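(* Let $d\geq 2$, $0<\alpha<1$, and suppose that the directions $\varepsilon_k$ are uniformly distributed on $S^{d-1}$. Let $Z_\alpha=\bigoplus_{k=1}^{\infty}\Gamma_k^{-1/\alpha}[0,\varepsilon_k]$ and let $F_\alpha=\operatorname{ext}Z_\alpha$ be the set of its extreme points. Then, almost surely, $$\dim_{\mathrm H} F_\alpha=(d-1)\alpha .$$
   Context: $S^{d-1}$ is the unit sphere of $\mathbb R^d$. Let $\tau_1,\tau_2,\dots$ be independent standard exponential random variables, $\Gamma_k=\tau_1+\cdots+\tau_k$ (successive arrival times of a standard Poisson process on $(0,\infty)$), and let $\varepsilon_1,\varepsilon_2,\dots$ be independent random points of $S^{d-1}$, each with the uniform (rotation-invariant) probability law, independent of $(\tau_k)$. Put $\gamma_k=\Gamma_k^{-1/\alpha}$; since $0<\alpha<1$, $\sum_k\gamma_k<\infty$ almost surely. Here $[0,x]$ is the segment $\{sx:0\le s\le 1\}$, $\oplus$ is Minkowski addition, and $Z_\alpha=\bigoplus_{k\ge1}\gamma_k[0,\varepsilon_k]$ is the almost sure limit in the Hausdorff metric of the partial Minkowski sums $\bigoplus_{k\le n}\gamma_k[0,\varepsilon_k]$; it is a random compact convex set. A point $x$ of a compact convex set $K$ is extreme if $x=ty+(1-t)z$ with $y,z\in K$, $t\in(0,1)$ implies $y=z=x$; $\operatorname{ext}K$ is the set of extreme points. $\dim_{\mathrm H}$ is Hausdorff dimension with respect to the Euclidean metric. *)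

theory Defs
  imports "HOL-Probability.Probability"
begin

subsection \<open>Hausdorff measure and dimension\<close>

text \<open>
  \<^term>\<open>0 powr 0 = 0\<close> for real numbers, so the case \<open>s = 0\<close> is spelled out: every nonempty
  covering set then counts 1, and \<open>\<H>\<^sup>0\<close> is the counting measure.
\<close>

definition hausdorff_gauge :: "real \<Rightarrow> 'a::metric_space set \<Rightarrow> ennreal" where
  "hausdorff_gauge s U =
     (if U = {} then 0 else if s = 0 then 1 else ennreal (diameter U powr s))"

text \<open>
  The requirement \<^const>\<open>bounded\<close> is not redundant: \<^const>\<open>diameter\<close> is real-valued and
  meaningless on unbounded sets. The sets \<open>U i\<close> may be empty, so finite covers are included.
\<close>

definition hausdorff_premeasure :: "real \<Rightarrow> real \<Rightarrow> 'a::metric_space set \<Rightarrow> ennreal" where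
  "hausdorff_premeasure \<delta> s A =
     (INF U \<in> {U :: nat \<Rightarrow> 'a set. A \<subseteq> (\<Union>i. U i) \<and> (\<forall>i. bounded (U i) \<and> diameter (U i) \<le> \<delta>)}.
        \<Sum>i. hausdorff_gauge s (U i))"

definition hausdorff_measure :: "real \<Rightarrow> 'a::metric_space set \<Rightarrow> ennreal" where
  "hausdorff_measure s A = (SUP \<delta> \<in> {0<..}. hausdorff_premeasure \<delta> s A)"

definition hausdorff_dim :: "'a::metric_space set \<Rightarrow> ennreal" where
  "hausdorff_dim A = (INF s \<in> {s. 0 \<le> s \<and> hausdorff_measure s A = 0}. ennreal s)"


subsection \<open>Limits in the Hausdorff metric\<close>

text \<open>To be used for nonempty bounded sets only.\<close>

definition hausdorff_dist :: "'a::metric_space set \<Rightarrow> 'a set \<Rightarrow> real" where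
  "hausdorff_dist A B = max (SUP a\<in>A. infdist a B) (SUP b\<in>B. infdist b A)"

definition hausdorff_lim :: "(nat \<Rightarrow> 'a::metric_space set) \<Rightarrow> 'a set" where
  "hausdorff_lim A =
     (THE K. compact K \<and> K \<noteq> {} \<and> (\<lambda>n. hausdorff_dist (A n) K) \<longlonglongrightarrow> 0)"


subsection \<open>The uniform law on the unit sphere\<close>

definition uniform_on_sphere :: "'a::euclidean_space measure \<Rightarrow> bool" where
  "uniform_on_sphere \<mu> \<longleftrightarrow>
     prob_space \<mu> \<and> sets \<mu> = sets borel \<and> measure \<mu> (sphere 0 1) = 1 \<and>
     (\<forall>f. orthogonal_transformation f \<longrightarrow> distr \<mu> borel f = \<mu>)"


subsection \<open>The random zonoid\<close>

text \<open>
  Indices start at 0: \<open>\<tau> k\<close> is the waiting time for the arrival number \<open>k + 1\<close>, and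
  \<open>arrival_time \<tau> k\<close> is the time of that arrival.
\<close>

definition arrival_time :: "(nat \<Rightarrow> 'w \<Rightarrow> real) \<Rightarrow> nat \<Rightarrow> 'w \<Rightarrow> real" where
  "arrival_time \<tau> k \<omega> = (\<Sum>i\<le>k. \<tau> i \<omega>)"

text \<open>The sum below is over sets, i.e. it is the Minkowski sum from \<^theory>\<open>HOL-Library.Set_Algebras\<close>.\<close>

definition partial_zonotope ::
    "real \<Rightarrow> (nat \<Rightarrow> 'w \<Rightarrow> real) \<Rightarrow> (nat \<Rightarrow> 'w \<Rightarrow> 'a::euclidean_space) \<Rightarrow> nat \<Rightarrow> 'w \<Rightarrow> 'a set" where
  "partial_zonotope \<alpha> \<tau> \<epsilon> n \<omega> =
     (\<Sum>k<n. (*\<^sub>R) (arrival_time \<tau> k \<omega> powr (- 1 / \<alpha>)) ` closed_segment 0 (\<epsilon> k \<omega>))"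

definition stable_zonoid ::
    "real \<Rightarrow> (nat \<Rightarrow> 'w \<Rightarrow> real) \<Rightarrow> (nat \<Rightarrow> 'w \<Rightarrow> 'a::euclidean_space) \<Rightarrow> 'w \<Rightarrow> 'a set" where
  "stable_zonoid \<alpha> \<tau> \<epsilon> \<omega> = hausdorff_lim (\<lambda>n. partial_zonotope \<alpha> \<tau> \<epsilon> n \<omega>)"

end

theory Submission
  imports Defs
begin

text \<open>
  Write \<open>\<beta> = 1 / \<alpha>\<close>, let \<open>d\<close> be the dimension of the space, and let \<open>\<gamma> k\<close> be the length of segment
  \<open>k\<close>. The zonoid consists of the sums \<open>\<Sum>k. \<gamma> k * s k * \<epsilon> k\<close> with weights \<open>s k\<close> in \<open>[0, 1]\<close>. A
  direction \<open>u\<close> that is orthogonal to no \<open>\<epsilon> k\<close> exposes a single point \<open>vertex u\<close>, whose weight \<open>s k\<close>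
  is 1 or 0 according to the sign of \<open>u \<bullet> \<epsilon> k\<close>. For two directions at distance \<open>1 / n\<close> these signs
  differ with probability of order \<open>1 / n\<close>, so the first index at which they differ is of order \<open>n\<close>
  and the two vertices are about \<open>n powr - \<beta>\<close> apart. Hence \<open>vertex\<close> maps \<open>n ^ (d - 1)\<close> cells of size
  \<open>1 / n\<close> to pieces of size \<open>n powr - \<beta>\<close>, and the dimension is \<open>(d - 1) / \<beta> = (d - 1) * \<alpha>\<close>.

  The lengths matter only up to constants: almost surely \<open>\<gamma> k\<close> lies between two multiples of
  \<open>(k + 1) powr - \<beta>\<close> (\<open>arrival_time_linear_growth\<close>). The random directions are
  therefore studied with these deterministic lengths, and for every fixed outcome the rest is a
  statement about one sequence of segments (locale \<open>segment_sum\<close>).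

  Upper bound. An extreme point has weights 0 or 1 and maximises some direction \<open>u\<close>
  (\<open>extreme_point_signs\<close>). If \<open>u\<close> lies in a cell of size \<open>1 / n\<close> around \<open>c\<close>, then \<open>c\<close> determines
  \<open>s k\<close> unless \<open>\<epsilon> k\<close> is nearly orthogonal to \<open>c\<close>, in which case \<open>\<epsilon> k\<close> is said to hit the cell. Among
  the first \<open>n\<close> indices all patterns of the hits are listed, and the total length of the later hits is
  the radius of a ball around each pattern (\<open>extreme_point_near_pattern\<close>). A cell receives on average
  boundedly many early hits and a later length of order \<open>n powr - \<beta>\<close>, with exponential moments
  (\<open>exp_moment_hits_le\<close>), so the sum of the diameters to the power \<open>s\<close> is about
  \<open>n powr (d - 1 - \<beta> * s)\<close>.

  Lower bound. Let \<open>\<sigma>\<close> be the law of a random direction. If \<open>u\<close> and \<open>v\<close> see \<open>\<epsilon> k\<close> with different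
  signs, and \<open>\<epsilon> k\<close> is not nearly orthogonal to \<open>u - v\<close>, then their vertices are at least a multiple
  of \<open>\<gamma> k\<close> apart (\<open>vertex_dist_ge\<close>). That this fails for all \<open>k < n\<close> has probability at most
  \<open>exp (- c * dist u v * n)\<close>, whose integral over \<open>v\<close> is of order \<open>1 / n ^ (d - 1)\<close>. So a ball of
  radius \<open>n powr - \<beta>\<close> around a vertex contains the vertices of directions of mass at most about
  \<open>1 / n ^ (d - 1)\<close>, and the mass distribution principle (\<open>hausdorff_measure_pos_of_mass\<close>) applies.

  In both halves expectations become almost sure bounds, at the price of a factor \<open>(j + 1)\<^sup>2\<close> for
  \<open>n = 2 ^ j\<close> (\<open>AE_quadratic_growth\<close>), which disappears in the geometric factor of the estimate. The
  required masses of slabs and caps under the uniform law follow from rotation invariance alone, by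
  averaging over a finite family of directions and counting (\<open>uniform_on_sphere_averaging\<close>).
\<close>

section \<open>The uniform law on the sphere\<close>


text \<open>
  The map is the reflection in the hyperplane orthogonal to \<open>u - v\<close>. The last clause makes it possible
  to move the second vector of an orthonormal pair while the first stays in place.
\<close>

lemma reflection_exists:
  fixes u v :: "'a::euclidean_space"
  assumes "norm u = norm v"
  obtains f where "orthogonal_transformation f" "f u = v"
    "\<And>w. w \<bullet> u = 0 \<Longrightarrow> w \<bullet> v = 0 \<Longrightarrow> f w = w"
proof (cases "u = v")
  case True
  show ?thesis
    by (rule that[of id]) (auto simp: True orthogonal_transformation_def linear_iff)
next
  case False
  define a where "a = u - v"
  define f where "f = (\<lambda>x. x - (2 * (a \<bullet> x) / (a \<bullet> a)) *\<^sub>R a)"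
  have a0: "a \<bullet> a \<noteq> 0" using False by (simp add: a_def)
  have lin: "linear f"
    unfolding linear_iff f_def
    by (auto simp: inner_simps field_simps scaleR_add_left scaleR_diff_right add_divide_distrib)
  have "f x \<bullet> f y = x \<bullet> y" for x y
    using a0 unfolding f_def
    by (simp add: inner_simps inner_commute field_simps power2_eq_square)
  then have o: "orthogonal_transformation f" using lin by (simp add: orthogonal_transformation_def)
  have "u \<bullet> u = v \<bullet> v" using assms by (simp add: norm_eq_sqrt_inner)
  then have "2 * (a \<bullet> u) = a \<bullet> a" by (simp add: a_def inner_simps inner_commute)
  then have "f u = v" using a0 unfolding f_def by (simp add: a_def)
  moreover have "f w = w" if "w \<bullet> u = 0" "w \<bullet> v = 0" for w
    using that by (simp add: f_def a_def inner_simps inner_commute)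
  ultimately show ?thesis using o that by blast
qed

lemma uniform_on_sphereD:
  assumes "uniform_on_sphere \<mu>"
  shows "prob_space \<mu>" "sets \<mu> = sets borel" "space \<mu> = UNIV" "AE e in \<mu>. norm e = 1"
proof -
  show "prob_space \<mu>" and s: "sets \<mu> = sets borel"
    using assms by (auto simp: uniform_on_sphere_def)
  show "space \<mu> = UNIV" using sets_eq_imp_space_eq[OF s] by simp
  interpret prob_space \<mu> by fact
  have "AE e in \<mu>. e \<in> sphere 0 1"
    using assms by (intro AE_prob_1) (auto simp: uniform_on_sphere_def)
  then show "AE e in \<mu>. norm e = 1" by eventually_elim auto
qed

lemma uniform_on_sphere_invariant:
  fixes f :: "'a::euclidean_space \<Rightarrow> 'a"
  assumes "uniform_on_sphere \<mu>" "orthogonal_transformation f" "A \<in> sets borel"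
  shows "measure \<mu> {e. f e \<in> A} = measure \<mu> A"
proof -
  have f: "f \<in> borel_measurable borel"
    using assms(2) by (intro borel_measurable_continuous_onI linear_continuous_on)
      (auto simp: orthogonal_transformation_def linear_conv_bounded_linear)
  have d: "distr \<mu> borel f = \<mu>" using assms by (auto simp: uniform_on_sphere_def)
  have "measure \<mu> A = measure (distr \<mu> borel f) A" by (simp add: d)
  also have "\<dots> = measure \<mu> (f -` A \<inter> space \<mu>)"
    using assms f uniform_on_sphereD(2)[OF assms(1)]
    by (intro measure_distr) (auto cong: measurable_cong_sets)
  finally show ?thesis using uniform_on_sphereD(3)[OF assms(1)] by (simp add: vimage_def)
qed

text \<open>
  By invariance the mass of \<open>{e. R e u}\<close> is the same for every unit vector \<open>u\<close>, in particular for all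
  \<open>g k\<close>. Adding these masses up, a bound on the mass reduces to counting, for one fixed \<open>e\<close>, the
  indices \<open>k\<close> with \<open>R e (g k)\<close>.
\<close>

lemma uniform_on_sphere_averaging:
  fixes R :: "'a::euclidean_space \<Rightarrow> 'a \<Rightarrow> bool" and g :: "'k \<Rightarrow> 'a"
  assumes \<mu>: "uniform_on_sphere \<mu>" and u: "norm u = 1"
    and meas: "\<And>v. {e. R e v} \<in> sets borel"
    and inv: "\<And>f e v. orthogonal_transformation f \<Longrightarrow> R (f e) (f v) = R e v"
    and K: "finite K" and g: "\<And>k. k \<in> K \<Longrightarrow> norm (g k) = 1"
  shows "real (card K) * measure \<mu> {e. R e u} = (\<integral>e. real (card {k\<in>K. R e (g k)}) \<partial>\<mu>)"
proof -
  interpret prob_space \<mu> using \<mu> by (rule uniform_on_sphereD)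
  note [simp] = uniform_on_sphereD(2,3)[OF \<mu>]
  have eq: "measure \<mu> {e. R e (g k)} = measure \<mu> {e. R e u}" if k: "k \<in> K" for k
  proof -
    obtain f where f: "orthogonal_transformation f" "f u = g k"
      using reflection_exists[of u "g k"] u g[OF k] by metis
    have "measure \<mu> {e. R e (g k)} = measure \<mu> {e. f e \<in> {e. R e (g k)}}"
      by (rule uniform_on_sphere_invariant[OF \<mu> f(1) meas, symmetric])
    then show ?thesis using inv[OF f(1), of _ u] f(2) by simp
  qed
  have "(\<integral>e. real (card {k\<in>K. R e (g k)}) \<partial>\<mu>) = (\<integral>e. (\<Sum>k\<in>K. indicator {e. R e (g k)} e) \<partial>\<mu>)"
    using K by (intro Bochner_Integration.integral_cong) (auto simp: indicator_def sum.If_cases Int_def)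
  also have "\<dots> = (\<Sum>k\<in>K. measure \<mu> {e. R e (g k)})"
    using meas by (subst Bochner_Integration.integral_sum)
      (auto simp: emeasure_eq_measure integrable_indicator_iff)
  also have "\<dots> = real (card K) * measure \<mu> {e. R e u}" using eq by simp
  finally show ?thesis by simp
qed

lemma uniform_on_sphere_le:
  fixes R :: "'a::euclidean_space \<Rightarrow> 'a \<Rightarrow> bool" and g :: "'k \<Rightarrow> 'a"
  assumes \<mu>: "uniform_on_sphere \<mu>" and u: "norm u = 1"
    and meas: "\<And>v. {e. R e v} \<in> sets borel"
    and inv: "\<And>f e v. orthogonal_transformation f \<Longrightarrow> R (f e) (f v) = R e v"
    and K: "finite K" "K \<noteq> {}" and g: "\<And>k. k \<in> K \<Longrightarrow> norm (g k) = 1"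
    and le: "\<And>e. norm e = 1 \<Longrightarrow> real (card {k\<in>K. R e (g k)}) \<le> q * real (card K)"
  shows "measure \<mu> {e. R e u} \<le> q"
proof -
  interpret prob_space \<mu> using \<mu> by (rule uniform_on_sphereD)
  have "AE e in \<mu>. real (card {k\<in>K. R e (g k)}) \<le> q * real (card K)"
    using uniform_on_sphereD(4)[OF \<mu>] by eventually_elim (rule le)
  moreover have "0 \<le> q * real (card K)"
  proof -
    obtain e :: 'a where "norm e = 1" using vector_choose_size[of 1] by auto
    from le[OF this] show ?thesis by linarith
  qed
  ultimately have "(\<integral>e. real (card {k\<in>K. R e (g k)}) \<partial>\<mu>) \<le> (\<integral>e. q * real (card K) \<partial>\<mu>)"
    by (intro integral_mono_AE') auto
  also have "\<dots> = q * real (card K)" using prob_space by simp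
  finally have "real (card K) * measure \<mu> {e. R e u} \<le> q * real (card K)"
    using uniform_on_sphere_averaging[OF \<mu> u meas inv K(1) g] by simp
  then show ?thesis using K by (simp add: mult.commute card_gt_0_iff)
qed

lemma uniform_on_sphere_ge:
  fixes R :: "'a::euclidean_space \<Rightarrow> 'a \<Rightarrow> bool" and g :: "'k \<Rightarrow> 'a"
  assumes \<mu>: "uniform_on_sphere \<mu>" and u: "norm u = 1"
    and meas: "\<And>v. {e. R e v} \<in> sets borel"
    and inv: "\<And>f e v. orthogonal_transformation f \<Longrightarrow> R (f e) (f v) = R e v"
    and K: "finite K" and g: "\<And>k. k \<in> K \<Longrightarrow> norm (g k) = 1"
    and ex: "\<And>e. norm e = 1 \<Longrightarrow> \<exists>k\<in>K. R e (g k)"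
  shows "1 \<le> real (card K) * measure \<mu> {e. R e u}"
proof -
  interpret prob_space \<mu> using \<mu> by (rule uniform_on_sphereD)
  note [simp] = uniform_on_sphereD(2,3)[OF \<mu>]
  have "real (card K) * measure \<mu> {e. R e u} = (\<Sum>k\<in>K. measure \<mu> {e. R e (g k)})"
  proof -
    have "measure \<mu> {e. R e (g k)} = measure \<mu> {e. R e u}" if k: "k \<in> K" for k
      using uniform_on_sphere_averaging[OF \<mu> g[OF k] meas inv, of "{()}" "\<lambda>_. u"]
        uniform_on_sphere_averaging[OF \<mu> u meas inv, of "{()}" "\<lambda>_. u"] u by simp
    then show ?thesis by simp
  qed
  also have "\<dots> \<ge> measure \<mu> (\<Union>k\<in>K. {e. R e (g k)})"
    using K meas by (intro finite_measure_subadditive_finite) auto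
  moreover have "measure \<mu> (\<Union>k\<in>K. {e. R e (g k)}) = 1"
  proof -
    have "AE e in \<mu>. e \<in> (\<Union>k\<in>K. {e. R e (g k)})"
      using uniform_on_sphereD(4)[OF \<mu>] by eventually_elim (use ex in auto)
    then show ?thesis using K meas by (intro prob_eq_1[THEN iffD2]) auto
  qed
  ultimately show ?thesis by linarith
qed

section \<open>Slabs, splitting events and caps\<close>

text \<open>
  In a coordinate plane, the directions \<open>(i / n) p + q\<close> and \<open>p + (i / n) q\<close> with \<open>\<bar>i\<bar> \<le> n\<close> run along
  two sides of a square, and every \<open>e\<close> is within \<open>1 / n\<close> of being orthogonal to one of them. These are
  \<open>4 n + 2\<close> directions, with \<open>n\<close> of the order of \<open>1 / a\<close>.
\<close>

lemma uniform_slab_ge: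
  fixes u :: "'a::euclidean_space"
  assumes \<mu>: "uniform_on_sphere \<mu>" and u: "norm u = 1" and D: "2 \<le> DIM('a)"
    and a: "0 < a" "a \<le> 1"
  shows "a / 12 \<le> measure \<mu> {e. \<bar>e \<bullet> u\<bar> < a}"
proof -
  obtain p q :: 'a where pq: "p \<in> Basis" "q \<in> Basis" "p \<noteq> q"
    by (metis D card_le_Suc0_iff_eq finite_Basis not_less_eq_eq numeral_2_eq_2)
  then have ip [simp]: "p \<bullet> p = 1" "q \<bullet> q = 1" "p \<bullet> q = 0" "q \<bullet> p = 0"
    by (auto simp: inner_not_same_Basis)
  define n where "n = nat \<lfloor>1 / a\<rfloor> + 1"
  have n: "1 / real n < a" "real n \<le> 2 / a" "n > 0"
  proof -
    have "0 \<le> 1 / a" using a by simp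
    then have "1 / a < real n" "real n \<le> 1 / a + 1" unfolding n_def by linarith+
    moreover have "1 \<le> 1 / a" using a by simp
    moreover show "n > 0" by (simp add: n_def)
    ultimately show "1 / real n < a" "real n \<le> 2 / a"
      using a by (auto simp: field_simps)
  qed
  define w :: "int \<times> bool \<Rightarrow> 'a" where
    "w = (\<lambda>(i, t). if t then (of_int i / real n) *\<^sub>R p + q else p + (of_int i / real n) *\<^sub>R q)"
  let ?K = "{- int n..int n} \<times> (UNIV :: bool set)"
  have w1: "1 \<le> norm (w k)" for k
  proof (cases k)
    case (Pair i t)
    have "\<bar>w k \<bullet> (if t then q else p)\<bar> = 1"
      by (auto simp: w_def Pair inner_simps)
    moreover have "\<bar>w k \<bullet> (if t then q else p)\<bar> \<le> norm (w k)"
      using Basis_le_norm[of "if t then q else p" "w k"] pq by auto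
    ultimately show ?thesis by simp
  qed
  have near: "\<exists>i\<in>{- int n..int n}. \<bar>of_int i / real n * x + y\<bar> < a"
    if "\<bar>y\<bar> \<le> \<bar>x\<bar>" "\<bar>x\<bar> \<le> 1" for x y :: real
  proof (cases "x = 0")
    case True then show ?thesis using that a by (intro bexI[of _ 0]) auto
  next
    case False
    define s where "s = - y / x"
    have s: "\<bar>s\<bar> \<le> 1" using that False by (simp add: s_def)
    define i where "i = \<lfloor>s * real n\<rfloor>"
    have "\<bar>s * real n\<bar> \<le> real n"
      using mult_right_mono[OF s, of "real n"] by (simp add: abs_mult)
    then have i: "i \<in> {- int n..int n}" unfolding i_def by (auto simp: le_floor_iff floor_le_iff)
    have "\<bar>of_int i - s * real n\<bar> \<le> 1" unfolding i_def by linarith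
    then have "\<bar>of_int i - s * real n\<bar> / real n \<le> 1 / real n"
      by (rule divide_right_mono) simp
    also have "\<bar>of_int i - s * real n\<bar> / real n = \<bar>(of_int i - s * real n) / real n\<bar>" by simp
    also have "(of_int i - s * real n) / real n = of_int i / real n - s"
      using n(3) by (simp add: diff_divide_distrib)
    finally have "\<bar>of_int i / real n - s\<bar> \<le> 1 / real n" .
    then have "\<bar>of_int i / real n - s\<bar> * \<bar>x\<bar> \<le> 1 / real n * 1"
      using that by (intro mult_mono) auto
    moreover have "of_int i / real n * x + y = (of_int i / real n - s) * x"
      using False by (simp add: s_def field_simps)
    ultimately have "\<bar>of_int i / real n * x + y\<bar> < a" using n(1) by (simp add: abs_mult)
    with i show ?thesis by blast
  qed
  have ex: "\<exists>k\<in>?K. \<bar>e \<bullet> sgn (w k)\<bar> < a" if e: "norm e = 1" for e :: 'a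
  proof -
    have b: "\<bar>e \<bullet> p\<bar> \<le> 1" "\<bar>e \<bullet> q\<bar> \<le> 1" using Basis_le_norm[of _ e] pq e by auto
    have "\<exists>k\<in>?K. \<bar>e \<bullet> w k\<bar> < a"
    proof (cases "\<bar>e \<bullet> q\<bar> \<le> \<bar>e \<bullet> p\<bar>")
      case True
      from near[OF True b(1)] obtain i where "i \<in> {- int n..int n}"
        "\<bar>of_int i / real n * (e \<bullet> p) + e \<bullet> q\<bar> < a" by blast
      then show ?thesis by (intro bexI[of _ "(i, True)"]) (auto simp: w_def inner_simps)
    next
      case False
      then have "\<bar>e \<bullet> p\<bar> \<le> \<bar>e \<bullet> q\<bar>" by simp
      from near[OF this b(2)] obtain i where "i \<in> {- int n..int n}"
        "\<bar>of_int i / real n * (e \<bullet> q) + e \<bullet> p\<bar> < a" by blast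
      then show ?thesis by (intro bexI[of _ "(i, False)"]) (auto simp: w_def inner_simps add.commute)
    qed
    then obtain k where k: "k \<in> ?K" "\<bar>e \<bullet> w k\<bar> < a" by blast
    have "\<bar>e \<bullet> sgn (w k)\<bar> = \<bar>e \<bullet> w k\<bar> / norm (w k)"
      by (simp add: sgn_div_norm divide_inverse abs_mult mult.commute)
    also have "\<dots> \<le> \<bar>e \<bullet> w k\<bar>" using w1[of k] by (simp add: divide_le_eq mult_le_cancel_left1)
    finally show ?thesis using k by (intro bexI[of _ k]) auto
  qed
  have "1 \<le> real (card ?K) * measure \<mu> {e. \<bar>e \<bullet> u\<bar> < a}"
  proof (rule uniform_on_sphere_ge[OF \<mu> u, where R="\<lambda>e v. \<bar>e \<bullet> v\<bar> < a" and g="\<lambda>k. sgn (w k)"])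
    show "norm (sgn (w k)) = 1" for k using w1[of k] by (auto simp: norm_sgn)
    show "\<exists>k\<in>?K. \<bar>e \<bullet> sgn (w k)\<bar> < a" if "norm e = 1" for e using ex[OF that] .
  qed (auto simp: orthogonal_transformation_def)
  also have "real (card ?K) = 4 * real n + 2" by (simp add: card_cartesian_product)
  also have "(4 * real n + 2) * measure \<mu> {e. \<bar>e \<bullet> u\<bar> < a} \<le> (12 / a) * measure \<mu> {e. \<bar>e \<bullet> u\<bar> < a}"
  proof (rule mult_right_mono)
    have "4 * real n + 2 \<le> 6 * real n" using n(3) by simp
    also have "\<dots> \<le> 12 / a" using n(2) by simp
    finally show "4 * real n + 2 \<le> 12 / a" .
  qed simp
  finally show ?thesis using a by (simp add: field_simps)
qed

text \<open>
  The sign condition says that the segment in direction \<open>e\<close> contributes to the vertex of exactly one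
  of \<open>u\<close> and \<open>v\<close>. The second condition keeps \<open>e\<close> away from the orthogonal complement of \<open>u - v\<close>, so
  that this contribution shows in the component of the difference of the vertices along \<open>u - v\<close>.
\<close>

definition splits :: "real \<Rightarrow> 'a::euclidean_space \<Rightarrow> 'a \<Rightarrow> 'a \<Rightarrow> bool" where
  "splits \<eta> e u v \<longleftrightarrow> (e \<bullet> u) * (e \<bullet> v) < 0 \<and> \<eta> * dist u v \<le> \<bar>e \<bullet> (u - v)\<bar>"

text \<open>
  Let \<open>w\<close> and \<open>h\<close> be unit vectors along \<open>u + v\<close> and \<open>u - v\<close>, which are orthogonal (if \<open>u + v = 0\<close>,
  let \<open>w\<close> be any unit vector orthogonal to \<open>h\<close>). The event contains
  \<open>\<bar>e \<bullet> w\<bar> < a \<and> \<eta> < \<bar>e \<bullet> h\<bar>\<close> for \<open>a = \<eta> * dist u v / 2\<close>, and all orthonormal pairs give this the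
  same mass. For a pair \<open>p\<close>, \<open>q\<close> of basis vectors with \<open>p\<close> fixed, these events together cover the slab
  \<open>\<bar>e \<bullet> p\<bar> < a\<close>, because not all coordinates of a unit vector are at most \<open>\<eta>\<close>. So one of at most
  \<open>DIM('a)\<close> equal masses is at least a fixed fraction of the mass of the slab.
\<close>

lemma uniform_splits_ge:
  fixes u v :: "'a::euclidean_space"
  assumes \<mu>: "uniform_on_sphere \<mu>" and D: "2 \<le> DIM('a)" and u: "norm u = 1" and v: "norm v = 1"
    and \<eta>: "\<eta> = 1 / (real DIM('a) + 1)"
  shows "\<eta> / (24 * real DIM('a)) * dist u v \<le> measure \<mu> {e. splits \<eta> e u v}"
proof (cases "u = v")
  case False
  interpret prob_space \<mu> using \<mu> by (rule uniform_on_sphereD)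
  note [simp] = uniform_on_sphereD(2,3)[OF \<mu>]
  define \<delta> where "\<delta> = dist u v"
  have \<delta>: "0 < \<delta>" "\<delta> \<le> 2"
    using False norm_triangle_ineq4[of u v] u v by (auto simp: \<delta>_def dist_norm)
  have \<eta>0: "0 < \<eta>" "\<eta> \<le> 1" by (auto simp: \<eta>)
  define a where "a = \<delta> * \<eta> / 2"
  have a: "0 < a" "a \<le> \<eta>" "a \<le> 1" using \<delta> \<eta>0 mult_mono[of \<delta> 2 \<eta> 1] mult_right_mono[of \<delta> 2 \<eta>] by (auto simp: a_def)
  define h where "h = (1 / \<delta>) *\<^sub>R (u - v)"
  have h: "norm h = 1" using \<delta> by (simp add: h_def \<delta>_def dist_norm)
  have uv: "(u + v) \<bullet> (u - v) = 0"
    using u v by (simp add: inner_simps inner_commute flip: power2_norm_eq_inner)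
  obtain w where w: "norm w = 1" "w \<bullet> h = 0" and c: "\<exists>c. 0 \<le> c \<and> c \<le> 1 \<and> (1/2) *\<^sub>R (u + v) = c *\<^sub>R w"
  proof (cases "u + v = 0")
    case True
    obtain w' where w': "w' \<noteq> 0" "orthogonal h w'"
      using orthogonal_to_vector_exists[OF D] by blast
    then show ?thesis
      using True by (intro that[of "sgn w'"] exI[of _ 0])
        (auto simp: norm_sgn orthogonal_def sgn_div_norm inner_commute)
  next
    case False
    show ?thesis
    proof (rule that[of "sgn (u + v)"])
      show "norm (sgn (u + v)) = 1" using False by (simp add: norm_sgn)
      show "sgn (u + v) \<bullet> h = 0" using uv by (simp add: sgn_div_norm h_def)
      have "norm (u + v) \<le> 2" using norm_triangle_ineq[of u v] u v by simp
      then show "\<exists>c. 0 \<le> c \<and> c \<le> 1 \<and> (1/2) *\<^sub>R (u + v) = c *\<^sub>R sgn (u + v)"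
        using False by (intro exI[of _ "norm (u + v) / 2"]) (auto simp: sgn_div_norm)
    qed
  qed
  from c obtain c where c: "0 \<le> c" "c \<le> 1" "(1/2) *\<^sub>R (u + v) = c *\<^sub>R w" by blast
  define E where "E p q = {e :: 'a. \<bar>e \<bullet> p\<bar> < a \<and> \<eta> < \<bar>e \<bullet> q\<bar>}" for p q
  have Em [measurable]: "E p q \<in> sets borel" for p q unfolding E_def by measurable
  have E_eq: "measure \<mu> (E w h) = measure \<mu> (E p q)" if pq: "norm p = 1" "norm q = 1" "q \<bullet> p = 0" for p q
  proof -
    obtain f where f: "orthogonal_transformation f" "f w = p"
      using reflection_exists[of w p] w pq by metis
    have fh: "f h \<bullet> p = 0" "norm (f h) = norm q"
      using f w(2) h pq by (auto simp: orthogonal_transformation_def inner_commute norm_eq_sqrt_inner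
          simp flip: f(2)) 
    obtain g where g: "orthogonal_transformation g" "g (f h) = q" "g p = p"
      using reflection_exists[OF fh(2)] fh(1) pq(3) by (metis inner_commute)
    have gf: "orthogonal_transformation (g \<circ> f)"
      using f(1) g(1) orthogonal_transformation_compose by blast
    have "measure \<mu> (E p q) = measure \<mu> {e. (g \<circ> f) e \<in> E p q}"
      by (rule uniform_on_sphere_invariant[OF \<mu> gf Em, symmetric])
    also have "{e. (g \<circ> f) e \<in> E p q} = E w h"
    proof -
      have "(g \<circ> f) e \<bullet> p = e \<bullet> w" "(g \<circ> f) e \<bullet> q = e \<bullet> h" for e
        using gf f(2) g(2,3) unfolding orthogonal_transformation_def by (metis comp_apply)+
      then show ?thesis by (auto simp: E_def)
    qed
    finally show ?thesis by simp
  qed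
  obtain p :: 'a where p: "p \<in> Basis" using nonempty_Basis by blast
  have "a / 12 \<le> measure \<mu> {e. \<bar>e \<bullet> p\<bar> < a}" using uniform_slab_ge[OF \<mu> _ D a(1,3)] p by simp
  also have "\<dots> \<le> measure \<mu> (\<Union>q\<in>Basis - {p}. E p q)"
  proof (rule finite_measure_mono_AE)
    show "AE e in \<mu>. e \<in> {e. \<bar>e \<bullet> p\<bar> < a} \<longrightarrow> e \<in> (\<Union>q\<in>Basis - {p}. E p q)"
      using uniform_on_sphereD(4)[OF \<mu>]
    proof eventually_elim
      case (elim e)
      show ?case
      proof (rule ccontr)
        assume "\<not> ?thesis"
        then have "\<bar>e \<bullet> q\<bar> \<le> \<eta>" if "q \<in> Basis" for q
          using that a(2) by (cases "q = p") (auto simp: E_def not_less)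
        then have "(e \<bullet> q)\<^sup>2 \<le> \<eta>\<^sup>2" if "q \<in> Basis" for q
          using that \<eta>0 power_mono[of "\<bar>e \<bullet> q\<bar>" \<eta> 2] by simp
        then have "(\<Sum>q\<in>Basis. (e \<bullet> q)\<^sup>2) \<le> (\<Sum>q\<in>(Basis::'a set). \<eta>\<^sup>2)" by (rule sum_mono)
        moreover have "(\<Sum>q\<in>Basis. (e \<bullet> q)\<^sup>2) = 1"
          using elim euclidean_inner[of e e] by (simp add: power2_eq_square norm_eq_1)
        ultimately have "1 \<le> real DIM('a) * \<eta>\<^sup>2" by simp
        then have "(real DIM('a) + 1)\<^sup>2 \<le> real DIM('a)" by (simp add: \<eta> field_simps)
        moreover have "real DIM('a) < (real DIM('a) + 1)\<^sup>2"
          by (simp add: power2_eq_square algebra_simps add_strict_increasing2)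
        ultimately show False by simp
      qed
    qed
    show "(\<Union>q\<in>Basis - {p}. E p q) \<in> events" using Em by auto
  qed
  also have "\<dots> \<le> (\<Sum>q\<in>Basis - {p}. measure \<mu> (E p q))"
    using Em by (intro finite_measure_subadditive_finite) auto
  also have "\<dots> = (\<Sum>q\<in>Basis - {p}. measure \<mu> (E w h))"
    using p by (intro sum.cong refl E_eq[symmetric]) (auto simp: inner_not_same_Basis)
  also have "\<dots> \<le> real DIM('a) * measure \<mu> (E w h)"
    using p by (simp add: mult_right_mono card_Diff_subset)
  also have "\<dots> \<le> real DIM('a) * measure \<mu> {e. splits \<eta> e u v}"
  proof (intro mult_left_mono finite_measure_mono subsetI)
    fix e assume e: "e \<in> E w h"
    have "u = c *\<^sub>R w + (\<delta> / 2) *\<^sub>R h" "v = c *\<^sub>R w - (\<delta> / 2) *\<^sub>R h"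
      using \<delta> by (auto simp: h_def simp flip: c(3) scaleR_add_left) (auto simp: algebra_simps simp flip: scaleR_add_left)
    then have eu: "e \<bullet> u = c * (e \<bullet> w) + \<delta> / 2 * (e \<bullet> h)" and ev: "e \<bullet> v = c * (e \<bullet> w) - \<delta> / 2 * (e \<bullet> h)"
      by (metis inner_add_right inner_diff_right inner_scaleR_right)+
    have "\<bar>c * (e \<bullet> w)\<bar> \<le> \<bar>e \<bullet> w\<bar>" using c by (simp add: abs_mult mult_left_le_one_le)
    also have "\<dots> < \<delta> / 2 * \<eta>" using e by (simp add: E_def a_def)
    also have "\<dots> \<le> \<bar>\<delta> / 2 * (e \<bullet> h)\<bar>" using e \<delta> by (simp add: E_def abs_mult)
    finally have "\<bar>c * (e \<bullet> w)\<bar>\<^sup>2 < \<bar>\<delta> / 2 * (e \<bullet> h)\<bar>\<^sup>2" by (intro power_strict_mono) auto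
    then have "(e \<bullet> u) * (e \<bullet> v) < 0" by (simp add: eu ev power2_eq_square algebra_simps)
    moreover have "\<eta> * dist u v \<le> \<bar>e \<bullet> (u - v)\<bar>"
      using e \<delta> by (simp add: inner_diff_right eu ev E_def \<delta>_def[symmetric] abs_mult)
    ultimately show "e \<in> {e. splits \<eta> e u v}" by (simp add: splits_def)
  qed (auto simp: splits_def)
  finally have "a / 12 \<le> real DIM('a) * measure \<mu> {e. splits \<eta> e u v}" .
  then show ?thesis using D by (simp add: a_def \<delta>_def field_simps)
qed (simp add: splits_def)

lemma card_nat_near:
  assumes "0 \<le> t"
  shows "finite {k::nat. \<bar>real k - c\<bar> \<le> t}" "real (card {k::nat. \<bar>real k - c\<bar> \<le> t}) \<le> 2 * t + 1"
proof -
  let ?S = "{k::nat. \<bar>real k - c\<bar> \<le> t}"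
  have sub: "int ` ?S \<subseteq> {\<lceil>c - t\<rceil>..\<lfloor>c + t\<rfloor>}" by (auto simp: ceiling_le_iff le_floor_iff)
  have "finite (int ` ?S)" using sub by (rule finite_subset) simp
  then show "finite ?S" by (simp add: finite_image_iff)
  have "card ?S = card (int ` ?S)" by (simp add: card_image)
  also have "\<dots> \<le> card {\<lceil>c - t\<rceil>..\<lfloor>c + t\<rfloor>}" using sub by (intro card_mono) auto
  also have "\<dots> = nat (\<lfloor>c + t\<rfloor> + 1 - \<lceil>c - t\<rceil>)" by simp
  finally have "real (card ?S) \<le> real (nat (\<lfloor>c + t\<rfloor> + 1 - \<lceil>c - t\<rceil>))" by simp
  also have "\<dots> \<le> 2 * t + 1" using assms by linarith
  finally show "real (card ?S) \<le> 2 * t + 1" .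
qed

text \<open>
  The coordinates outside \<open>L\<close> are arbitrary, and once they are chosen each coordinate in \<open>L\<close> is confined
  to an interval of length \<open>2 * t\<close>. With \<open>L\<close> a single coordinate this counts the lattice points near a
  hyperplane, with all coordinates but one in \<open>L\<close> those near a line.
\<close>

lemma card_lattice_near_graph:
  fixes S :: "('b \<Rightarrow> nat) set"
  assumes B: "finite B" "L \<subseteq> B" and S: "S \<subseteq> (B \<rightarrow>\<^sub>E {1..m})" and t: "0 \<le> t"
    and near: "\<And>\<kappa> l. \<kappa> \<in> S \<Longrightarrow> l \<in> L \<Longrightarrow> \<bar>real (\<kappa> l) - c (restrict \<kappa> (B - L)) l\<bar> \<le> t"
  shows "real (card S) \<le> real m ^ card (B - L) * (2 * t + 1) ^ card L"
proof -
  define R where "R = ((B - L) \<rightarrow>\<^sub>E {1..m})"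
  define I where "I \<rho> = (\<Pi>\<^sub>E l\<in>L. {k::nat. \<bar>real k - c \<rho> l\<bar> \<le> t})" for \<rho>
  have L: "finite L" using B finite_subset by blast
  have finR: "finite R" unfolding R_def using B by (intro finite_PiE) auto
  have finI: "finite (I \<rho>)" for \<rho> unfolding I_def using L card_nat_near(1)[OF t] by (intro finite_PiE) auto
  have "inj_on (\<lambda>\<kappa>. (restrict \<kappa> (B - L), restrict \<kappa> L)) S"
  proof (rule inj_onI)
    fix \<kappa> \<kappa>' assume *: "\<kappa> \<in> S" "\<kappa>' \<in> S" "(restrict \<kappa> (B - L), restrict \<kappa> L) = (restrict \<kappa>' (B - L), restrict \<kappa>' L)"
    show "\<kappa> = \<kappa>'"
    proof
      fix x
      have eq: "restrict \<kappa> (B - L) x = restrict \<kappa>' (B - L) x" "restrict \<kappa> L x = restrict \<kappa>' L x"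
        using *(3) by auto
      have "\<kappa> x = undefined" "\<kappa>' x = undefined" if "x \<notin> B"
        using * S that by (auto simp: subset_iff PiE_iff extensional_def)
      with eq show "\<kappa> x = \<kappa>' x" by (cases "x \<in> L"; cases "x \<in> B") auto
    qed
  qed
  moreover have "(\<lambda>\<kappa>. (restrict \<kappa> (B - L), restrict \<kappa> L)) ` S \<subseteq> Sigma R I"
  proof (rule image_subsetI)
    fix \<kappa> assume \<kappa>: "\<kappa> \<in> S"
    then have "\<kappa> \<in> B \<rightarrow>\<^sub>E {1..m}" using S by blast
    then have "restrict \<kappa> (B - L) \<in> R" unfolding R_def by (auto simp: PiE_iff)
    moreover have "restrict \<kappa> L \<in> I (restrict \<kappa> (B - L))"
      unfolding I_def using near[OF \<kappa>] by (auto simp: PiE_iff)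
    ultimately show "(restrict \<kappa> (B - L), restrict \<kappa> L) \<in> Sigma R I" by blast
  qed
  ultimately have "card S \<le> card (Sigma R I)"
    using finR finI by (intro card_inj_on_le) auto
  also have "\<dots> = (\<Sum>\<rho>\<in>R. card (I \<rho>))" using finR finI by simp
  finally have "real (card S) \<le> (\<Sum>\<rho>\<in>R. real (card (I \<rho>)))" by (simp flip: of_nat_sum)
  also have "\<dots> \<le> (\<Sum>\<rho>\<in>R. (2 * t + 1) ^ card L)"
  proof (rule sum_mono)
    fix \<rho>
    have "real (card (I \<rho>)) = (\<Prod>l\<in>L. real (card {k::nat. \<bar>real k - c \<rho> l\<bar> \<le> t}))"
      unfolding I_def using L by (simp add: card_PiE)
    also have "\<dots> \<le> (\<Prod>l\<in>L. 2 * t + 1)" using card_nat_near(2)[OF t] by (intro prod_mono) auto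
    finally show "real (card (I \<rho>)) \<le> (2 * t + 1) ^ card L" by simp
  qed
  also have "\<dots> = real m ^ card (B - L) * (2 * t + 1) ^ card L"
    unfolding R_def using B by (simp add: card_PiE)
  finally show ?thesis .
qed

lemma unit_vector_large_coordinate:
  fixes e :: "'a::euclidean_space"
  assumes "norm e = 1"
  obtains j where "j \<in> Basis" "1 / real DIM('a) \<le> \<bar>e \<bullet> j\<bar>"
proof (rule ccontr)
  assume "\<not> thesis"
  then have "\<bar>e \<bullet> j\<bar> < 1 / real DIM('a)" if "j \<in> Basis" for j
    using \<open>\<And>j. j \<in> Basis \<Longrightarrow> 1 / real DIM('a) \<le> \<bar>e \<bullet> j\<bar> \<Longrightarrow> thesis\<close> that not_le by blast
  then have "(\<Sum>j\<in>Basis. \<bar>e \<bullet> j\<bar>) < (\<Sum>j\<in>(Basis::'a set). 1 / real DIM('a))"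
    by (intro sum_strict_mono) auto
  then show False using norm_le_l1[of e] assms by simp
qed

definition lattice_point :: "('a::euclidean_space \<Rightarrow> nat) \<Rightarrow> 'a" where
  "lattice_point \<kappa> = (\<Sum>b\<in>Basis. real (\<kappa> b) *\<^sub>R b)"

lemma lattice_point:
  fixes \<kappa> :: "'a::euclidean_space \<Rightarrow> nat"
  assumes "\<kappa> \<in> Basis \<rightarrow>\<^sub>E {1..m}"
  shows "\<And>b. b \<in> Basis \<Longrightarrow> lattice_point \<kappa> \<bullet> b = real (\<kappa> b)"
    "0 < norm (lattice_point \<kappa>)" "norm (lattice_point \<kappa>) \<le> real DIM('a) * real m"
proof -
  show c: "lattice_point \<kappa> \<bullet> b = real (\<kappa> b)" if "b \<in> Basis" for b :: 'a
    using that by (simp add: lattice_point_def)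
  obtain b :: 'a where "b \<in> Basis" using nonempty_Basis by blast
  then show "0 < norm (lattice_point \<kappa>)" using c[of b] assms by (auto simp: PiE_iff)
  have "norm (lattice_point \<kappa>) \<le> (\<Sum>b\<in>Basis. \<bar>lattice_point \<kappa> \<bullet> b\<bar>)" by (rule norm_le_l1)
  also have "\<dots> \<le> (\<Sum>b\<in>(Basis::'a set). real m)"
    using assms by (intro sum_mono) (auto simp: c PiE_iff)
  finally show "norm (lattice_point \<kappa>) \<le> real DIM('a) * real m" by simp
qed

text \<open>
  The directions of the averaging are those of the lattice points in the cube \<open>{1..m}\<close>, where \<open>m\<close> is of
  the order of \<open>1 / \<delta>\<close>. The points nearly orthogonal to \<open>e\<close> are counted by solving for a coordinate
  in which \<open>e\<close> is large.
\<close>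

lemma uniform_slab_le_aux:
  fixes u :: "'a::euclidean_space"
  assumes \<mu>: "uniform_on_sphere \<mu>" and u: "norm u = 1" and \<delta>: "0 < \<delta>"
  shows "measure \<mu> {e. \<bar>e \<bullet> u\<bar> \<le> \<delta>} \<le> (2 * real DIM('a) ^ 2 + 1) * \<delta>"
proof -
  define D where "D = real DIM('a)"
  define m where "m = nat \<lceil>1 / \<delta>\<rceil>"
  have m: "1 \<le> \<delta> * real m" "m > 0"
  proof -
    have "1 / \<delta> \<le> real m" unfolding m_def by linarith
    then show "1 \<le> \<delta> * real m" using \<delta> by (simp add: field_simps)
    then show "m > 0" by (cases m) auto
  qed
  define K where "K = ((Basis :: 'a set) \<rightarrow>\<^sub>E {1..m})"
  have cK: "real (card K) = real m ^ DIM('a)" unfolding K_def by (simp add: card_PiE)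
  have "measure \<mu> {e. \<bar>e \<bullet> u\<bar> \<le> \<delta>} \<le> (2 * D ^ 2 + 1) * \<delta>"
  proof (rule uniform_on_sphere_le[OF \<mu> u, where R="\<lambda>e v. \<bar>e \<bullet> v\<bar> \<le> \<delta>" and K=K
        and g="\<lambda>\<kappa>. sgn (lattice_point \<kappa>)"])
    show "norm (sgn (lattice_point \<kappa>)) = 1" if "\<kappa> \<in> K" for \<kappa>
      using lattice_point(2)[of \<kappa> m] that by (auto simp: norm_sgn K_def)
    show "finite K" unfolding K_def by (intro finite_PiE) auto
    show "K \<noteq> {}" using cK m by auto
    fix e :: 'a assume e: "norm e = 1"
    obtain j where j: "j \<in> Basis" "1 / D \<le> \<bar>e \<bullet> j\<bar>"
      using unit_vector_large_coordinate[OF e] unfolding D_def by blast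
    have D0: "0 < D" by (simp add: D_def)
    have ej: "0 < \<bar>e \<bullet> j\<bar>" "1 \<le> D * \<bar>e \<bullet> j\<bar>"
      using j D0 less_le_trans[of 0 "1/D" "\<bar>e \<bullet> j\<bar>"] by (auto simp: field_simps)
    define S where "S = {\<kappa>\<in>K. \<bar>e \<bullet> sgn (lattice_point \<kappa>)\<bar> \<le> \<delta>}"
    define t where "t = \<delta> * D ^ 2 * real m"
    have "real (card S) \<le> real m ^ card (Basis - {j}) * (2 * t + 1) ^ card {j}"
    proof (rule card_lattice_near_graph[where
          c="\<lambda>\<rho> l. - (\<Sum>b\<in>Basis - {j}. real (\<rho> b) * (e \<bullet> b)) / (e \<bullet> j)"])
      show "S \<subseteq> (Basis \<rightarrow>\<^sub>E {1..m})" by (auto simp: S_def K_def)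
      show "0 \<le> t" using \<delta> D0 by (simp add: t_def)
      fix \<kappa> l assume \<kappa>: "\<kappa> \<in> S" and l: "l \<in> {j}"
      let ?w = "lattice_point \<kappa>"
      have \<kappa>K: "\<kappa> \<in> Basis \<rightarrow>\<^sub>E {1..m}" using \<kappa> by (auto simp: S_def K_def)
      note w = lattice_point[OF \<kappa>K]
      have "\<bar>e \<bullet> ?w\<bar> = \<bar>e \<bullet> sgn ?w\<bar> * norm ?w"
        using w(2) by (simp add: sgn_div_norm abs_mult)
      also have "\<dots> \<le> \<delta> * (D * real m)"
        using \<kappa> w \<delta> by (intro mult_mono) (auto simp: S_def D_def)
      finally have 1: "\<bar>e \<bullet> ?w\<bar> \<le> \<delta> * (D * real m)" .
      have "e \<bullet> ?w = (\<Sum>b\<in>Basis. real (\<kappa> b) * (e \<bullet> b))"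
        by (simp add: lattice_point_def inner_sum_right)
      also have "\<dots> = real (\<kappa> j) * (e \<bullet> j) + (\<Sum>b\<in>Basis - {j}. real (\<kappa> b) * (e \<bullet> b))"
        using j by (intro sum.remove) auto
      also have "(\<Sum>b\<in>Basis - {j}. real (\<kappa> b) * (e \<bullet> b))
          = (\<Sum>b\<in>Basis - {j}. real (restrict \<kappa> (Basis - {j}) b) * (e \<bullet> b))"
        by (intro sum.cong) auto
      finally have "\<bar>real (\<kappa> l) - - (\<Sum>b\<in>Basis - {j}. real (restrict \<kappa> (Basis - {j}) b) * (e \<bullet> b)) / (e \<bullet> j)\<bar>
          = \<bar>e \<bullet> ?w\<bar> / \<bar>e \<bullet> j\<bar>"
        using l ej by (simp add: field_simps flip: abs_divide)
      also have "\<dots> \<le> \<bar>e \<bullet> ?w\<bar> * D"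
      proof -
        have "\<bar>e \<bullet> ?w\<bar> * 1 \<le> \<bar>e \<bullet> ?w\<bar> * (D * \<bar>e \<bullet> j\<bar>)" using ej by (intro mult_left_mono) auto
        then show ?thesis using ej by (simp add: field_simps)
      qed
      also have "\<dots> \<le> (\<delta> * (D * real m)) * D" using 1 D0 by (intro mult_right_mono) auto
      also have "\<dots> = t" by (simp add: t_def power2_eq_square)
      finally show "\<bar>real (\<kappa> l) - - (\<Sum>b\<in>Basis - {j}. real (restrict \<kappa> (Basis - {j}) b) * (e \<bullet> b)) / (e \<bullet> j)\<bar> \<le> t" .
    qed (use j in auto)
    also have "\<dots> = real m ^ (DIM('a) - 1) * (2 * t + 1)" using j by simp
    also have "\<dots> \<le> real m ^ (DIM('a) - 1) * ((2 * D ^ 2 + 1) * \<delta> * real m)"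
      using m by (intro mult_left_mono) (auto simp: t_def algebra_simps)
    also have "\<dots> = (2 * D ^ 2 + 1) * \<delta> * real m ^ DIM('a)"
      using DIM_positive[where 'a='a] by (cases "DIM('a)") auto
    finally show "real (card {\<kappa>\<in>K. \<bar>e \<bullet> sgn (lattice_point \<kappa>)\<bar> \<le> \<delta>}) \<le> (2 * D ^ 2 + 1) * \<delta> * real (card K)"
      by (simp add: S_def cK)
  qed (auto simp: orthogonal_transformation_def)
  then show ?thesis by (simp add: D_def)
qed

text \<open>
  The bound for \<open>\<delta> = 0\<close>, obtained as the limit of those for larger values, says that the directions
  orthogonal to \<open>u\<close> form a null set.
\<close>

lemma uniform_slab_le:
  fixes u :: "'a::euclidean_space"
  assumes \<mu>: "uniform_on_sphere \<mu>" and u: "1 \<le> norm u" and \<delta>: "0 \<le> \<delta>"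
  shows "measure \<mu> {e. \<bar>e \<bullet> u\<bar> \<le> \<delta>} \<le> (2 * real DIM('a) ^ 2 + 1) * \<delta>"
proof -
  interpret prob_space \<mu> using \<mu> by (rule uniform_on_sphereD)
  note [simp] = uniform_on_sphereD(2,3)[OF \<mu>]
  let ?C = "2 * real DIM('a) ^ 2 + 1"
  have C: "0 < ?C" by (simp add: add_nonneg_pos)
  have le: "measure \<mu> {e. \<bar>e \<bullet> u\<bar> \<le> \<delta>} \<le> ?C * d" if d: "\<delta> < d" for d
  proof -
    have "measure \<mu> {e. \<bar>e \<bullet> u\<bar> \<le> \<delta>} \<le> measure \<mu> {e. \<bar>e \<bullet> sgn u\<bar> \<le> d}"
    proof (rule finite_measure_mono)
      show "{e. \<bar>e \<bullet> u\<bar> \<le> \<delta>} \<subseteq> {e. \<bar>e \<bullet> sgn u\<bar> \<le> d}"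
      proof safe
        fix e assume "\<bar>e \<bullet> u\<bar> \<le> \<delta>"
        moreover have "\<bar>e \<bullet> sgn u\<bar> = \<bar>e \<bullet> u\<bar> / norm u"
          by (simp add: sgn_div_norm divide_inverse abs_mult mult.commute)
        moreover have "\<bar>e \<bullet> u\<bar> / norm u \<le> \<bar>e \<bullet> u\<bar>"
          using u by (simp add: divide_le_eq mult_le_cancel_left1)
        ultimately show "\<bar>e \<bullet> sgn u\<bar> \<le> d" using d by linarith
      qed
    qed simp
    also have "\<dots> \<le> ?C * d"
      using u d \<delta> by (intro uniform_slab_le_aux[OF \<mu>]) (auto simp: norm_sgn)
    finally show ?thesis .
  qed
  show ?thesis
  proof (rule field_le_epsilon)
    fix x :: real assume "0 < x"
    then show "measure \<mu> {e. \<bar>e \<bullet> u\<bar> \<le> \<delta>} \<le> ?C * \<delta> + x"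
      using le[of "\<delta> + x / ?C"] C by (simp add: distrib_left)
  qed
qed

text \<open>
  The lattice points whose direction is within \<open>r\<close> of \<open>e\<close> lie near the line through \<open>e\<close>: the
  coordinate in which \<open>e\<close> is large determines all others up to a multiple of \<open>r * m\<close>.
\<close>

lemma uniform_cap_le:
  fixes u :: "'a::euclidean_space"
  assumes \<mu>: "uniform_on_sphere \<mu>" and u: "norm u = 1" and r: "0 < r"
  shows "measure \<mu> {e. dist e u \<le> r} \<le> ((4 * real DIM('a) ^ 2 + 1) * r) ^ (DIM('a) - 1)"
proof -
  define D where "D = real DIM('a)"
  have D1: "1 \<le> D" using DIM_positive[where 'a='a] by (simp add: D_def Suc_leI del: DIM_positive)
  define m where "m = nat \<lceil>1 / r\<rceil>"
  have m: "1 \<le> r * real m" "m > 0"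
  proof -
    have "1 / r \<le> real m" unfolding m_def by linarith
    then show "1 \<le> r * real m" using r by (simp add: field_simps)
    then show "m > 0" by (cases m) auto
  qed
  define K where "K = ((Basis :: 'a set) \<rightarrow>\<^sub>E {1..m})"
  have cK: "real (card K) = real m ^ DIM('a)" unfolding K_def by (simp add: card_PiE)
  have "measure \<mu> {e. dist e u \<le> r} \<le> ((4 * D ^ 2 + 1) * r) ^ (DIM('a) - 1)"
  proof (rule uniform_on_sphere_le[OF \<mu> u, where R="\<lambda>e v. dist e v \<le> r" and K=K
        and g="\<lambda>\<kappa>. sgn (lattice_point \<kappa>)"])
    show "norm (sgn (lattice_point \<kappa>)) = 1" if "\<kappa> \<in> K" for \<kappa>
      using lattice_point(2)[of \<kappa> m] that by (auto simp: norm_sgn K_def)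
    show "finite K" unfolding K_def by (intro finite_PiE) auto
    show "K \<noteq> {}" using cK m by auto
    show "(dist (f e) (f v) \<le> r) = (dist e v \<le> r)" if "orthogonal_transformation f" for f e and v :: 'a
      using orthogonal_transformation_norm[OF that, of "e - v"]
        linear_diff[OF orthogonal_transformation_linear[OF that], of e v] by (simp add: dist_norm)
    fix e :: 'a assume e: "norm e = 1"
    obtain j where j: "j \<in> Basis" "1 / D \<le> \<bar>e \<bullet> j\<bar>"
      using unit_vector_large_coordinate[OF e] unfolding D_def by blast
    have ej: "0 < \<bar>e \<bullet> j\<bar>" "1 \<le> D * \<bar>e \<bullet> j\<bar>"
      using j D1 less_le_trans[of 0 "1/D" "\<bar>e \<bullet> j\<bar>"] by (auto simp: field_simps)
    define S where "S = {\<kappa>\<in>K. dist e (sgn (lattice_point \<kappa>)) \<le> r}"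
    define t where "t = 2 * r * D ^ 2 * real m"
    have "real (card S) \<le> real m ^ card (Basis - (Basis - {j})) * (2 * t + 1) ^ card (Basis - {j})"
    proof (rule card_lattice_near_graph[where c="\<lambda>\<rho> l. real (\<rho> j) / (e \<bullet> j) * (e \<bullet> l)"])
      show "S \<subseteq> (Basis \<rightarrow>\<^sub>E {1..m})" by (auto simp: S_def K_def)
      show "0 \<le> t" using r D1 by (simp add: t_def)
      fix \<kappa> l assume \<kappa>: "\<kappa> \<in> S" and l: "l \<in> Basis - {j}"
      let ?w = "lattice_point \<kappa>"
      have \<kappa>K: "\<kappa> \<in> Basis \<rightarrow>\<^sub>E {1..m}" using \<kappa> by (auto simp: S_def K_def)
      note w = lattice_point[OF \<kappa>K]
      define \<rho> where "\<rho> = norm ?w"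
      have "norm (?w - \<rho> *\<^sub>R e) = \<rho> * dist e (sgn ?w)"
      proof -
        have "?w - \<rho> *\<^sub>R e = - \<rho> *\<^sub>R (e - sgn ?w)"
          using w(2) by (simp add: \<rho>_def sgn_div_norm algebra_simps)
        then show ?thesis using w(2) by (simp add: \<rho>_def dist_norm del: scaleR_minus_left)
      qed
      also have "\<dots> \<le> (D * real m) * r"
        using \<kappa> w r by (intro mult_mono) (auto simp: S_def D_def \<rho>_def)
      finally have n: "norm (?w - \<rho> *\<^sub>R e) \<le> D * real m * r" .
      have near: "\<bar>real (\<kappa> b) - \<rho> * (e \<bullet> b)\<bar> \<le> D * real m * r" if "b \<in> Basis" for b
        using Basis_le_norm[OF that, of "?w - \<rho> *\<^sub>R e"] n w(1)[OF that] by (simp add: inner_simps)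
      have "\<bar>real (\<kappa> j) / (e \<bullet> j) - \<rho>\<bar> = \<bar>real (\<kappa> j) - \<rho> * (e \<bullet> j)\<bar> / \<bar>e \<bullet> j\<bar>"
        using ej by (simp add: field_simps flip: abs_divide)
      also have "\<dots> \<le> \<bar>real (\<kappa> j) - \<rho> * (e \<bullet> j)\<bar> * D"
      proof -
        have "\<bar>real (\<kappa> j) - \<rho> * (e \<bullet> j)\<bar> * 1 \<le> \<bar>real (\<kappa> j) - \<rho> * (e \<bullet> j)\<bar> * (D * \<bar>e \<bullet> j\<bar>)"
          using ej by (intro mult_left_mono) auto
        then show ?thesis using ej by (simp add: field_simps)
      qed
      also have "\<dots> \<le> (D * real m * r) * D" using near[OF j(1)] D1 by (intro mult_right_mono) auto
      finally have 1: "\<bar>real (\<kappa> j) / (e \<bullet> j) - \<rho>\<bar> \<le> D ^ 2 * real m * r" by (simp add: power2_eq_square mult_ac)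
      have "\<bar>e \<bullet> l\<bar> \<le> 1" using l e Basis_le_norm[of l e] by simp
      then have "\<bar>real (\<kappa> j) / (e \<bullet> j) - \<rho>\<bar> * \<bar>e \<bullet> l\<bar> \<le> (D ^ 2 * real m * r) * 1"
        using 1 r by (intro mult_mono) auto
      then have 3: "\<bar>real (\<kappa> j) / (e \<bullet> j) * (e \<bullet> l) - \<rho> * (e \<bullet> l)\<bar> \<le> D ^ 2 * real m * r"
        by (simp only: abs_mult[symmetric] left_diff_distrib mult_1_right)
      have 2: "D * real m * r \<le> D ^ 2 * real m * r"
        using D1 r self_le_power[OF D1, of 2] by (intro mult_right_mono) auto
      have tri: "\<bar>x - y\<bar> \<le> 2 * b" if "\<bar>y - z\<bar> \<le> b" "a \<le> b" "\<bar>x - z\<bar> \<le> a" for x y z a b :: real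
        using that by linarith
      have "\<bar>real (\<kappa> l) - real (\<kappa> j) / (e \<bullet> j) * (e \<bullet> l)\<bar> \<le> 2 * (D ^ 2 * real m * r)"
        by (rule tri[OF 3 2 near[OF DiffD1[OF l]]])
      also have "\<dots> = t" by (simp add: t_def)
      finally show "\<bar>real (\<kappa> l) - real (restrict \<kappa> (Basis - (Basis - {j})) j) / (e \<bullet> j) * (e \<bullet> l)\<bar> \<le> t"
        using j by simp
    qed auto
    also have "Basis - (Basis - {j}) = {j}" using j by auto
    also have "real m ^ card {j} * (2 * t + 1) ^ card (Basis - {j}) = real m * (2 * t + 1) ^ (DIM('a) - 1)"
      using j by simp
    also have "\<dots> \<le> real m * ((4 * D ^ 2 + 1) * r * real m) ^ (DIM('a) - 1)"
      using m r by (intro mult_left_mono power_mono) (auto simp: t_def algebra_simps)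
    also have "\<dots> = ((4 * D ^ 2 + 1) * r) ^ (DIM('a) - 1) * real m ^ DIM('a)"
      using DIM_positive[where 'a='a] by (cases "DIM('a)") (auto simp: power_mult_distrib)
    finally show "real (card {\<kappa>\<in>K. dist e (sgn (lattice_point \<kappa>)) \<le> r})
        \<le> ((4 * D ^ 2 + 1) * r) ^ (DIM('a) - 1) * real (card K)"
      by (simp add: S_def cK)
  qed measurable
  then show ?thesis by (simp add: D_def)
qed

section \<open>A net of directions\<close>

text \<open>
  The net is a grid of spacing \<open>2 / m\<close> on the faces of the cube \<open>[-1, 1]\<close>. A nonzero vector scaled to
  maximum norm 1 lies on a face, where each coordinate is within \<open>1 / m\<close> of that of a grid point.
\<close>

lemma direction_net:
  fixes m :: nat
  assumes m: "0 < m"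
  obtains P :: "'a::euclidean_space set" where
    "finite P" "card P \<le> 2 * DIM('a) * m ^ (DIM('a) - 1)" "\<And>c. c \<in> P \<Longrightarrow> 1 \<le> norm c"
    "\<And>u. u \<noteq> 0 \<Longrightarrow> \<exists>c\<in>P. \<exists>t>0. norm (t *\<^sub>R u - c) \<le> real DIM('a) / real m"
proof -
  define c :: "'a \<times> bool \<times> ('a \<Rightarrow> nat) \<Rightarrow> 'a" where
    "c = (\<lambda>(b, s, \<kappa>). (if s then b else - b) + (\<Sum>j\<in>Basis - {b}. ((2 * real (\<kappa> j) + 1) / real m - 1) *\<^sub>R j))"
  define I where "I = Sigma Basis (\<lambda>b::'a. (UNIV :: bool set) \<times> ((Basis - {b}) \<rightarrow>\<^sub>E {..<m}))"
  have c_b: "c (b, s, \<kappa>) \<bullet> b = (if s then 1 else - 1)" if "b \<in> Basis" for b s \<kappa>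
    using that unfolding c_def
    by (auto simp: inner_simps inner_sum_left inner_not_same_Basis intro!: sum.neutral)
  have c_j: "c (b, s, \<kappa>) \<bullet> j = (2 * real (\<kappa> j) + 1) / real m - 1" if "b \<in> Basis" "j \<in> Basis - {b}" for b s \<kappa> j
  proof -
    have "(\<Sum>i\<in>Basis - {b}. ((2 * real (\<kappa> i) + 1) / real m - 1) *\<^sub>R i) \<bullet> j
        = (\<Sum>i\<in>Basis - {b}. if i = j then (2 * real (\<kappa> i) + 1) / real m - 1 else 0)"
      unfolding inner_sum_left using that by (intro sum.cong) (auto simp: inner_not_same_Basis)
    also have "\<dots> = (2 * real (\<kappa> j) + 1) / real m - 1" using that by simp
    finally show ?thesis using that by (auto simp: c_def inner_simps inner_not_same_Basis)
  qed
  have fI: "finite I" unfolding I_def by (intro finite_SigmaI finite_cartesian_product finite_PiE) auto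
  have "card I = 2 * DIM('a) * m ^ (DIM('a) - 1)"
    unfolding I_def by (subst card_SigmaI) (auto intro!: finite_PiE simp: card_cartesian_product card_PiE)
  then have cI: "card (c ` I) \<le> 2 * DIM('a) * m ^ (DIM('a) - 1)" using card_image_le[OF fI, of c] by simp
  show ?thesis
  proof (rule that[OF _ cI])
    show "finite (c ` I)" using fI by simp
    show "1 \<le> norm x" if x: "x \<in> c ` I" for x
    proof -
      obtain k where "k \<in> I" "x = c k" using x by blast
      moreover obtain b s \<kappa> where "k = (b, s, \<kappa>)" by (cases k) auto
      ultimately have "b \<in> Basis" "x = c (b, s, \<kappa>)" by (auto simp: I_def)
      then show ?thesis using c_b[of b s \<kappa>] Basis_le_norm[of b x] by (auto split: if_splits)
    qed
    fix u :: 'a assume u: "u \<noteq> 0"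
    define M where "M = Max ((\<lambda>b. \<bar>u \<bullet> b\<bar>) ` Basis)"
    have le: "\<bar>u \<bullet> j\<bar> \<le> M" if "j \<in> Basis" for j unfolding M_def using that by (intro Max_ge) auto
    have "M \<in> (\<lambda>b. \<bar>u \<bullet> b\<bar>) ` Basis" unfolding M_def by (intro Max_in) auto
    then obtain b where b: "b \<in> Basis" "M = \<bar>u \<bullet> b\<bar>" by auto
    have M: "0 < M"
    proof (rule ccontr)
      assume "\<not> 0 < M"
      then have "u \<bullet> j = 0" if "j \<in> Basis" for j using le[OF that] by linarith
      then have "u = 0" using euclidean_all_zero_iff[of u] by blast
      then show False using u by simp
    qed
    define v where "v = (1 / M) *\<^sub>R u"
    have vj: "\<bar>v \<bullet> j\<bar> \<le> 1" if "j \<in> Basis" for j using le[OF that] M by (simp add: v_def)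
    define s where "s \<longleftrightarrow> 0 \<le> u \<bullet> b"
    have vb: "v \<bullet> b = (if s then 1 else - 1)" using b M by (auto simp: v_def s_def)
    define \<kappa> where "\<kappa> = restrict (\<lambda>j. min (nat \<lfloor>(v \<bullet> j + 1) * real m / 2\<rfloor>) (m - 1)) (Basis - {b})"
    have mem: "(b, s, \<kappa>) \<in> I" using b m by (auto simp: I_def \<kappa>_def)
    have "\<bar>(v - c (b, s, \<kappa>)) \<bullet> j\<bar> \<le> 1 / real m" if j: "j \<in> Basis" for j
    proof (cases "j = b")
      case True then show ?thesis using b vb c_b by (simp add: inner_simps)
    next
      case False
      define y where "y = (v \<bullet> j + 1) * real m / 2"
      have y: "0 \<le> y" "y \<le> real m" using vj[OF j] m by (auto simp: y_def abs_le_iff mult_left_le)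
      have \<kappa>j: "\<kappa> j = min (nat \<lfloor>y\<rfloor>) (m - 1)" using j False by (simp add: \<kappa>_def y_def)
      have "\<bar>2 * y - (2 * real (\<kappa> j) + 1)\<bar> \<le> 1"
      proof (cases "nat \<lfloor>y\<rfloor> \<le> m - 1")
        case True
        then have "\<kappa> j = nat \<lfloor>y\<rfloor>" by (simp add: \<kappa>j)
        then have "real (\<kappa> j) \<le> y" "y < real (\<kappa> j) + 1" using y by linarith+
        then show ?thesis by linarith
      next
        case False
        then have "\<kappa> j = m - 1" "y = real m" using y m by (auto simp: \<kappa>j) linarith
        then show ?thesis using m by (simp add: of_nat_diff)
      qed
      then have "\<bar>2 * y - (2 * real (\<kappa> j) + 1)\<bar> / real m \<le> 1 / real m" by (rule divide_right_mono) simp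
      moreover have "(v - c (b, s, \<kappa>)) \<bullet> j = (2 * y - (2 * real (\<kappa> j) + 1)) / real m"
        using b j False m by (simp add: inner_simps c_j y_def diff_divide_distrib)
      ultimately show ?thesis by simp
    qed
    then have "(\<Sum>j\<in>Basis. \<bar>(v - c (b, s, \<kappa>)) \<bullet> j\<bar>) \<le> (\<Sum>j\<in>(Basis :: 'a set). 1 / real m)"
      by (rule sum_mono)
    then have "norm (v - c (b, s, \<kappa>)) \<le> real DIM('a) / real m"
      using norm_le_l1[of "v - c (b, s, \<kappa>)"] by simp
    then show "\<exists>c\<in>c ` I. \<exists>t>0. norm (t *\<^sub>R u - c) \<le> real DIM('a) / real m"
      using mem M unfolding v_def by (intro bexI[of _ "c (b, s, \<kappa>)"] exI[of _ "1 / M"]) auto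
  qed
qed

section \<open>From first moments to almost sure bounds\<close>

text \<open>
  The series \<open>\<Sum>j. X j / (j + 1)\<^sup>2\<close> has finite expectation, hence is almost surely finite and bounds each
  of its terms.
\<close>

lemma AE_quadratic_growth:
  fixes X :: "nat \<Rightarrow> 'w \<Rightarrow> ennreal"
  assumes [measurable]: "\<And>j. X j \<in> borel_measurable M"
    and C: "\<And>j. (\<integral>\<^sup>+\<omega>. X j \<omega> \<partial>M) \<le> ennreal C"
  shows "AE \<omega> in M. \<exists>B::real. \<forall>j. X j \<omega> \<le> ennreal (B * real (j + 1) ^ 2)"
proof -
  define w where "w j = ennreal (1 / real (j + 1) ^ 2)" for j
  have "(\<integral>\<^sup>+\<omega>. (\<Sum>j. X j \<omega> * w j) \<partial>M) = (\<Sum>j. (\<integral>\<^sup>+\<omega>. X j \<omega> \<partial>M) * w j)"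
    by (subst nn_integral_suminf) (auto simp: nn_integral_multc)
  also have "\<dots> \<le> (\<Sum>j. ennreal C * w j)"
    using C by (intro suminf_le mult_right_mono) auto
  also have "\<dots> = ennreal C * (\<Sum>j. w j)" by simp
  also have "(\<Sum>j. w j) = ennreal (\<Sum>j. 1 / real (j + 1) ^ 2)"
    unfolding w_def using inverse_squares_sums by (intro suminf_ennreal_eq) (auto simp: sums_iff add.commute)
  finally have "(\<integral>\<^sup>+\<omega>. (\<Sum>j. X j \<omega> * w j) \<partial>M) \<noteq> \<infinity>"
    by (metis ennreal_mult_eq_top_iff ennreal_neq_top infinity_ennreal_def top.extremum_unique)
  then have "AE \<omega> in M. (\<Sum>j. X j \<omega> * w j) \<noteq> \<infinity>"
    by (intro nn_integral_PInf_AE) auto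
  then show ?thesis
  proof eventually_elim
    case (elim \<omega>)
    then obtain B where B: "0 \<le> B" "(\<Sum>j. X j \<omega> * w j) = ennreal B"
      by (metis ennreal_cases infinity_ennreal_def)
    have "X j \<omega> \<le> ennreal (B * real (j + 1) ^ 2)" for j
    proof -
      have "X j \<omega> = X j \<omega> * w j * ennreal (real (j + 1) ^ 2)"
        by (simp add: w_def mult.assoc flip: ennreal_mult)
      also have "\<dots> \<le> ennreal B * ennreal (real (j + 1) ^ 2)"
        using sum_le_suminf[of "\<lambda>j. X j \<omega> * w j" "{j}"] B by (intro mult_right_mono) auto
      finally show ?thesis using B by (simp add: ennreal_mult)
    qed
    then show ?case by blast
  qed
qed

section \<open>Vectors nearly orthogonal to a direction\<close>

lemma (in prob_space) exp_moment_hits_le: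
  fixes X :: "nat \<Rightarrow> 'a \<Rightarrow> 'b::topological_space"
  assumes X: "indep_vars (\<lambda>_. borel) X UNIV" and D [measurable]: "D \<in> sets borel"
    and p: "\<And>k. \<P>(\<omega> in M. X k \<omega> \<in> D) \<le> p"
    and a: "\<And>k. 0 \<le> a k" "summable (\<lambda>k. exp (a k) - 1)"
  shows "(\<integral>\<^sup>+\<omega>. ennreal (exp (\<Sum>k. a k * indicator D (X k \<omega>))) \<partial>M)
    \<le> ennreal (exp (p * (\<Sum>k. exp (a k) - 1)))"
proof -
  have rv [measurable]: "X k \<in> borel_measurable M" for k using X by (auto simp: indep_vars_def)
  have p0: "0 \<le> p" using p[of 0] measure_nonneg order_trans by blast
  have e0: "0 \<le> exp (a k) - 1" for k using a(1) by simp
  have sa: "summable (\<lambda>k. a k * indicator D (X k \<omega>))" for \<omega>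
  proof (rule summable_comparison_test'[OF a(2)])
    fix k
    have "a k \<le> exp (a k) - 1" using exp_ge_add_one_self[of "a k"] by linarith
    then show "norm (a k * indicator D (X k \<omega>)) \<le> exp (a k) - 1"
      using a(1)[of k] by (cases "X k \<omega> \<in> D") auto
  qed
  let ?f = "\<lambda>N \<omega>. ennreal (exp (\<Sum>k<N. a k * indicator D (X k \<omega>)))"
  have lim: "(\<lambda>N. \<integral>\<^sup>+\<omega>. ?f N \<omega> \<partial>M) \<longlonglongrightarrow> (\<integral>\<^sup>+\<omega>. ennreal (exp (\<Sum>k. a k * indicator D (X k \<omega>))) \<partial>M)"
  proof (rule nn_integral_LIMSEQ)
    show "incseq ?f"
      using a(1) by (auto simp: incseq_def le_fun_def intro!: ennreal_leI sum_mono2 mult_nonneg_nonneg)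
    show "(\<lambda>N. ?f N \<omega>) \<longlonglongrightarrow> ennreal (exp (\<Sum>k. a k * indicator D (X k \<omega>)))" for \<omega>
      by (intro tendsto_intros summable_LIMSEQ sa)
  qed measurable
  have "(\<integral>\<^sup>+\<omega>. ?f N \<omega> \<partial>M) \<le> ennreal (exp (p * (\<Sum>k. exp (a k) - 1)))" for N
  proof -
    have "(\<integral>\<^sup>+\<omega>. ?f N \<omega> \<partial>M) = (\<integral>\<^sup>+\<omega>. (\<Prod>k<N. ennreal (exp (a k * indicator D (X k \<omega>)))) \<partial>M)"
      by (intro nn_integral_cong, subst exp_sum) (simp_all only: prod_ennreal exp_ge_zero finite_lessThan)
    also have "\<dots> = (\<Prod>k<N. \<integral>\<^sup>+\<omega>. ennreal (exp (a k * indicator D (X k \<omega>))) \<partial>M)"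
    proof (rule indep_vars_nn_integral)
      have "indep_vars (\<lambda>_. borel) X {..<N}" by (rule indep_vars_subset[OF X]) auto
      then show "indep_vars (\<lambda>_. borel) (\<lambda>k \<omega>. ennreal (exp (a k * indicator D (X k \<omega>)))) {..<N}"
        by (rule indep_vars_compose2) measurable
    qed auto
    also have "\<dots> \<le> (\<Prod>k<N. ennreal (exp (p * (exp (a k) - 1))))"
    proof (rule prod_mono_ennreal)
      fix k
      have one_plus: "1 + ennreal (exp (a k) - 1) = ennreal (exp (a k))"
        using e0[of k] by (subst ennreal_1[symmetric], subst ennreal_plus[symmetric]) auto
      have "(\<integral>\<^sup>+\<omega>. ennreal (exp (a k * indicator D (X k \<omega>))) \<partial>M)
          = (\<integral>\<^sup>+\<omega>. 1 + ennreal (exp (a k) - 1) * indicator {\<omega>\<in>space M. X k \<omega> \<in> D} \<omega> \<partial>M)"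
        using one_plus by (intro nn_integral_cong) (auto simp: indicator_def)
      also have "\<dots> = 1 + ennreal (exp (a k) - 1) * emeasure M {\<omega>\<in>space M. X k \<omega> \<in> D}"
        by (subst nn_integral_add) (auto simp: nn_integral_cmult_indicator emeasure_space_1)
      also have "\<dots> = ennreal (1 + (exp (a k) - 1) * \<P>(\<omega> in M. X k \<omega> \<in> D))"
        using e0 by (simp add: emeasure_eq_measure ennreal_mult flip: ennreal_1)
      also have "\<dots> \<le> ennreal (exp (p * (exp (a k) - 1)))"
      proof (rule ennreal_leI)
        have "1 + (exp (a k) - 1) * \<P>(\<omega> in M. X k \<omega> \<in> D) \<le> 1 + (exp (a k) - 1) * p"
          using mult_left_mono[OF p e0] by simp
        also have "\<dots> \<le> exp (p * (exp (a k) - 1))"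
          using exp_ge_add_one_self[of "p * (exp (a k) - 1)"] by (simp add: mult.commute)
        finally show "1 + (exp (a k) - 1) * \<P>(\<omega> in M. X k \<omega> \<in> D) \<le> exp (p * (exp (a k) - 1))" .
      qed
      finally show "(\<integral>\<^sup>+\<omega>. ennreal (exp (a k * indicator D (X k \<omega>))) \<partial>M) \<le> ennreal (exp (p * (exp (a k) - 1)))" .
    qed
    also have "\<dots> = ennreal (exp (p * (\<Sum>k<N. exp (a k) - 1)))"
      by (simp add: prod_ennreal exp_sum sum_distrib_left)
    also have "\<dots> \<le> ennreal (exp (p * (\<Sum>k. exp (a k) - 1)))"
      using e0 p0 by (intro ennreal_leI) (simp add: mult_left_mono sum_le_suminf[OF a(2)])
    finally show ?thesis .
  qed
  then show ?thesis by (intro LIMSEQ_le_const2[OF lim]) auto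
qed

lemma powr_tail_le:
  fixes \<beta> :: real
  assumes \<beta>: "1 < \<beta>" and n: "1 \<le> (n::nat)"
  shows "summable (\<lambda>k. real (k + n + 1) powr - \<beta>)"
    "(\<Sum>k. real (k + n + 1) powr - \<beta>) \<le> real n powr (1 - \<beta>) / (\<beta> - 1)"
proof -
  define f where "f k = real (k + n) powr (1 - \<beta>) / (\<beta> - 1)" for k
  have "(\<lambda>k. real (k + n) powr (1 - \<beta>)) \<longlonglongrightarrow> 0"
  proof (rule tendsto_neg_powr)
    show "filterlim (\<lambda>k. real (k + n)) at_top sequentially"
      by (intro filterlim_compose[OF filterlim_real_sequentially] filterlim_add_const_nat_at_top)
  qed (use \<beta> in auto)
  then have "f \<longlonglongrightarrow> 0 / (\<beta> - 1)" unfolding f_def using \<beta> by (intro tendsto_divide tendsto_const) auto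
  then have tel: "(\<lambda>k. f k - f (Suc k)) sums (f 0 - 0)" by (intro telescope_sums') simp
  have le: "real (k + n + 1) powr - \<beta> \<le> f k - f (Suc k)" for k
  proof -
    let ?x = "real (k + n)"
    have x: "0 < ?x" using n by simp
    have "\<exists>z>?x. z < ?x + 1 \<and> (?x + 1) powr (1 - \<beta>) - ?x powr (1 - \<beta>) = (?x + 1 - ?x) * ((1 - \<beta>) * z powr (1 - \<beta> - 1))"
    proof (rule MVT2)
      fix y assume "?x \<le> y" "y \<le> ?x + 1"
      then show "((\<lambda>y. y powr (1 - \<beta>)) has_real_derivative (1 - \<beta>) * y powr (1 - \<beta> - 1)) (at y)"
        using x by (intro has_real_derivative_powr) auto
    qed simp
    then obtain z where z: "?x < z" "z < ?x + 1"
      "(?x + 1) powr (1 - \<beta>) - ?x powr (1 - \<beta>) = (1 - \<beta>) * z powr - \<beta>" by auto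
    have "(?x + 1) powr - \<beta> \<le> z powr - \<beta>" using z x \<beta> by (intro powr_mono2') auto
    moreover have "f k - f (Suc k) = z powr - \<beta>"
    proof -
      have "f k - f (Suc k) = - ((?x + 1) powr (1 - \<beta>) - ?x powr (1 - \<beta>)) / (\<beta> - 1)"
        by (simp add: f_def diff_divide_distrib add_ac)
      also have "\<dots> = ((\<beta> - 1) * z powr - \<beta>) / (\<beta> - 1)" unfolding z(3) by (simp add: algebra_simps)
      also have "\<dots> = z powr - \<beta>" using \<beta> by simp
      finally show ?thesis .
    qed
    ultimately show ?thesis by (simp add: add_ac)
  qed
  show s: "summable (\<lambda>k. real (k + n + 1) powr - \<beta>)"
    by (rule summable_comparison_test'[OF sums_summable[OF tel]]) (use le in auto)
  have "(\<Sum>k. real (k + n + 1) powr - \<beta>) \<le> f 0 - 0"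
    using suminf_le[OF le s sums_summable[OF tel]] sums_unique[OF tel] by simp
  then show "(\<Sum>k. real (k + n + 1) powr - \<beta>) \<le> real n powr (1 - \<beta>) / (\<beta> - 1)" by (simp add: f_def)
qed

text \<open>
  Exponentiating the total cost of the hits of a cell bounds two quantities at once. An early hit
  doubles the number of patterns to be listed, hence \<open>ln 2\<close>. A late hit enlarges the radius by the
  length of its segment, which is measured here in units of \<open>n powr - \<beta>\<close>.
\<close>

definition hit_cost :: "real \<Rightarrow> nat \<Rightarrow> nat \<Rightarrow> real" where
  "hit_cost \<beta> n k = (if k < n then ln 2 else real n powr \<beta> * real (k + 1) powr - \<beta>)"

lemma hit_cost_nonneg: "0 \<le> hit_cost \<beta> n k"
  by (simp add: hit_cost_def)

lemma hit_cost_sum_le: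
  assumes \<beta>: "1 < \<beta>" and n: "1 \<le> n"
  shows "summable (\<lambda>k. exp (hit_cost \<beta> n k) - 1)"
    "(\<Sum>k. exp (hit_cost \<beta> n k) - 1) \<le> (1 + 2 / (\<beta> - 1)) * real n"
proof -
  let ?f = "\<lambda>k. exp (hit_cost \<beta> n k) - 1"
  let ?g = "\<lambda>k. 2 * real n powr \<beta> * real (k + n + 1) powr - \<beta>"
  have le: "?f (k + n) \<le> ?g k" for k
  proof -
    define x where "x = hit_cost \<beta> n (k + n)"
    have x: "x = (real n / real (k + n + 1)) powr \<beta>"
      by (simp add: x_def hit_cost_def powr_divide powr_minus_divide)
    have "x \<le> 1" unfolding x using n \<beta> by (intro powr_le1) auto
    then have "exp x \<le> 1 + x + x\<^sup>2" using hit_cost_nonneg by (intro exp_bound) (auto simp: x_def)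
    also have "x\<^sup>2 \<le> x" using \<open>x \<le> 1\<close> hit_cost_nonneg by (simp add: x_def power2_eq_square mult_left_le)
    finally have "exp x - 1 \<le> 2 * x" by simp
    then show ?thesis by (simp add: x_def hit_cost_def)
  qed
  have f0: "0 \<le> ?f k" for k using hit_cost_nonneg by simp
  have sg: "summable ?g" by (intro summable_mult powr_tail_le \<beta> n)
  have s: "summable (\<lambda>k. ?f (k + n))"
    by (rule summable_comparison_test'[OF sg]) (use le f0 in auto)
  then show sf: "summable ?f" by (rule summable_iff_shift[THEN iffD1])
  have "suminf ?f = (\<Sum>k. ?f (k + n)) + (\<Sum>k<n. ?f k)" by (rule suminf_split_initial_segment[OF sf])
  also have "(\<Sum>k<n. ?f k) = real n" by (simp add: hit_cost_def)
  also have "(\<Sum>k. ?f (k + n)) \<le> suminf ?g" by (rule suminf_le[OF le s sg])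
  also have "suminf ?g = 2 * real n powr \<beta> * (\<Sum>k. real (k + n + 1) powr - \<beta>)"
    by (rule suminf_mult[OF powr_tail_le(1)[OF \<beta> n]])
  also have "\<dots> \<le> 2 * real n powr \<beta> * (real n powr (1 - \<beta>) / (\<beta> - 1))"
    by (intro mult_left_mono powr_tail_le \<beta> n) auto
  also have "\<dots> = 2 / (\<beta> - 1) * (real n powr \<beta> * real n powr (1 - \<beta>))" by simp
  also have "real n powr \<beta> * real n powr (1 - \<beta>) = real n" using n by (simp flip: powr_add)
  finally show "suminf ?f \<le> (1 + 2 / (\<beta> - 1)) * real n" by (simp add: algebra_simps)
qed

text \<open>
  For \<open>n = 2 ^ j\<close>, a vector hits a given cell with probability of order \<open>1 / n\<close> while the costs
  \<open>exp (hit_cost \<beta> n k) - 1\<close> add up to a multiple of \<open>n\<close>, so each summand has bounded expectation.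
\<close>

lemma (in prob_space) AE_hits_bound:
  fixes \<epsilon> :: "nat \<Rightarrow> 'a \<Rightarrow> 'b::euclidean_space" and P :: "nat \<Rightarrow> 'b set"
  assumes indep: "indep_vars (\<lambda>_. borel) \<epsilon> UNIV"
    and unif: "\<And>k. uniform_on_sphere (distr M borel (\<epsilon> k))" and \<beta>: "1 < \<beta>"
    and P: "\<And>j. finite (P j)" "\<And>j. card (P j) \<le> 2 * DIM('b) * (2 ^ j) ^ (DIM('b) - 1)"
      "\<And>j c. c \<in> P j \<Longrightarrow> 1 \<le> norm c"
  shows "AE \<omega> in M. \<exists>B::real. \<forall>j. (\<Sum>c\<in>P j. exp (\<Sum>k. hit_cost \<beta> (2 ^ j) k *
      indicator {e. \<bar>e \<bullet> c\<bar> \<le> real DIM('b) / 2 ^ j} (\<epsilon> k \<omega>))) \<le> B * real (j + 1) ^ 2 * (2 ^ j) ^ (DIM('b) - 1)"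
proof -
  have rv [measurable]: "\<epsilon> k \<in> borel_measurable M" for k using indep by (auto simp: indep_vars_def)
  define D where "D = real DIM('b)"
  define H where "H j c = {e :: 'b. \<bar>e \<bullet> c\<bar> \<le> D / 2 ^ j}" for j c
  have H [measurable]: "H j c \<in> sets borel" for j c unfolding H_def by measurable
  define V where "V j c \<omega> = exp (\<Sum>k. hit_cost \<beta> (2 ^ j) k * indicator (H j c) (\<epsilon> k \<omega>))" for j c \<omega>
  have V [measurable]: "V j c \<in> borel_measurable M" for j c unfolding V_def by measurable
  define K where "K = exp ((2 * D ^ 2 + 1) * D * (1 + 2 / (\<beta> - 1)))"
  have EV: "(\<integral>\<^sup>+\<omega>. ennreal (V j c \<omega>) \<partial>M) \<le> ennreal K" if c: "c \<in> P j" for j c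
  proof -
    let ?p = "(2 * D ^ 2 + 1) * (D / 2 ^ j)"
    have "\<P>(\<omega> in M. \<epsilon> k \<omega> \<in> H j c) \<le> ?p" for k
    proof -
      have "\<P>(\<omega> in M. \<epsilon> k \<omega> \<in> H j c) = measure (distr M borel (\<epsilon> k)) (H j c)"
        by (subst measure_distr) (auto simp: vimage_def Int_def conj_commute)
      also have "\<dots> \<le> ?p"
        unfolding H_def D_def by (intro uniform_slab_le unif P(3)[OF c]) auto
      finally show ?thesis .
    qed
    then have "(\<integral>\<^sup>+\<omega>. ennreal (V j c \<omega>) \<partial>M) \<le> ennreal (exp (?p * (\<Sum>k. exp (hit_cost \<beta> (2 ^ j) k) - 1)))"
      unfolding V_def by (intro exp_moment_hits_le[OF indep] hit_cost_nonneg hit_cost_sum_le \<beta>) auto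
    also have "\<dots> \<le> ennreal (exp (?p * ((1 + 2 / (\<beta> - 1)) * real (2 ^ j))))"
    proof (intro ennreal_leI exp_le_cancel_iff[THEN iffD2] mult_left_mono)
      show "(\<Sum>k. exp (hit_cost \<beta> (2 ^ j) k) - 1) \<le> (1 + 2 / (\<beta> - 1)) * real (2 ^ j)"
        by (intro hit_cost_sum_le \<beta>) simp
    qed (auto simp: D_def)
    also have "\<dots> = ennreal K" by (simp add: K_def mult_ac)
    finally show ?thesis .
  qed
  have "AE \<omega> in M. \<exists>B::real. \<forall>j. ennreal ((\<Sum>c\<in>P j. V j c \<omega>) / (2 ^ j) ^ (DIM('b) - 1)) \<le> ennreal (B * real (j + 1) ^ 2)"
  proof (rule AE_quadratic_growth)
    show "(\<integral>\<^sup>+\<omega>. ennreal ((\<Sum>c\<in>P j. V j c \<omega>) / (2 ^ j) ^ (DIM('b) - 1)) \<partial>M) \<le> ennreal (2 * D * K)" for j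
    proof -
      have "(\<integral>\<^sup>+\<omega>. ennreal ((\<Sum>c\<in>P j. V j c \<omega>) / (2 ^ j) ^ (DIM('b) - 1)) \<partial>M)
          = (\<integral>\<^sup>+\<omega>. (\<Sum>c\<in>P j. ennreal (V j c \<omega>)) * ennreal (1 / (2 ^ j) ^ (DIM('b) - 1)) \<partial>M)"
        by (intro nn_integral_cong) (auto simp: V_def sum_ennreal sum_nonneg simp flip: ennreal_mult)
      also have "\<dots> = (\<Sum>c\<in>P j. \<integral>\<^sup>+\<omega>. ennreal (V j c \<omega>) \<partial>M) * ennreal (1 / (2 ^ j) ^ (DIM('b) - 1))"
        by (subst nn_integral_multc, measurable) (subst nn_integral_sum, auto)
      also have "\<dots> \<le> (\<Sum>c\<in>P j. ennreal K) * ennreal (1 / (2 ^ j) ^ (DIM('b) - 1))"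
        using EV by (intro mult_right_mono sum_mono) auto
      also have "\<dots> = ennreal (real (card (P j))) * ennreal K * ennreal (1 / (2 ^ j) ^ (DIM('b) - 1))"
        by (simp add: ennreal_of_nat_eq_real_of_nat)
      also have "\<dots> = ennreal (real (card (P j)) * K * (1 / (2 ^ j) ^ (DIM('b) - 1)))"
        by (subst ennreal_mult'', simp, subst ennreal_mult'', simp add: K_def, rule refl)
      also have "\<dots> = ennreal (real (card (P j)) * K / (2 ^ j) ^ (DIM('b) - 1))" by simp
      also have "\<dots> \<le> ennreal (2 * D * K)"
      proof (rule ennreal_leI)
        have "real (card (P j)) \<le> real (2 * DIM('b) * (2 ^ j) ^ (DIM('b) - 1))" using P(2) of_nat_le_iff by blast
        also have "\<dots> = 2 * D * (2 ^ j) ^ (DIM('b) - 1)" by (simp add: D_def)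
        finally have "real (card (P j)) * K \<le> 2 * D * (2 ^ j) ^ (DIM('b) - 1) * K"
          by (rule mult_right_mono) (simp add: K_def)
        then show "real (card (P j)) * K / (2 ^ j) ^ (DIM('b) - 1) \<le> 2 * D * K"
          by (subst pos_divide_le_eq) (auto simp: mult_ac)
      qed
      finally show ?thesis .
    qed
  qed measurable
  then show ?thesis
  proof eventually_elim
    case (elim \<omega>)
    then obtain B :: real where B: "ennreal ((\<Sum>c\<in>P j. V j c \<omega>) / (2 ^ j) ^ (DIM('b) - 1)) \<le> ennreal (B * real (j + 1) ^ 2)" for j
      by blast
    have "(\<Sum>c\<in>P j. V j c \<omega>) / (2 ^ j) ^ (DIM('b) - 1) \<le> \<bar>B\<bar> * real (j + 1) ^ 2" for j
    proof -
      have "ennreal (B * real (j + 1) ^ 2) \<le> ennreal (\<bar>B\<bar> * real (j + 1) ^ 2)"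
        by (intro ennreal_leI mult_right_mono) auto
      with B[of j] have "ennreal ((\<Sum>c\<in>P j. V j c \<omega>) / (2 ^ j) ^ (DIM('b) - 1)) \<le> ennreal (\<bar>B\<bar> * real (j + 1) ^ 2)"
        by (rule order_trans)
      then show ?thesis by (subst (asm) ennreal_le_iff) auto
    qed
    then show ?case unfolding V_def H_def D_def
      by (intro exI[of _ "\<bar>B\<bar>"] allI) (simp add: pos_divide_le_eq)
  qed
qed

section \<open>Directions that are not told apart\<close>

lemma summable_power_times_exp: "summable (\<lambda>i. real (i + 1) ^ q * exp (- real i))"
proof (rule summable_comparison_test')
  show "summable (\<lambda>i. (fact q * 2 ^ q * exp (1/2)) * exp (- 1 / 2) ^ i :: real)"
    by (intro summable_mult summable_geometric) auto
  fix i :: nat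
  define x where "x = real (i + 1) / 2"
  have "x ^ q /\<^sub>R fact q \<le> exp x"
    using sum_le_suminf[OF sums_summable[OF exp_converges[of x]], of "{q}"]
      sums_unique[OF exp_converges[of x]] by (simp add: x_def)
  then have "x ^ q \<le> fact q * exp x" by (simp add: field_simps)
  then have "real (i + 1) ^ q \<le> fact q * 2 ^ q * exp x"
    unfolding x_def power_divide by (simp add: pos_divide_le_eq mult_ac)
  then have "real (i + 1) ^ q * exp (- real i) \<le> fact q * 2 ^ q * (exp x * exp (- real i))"
    by (simp add: mult_right_mono flip: mult.assoc)
  also have "exp x * exp (- real i) = exp (1/2) * exp (- 1 / 2) ^ i"
    unfolding x_def exp_of_nat_mult[symmetric] exp_add[symmetric] by (simp add: field_simps)
  finally show "norm (real (i + 1) ^ q * exp (- real i)) \<le> (fact q * 2 ^ q * exp (1/2)) * exp (- 1 / 2) ^ i"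
    by (simp add: mult.assoc)
qed

lemma ennreal_term_le_suminf: "f i \<le> suminf f" for f :: "nat \<Rightarrow> ennreal"
  using sum_le_suminf[of f "{i}"] by simp

text \<open>
  The exponential is at most \<open>exp (- i)\<close> where \<open>dist u v\<close> is between \<open>i\<close> and \<open>i + 1\<close> multiples of
  \<open>1 / (c * N)\<close>, and the cap with the larger radius has mass of order \<open>((i + 1) / N) ^ (DIM('a) - 1)\<close>.
\<close>

lemma uniform_exp_dist_integral_le:
  fixes \<mu> :: "'a::euclidean_space measure"
  assumes \<mu>: "uniform_on_sphere \<mu>" and c: "0 < c"
  shows "\<exists>C. \<forall>u N. norm u = 1 \<longrightarrow> 0 < N \<longrightarrow>
    (\<integral>\<^sup>+v. ennreal (exp (- (c * dist u v * real N))) \<partial>\<mu>) \<le> ennreal (C / real N ^ (DIM('a) - 1))"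
proof -
  interpret prob_space \<mu> using \<mu> by (rule uniform_on_sphereD)
  note [simp, measurable_cong] = uniform_on_sphereD(2)[OF \<mu>]
  note [simp] = uniform_on_sphereD(3)[OF \<mu>]
  define q where "q = DIM('a) - 1"
  define A where "A = 4 * real DIM('a) ^ 2 + 1"
  define S where "S = (\<Sum>i. real (i + 1) ^ q * exp (- real i))"
  have "(\<integral>\<^sup>+v. ennreal (exp (- (c * dist u v * real N))) \<partial>\<mu>) \<le> ennreal ((A / c) ^ q * S / real N ^ q)"
    if u: "norm u = 1" and N: "0 < N" for u and N :: nat
  proof -
    define B where "B i = {v. dist v u \<le> real (i + 1) / (c * real N)}" for i
    have [measurable]: "B i \<in> sets borel" for i unfolding B_def by measurable
    have "(\<integral>\<^sup>+v. ennreal (exp (- (c * dist u v * real N))) \<partial>\<mu>)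
        \<le> (\<integral>\<^sup>+v. (\<Sum>i. ennreal (exp (- real i)) * indicator (B i) v) \<partial>\<mu>)"
    proof (rule nn_integral_mono)
      fix v
      define y where "y = c * dist u v * real N"
      define i where "i = nat \<lfloor>y\<rfloor>"
      have y: "0 \<le> y" using c by (simp add: y_def)
      have i: "real i \<le> y" "y \<le> real (i + 1)" unfolding i_def using y by linarith+
      have "v \<in> B i" using i(2) c N unfolding B_def y_def by (simp add: dist_commute field_simps)
      then have "ennreal (exp (- y)) \<le> ennreal (exp (- real i)) * indicator (B i) v" using i by simp
      also have "\<dots> \<le> (\<Sum>i. ennreal (exp (- real i)) * indicator (B i) v)"
        by (rule ennreal_term_le_suminf)
      finally show "ennreal (exp (- (c * dist u v * real N))) \<le> (\<Sum>i. ennreal (exp (- real i)) * indicator (B i) v)"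
        by (simp add: y_def)
    qed
    also have "\<dots> = (\<Sum>i. ennreal (exp (- real i)) * emeasure \<mu> (B i))"
      by (subst nn_integral_suminf) (auto simp: nn_integral_cmult_indicator)
    also have "\<dots> \<le> (\<Sum>i. ennreal ((A / c) ^ q / real N ^ q * (real (i + 1) ^ q * exp (- real i))))"
    proof (intro suminf_le allI)
      fix i
      have "measure \<mu> (B i) \<le> (A * (real (i + 1) / (c * real N))) ^ q"
        unfolding B_def A_def q_def using c N by (intro uniform_cap_le[OF \<mu> u]) auto
      then have "exp (- real i) * measure \<mu> (B i) \<le> exp (- real i) * (A * (real (i + 1) / (c * real N))) ^ q"
        by (rule mult_left_mono) simp
      also have "\<dots> = (A / c) ^ q / real N ^ q * (real (i + 1) ^ q * exp (- real i))"
        by (simp add: power_mult_distrib power_divide)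
      finally have le: "exp (- real i) * measure \<mu> (B i) \<le> (A / c) ^ q / real N ^ q * (real (i + 1) ^ q * exp (- real i))" .
      show "ennreal (exp (- real i)) * emeasure \<mu> (B i) \<le> ennreal ((A / c) ^ q / real N ^ q * (real (i + 1) ^ q * exp (- real i)))"
        unfolding emeasure_eq_measure
        by (subst ennreal_mult[symmetric]) (simp_all only: ennreal_leI[OF le] exp_ge_zero measure_nonneg)
    qed auto
    also have "\<dots> = ennreal ((A / c) ^ q * S / real N ^ q)"
    proof (rule suminf_ennreal_eq)
      show "(\<lambda>i. (A / c) ^ q / real N ^ q * (real (i + 1) ^ q * exp (- real i))) sums ((A / c) ^ q * S / real N ^ q)"
        using sums_mult[OF summable_sums[OF summable_power_times_exp[of q]], of "(A / c) ^ q / real N ^ q"]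
        by (simp add: S_def)
    qed (use c in \<open>auto simp: A_def\<close>)
    finally show ?thesis .
  qed
  then show ?thesis unfolding q_def by blast
qed

lemma splits_measurable [measurable]:
  assumes [measurable]: "f \<in> borel_measurable N" "g \<in> borel_measurable N" "h \<in> borel_measurable N"
  shows "Measurable.pred N (\<lambda>x. splits \<eta> (f x) (g x) (h x :: 'a::euclidean_space))"
  unfolding splits_def by measurable

lemma (in prob_space) prob_no_split_le:
  fixes \<epsilon> :: "nat \<Rightarrow> 'a \<Rightarrow> 'b::euclidean_space"
  assumes indep: "indep_vars (\<lambda>_. borel) \<epsilon> UNIV"
    and unif: "\<And>k. uniform_on_sphere (distr M borel (\<epsilon> k))"
    and D: "2 \<le> DIM('b)" and \<eta>: "\<eta> = 1 / (real DIM('b) + 1)"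
    and u: "norm u = 1" and v: "norm v = 1"
  shows "(\<integral>\<^sup>+\<omega>. indicator {\<omega>. \<forall>i<N. \<not> splits \<eta> (\<epsilon> i \<omega>) u v} \<omega> \<partial>M)
    \<le> ennreal (exp (- (\<eta> / (24 * real DIM('b)) * dist u v * real N)))"
proof -
  have rv [measurable]: "\<epsilon> k \<in> borel_measurable M" for k using indep by (auto simp: indep_vars_def)
  let ?p = "\<eta> / (24 * real DIM('b)) * dist u v"
  let ?I = "indicator {e. \<not> splits \<eta> e u v} :: 'b \<Rightarrow> ennreal"
  have "(\<integral>\<^sup>+\<omega>. indicator {\<omega>. \<forall>i<N. \<not> splits \<eta> (\<epsilon> i \<omega>) u v} \<omega> \<partial>M) = (\<integral>\<^sup>+\<omega>. (\<Prod>i<N. ?I (\<epsilon> i \<omega>)) \<partial>M)"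
  proof (rule nn_integral_cong)
    fix \<omega>
    show "indicator {\<omega>. \<forall>i<N. \<not> splits \<eta> (\<epsilon> i \<omega>) u v} \<omega> = (\<Prod>i<N. ?I (\<epsilon> i \<omega>))"
    proof (cases "\<forall>i<N. \<not> splits \<eta> (\<epsilon> i \<omega>) u v")
      case False
      then show ?thesis by (auto simp: prod_zero_iff intro!: prod_zero[symmetric] bexI)
    qed simp
  qed
  also have "\<dots> = (\<Prod>i<N. \<integral>\<^sup>+\<omega>. ?I (\<epsilon> i \<omega>) \<partial>M)"
  proof (rule indep_vars_nn_integral)
    have "indep_vars (\<lambda>_. borel) \<epsilon> {..<N}" by (rule indep_vars_subset[OF indep]) auto
    then show "indep_vars (\<lambda>_. borel) (\<lambda>i \<omega>. ?I (\<epsilon> i \<omega>)) {..<N}"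
      by (rule indep_vars_compose2) measurable
  qed auto
  also have "\<dots> \<le> (\<Prod>i<N. ennreal (exp (- ?p)))"
  proof (rule prod_mono_ennreal)
    fix i
    interpret S: prob_space "distr M borel (\<epsilon> i)" by (rule prob_space_distr) measurable
    have "(\<integral>\<^sup>+\<omega>. ?I (\<epsilon> i \<omega>) \<partial>M) = (\<integral>\<^sup>+e. ?I e \<partial>distr M borel (\<epsilon> i))"
      by (subst nn_integral_distr) auto
    also have "\<dots> = emeasure (distr M borel (\<epsilon> i)) (space (distr M borel (\<epsilon> i)) - {e. splits \<eta> e u v})"
      by (subst nn_integral_indicator) (auto intro!: arg_cong2[where f=emeasure])
    also have "\<dots> = ennreal (1 - measure (distr M borel (\<epsilon> i)) {e. splits \<eta> e u v})"
      by (subst S.emeasure_eq_measure, subst S.prob_compl) auto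
    also have "\<dots> \<le> ennreal (exp (- ?p))"
      using uniform_splits_ge[OF unif[of i] D u v \<eta>] exp_ge_add_one_self[of "- ?p"]
      by (intro ennreal_leI) linarith
    finally show "(\<integral>\<^sup>+\<omega>. ?I (\<epsilon> i \<omega>) \<partial>M) \<le> ennreal (exp (- ?p))" .
  qed
  also have "\<dots> = ennreal (exp (- (?p * real N)))"
    by (simp add: ennreal_power mult_ac flip: exp_of_nat_mult)
  finally show ?thesis .
qed

text \<open>
  By Fubini's theorem the expected mass of the \<open>v\<close> not split from \<open>u\<close> is the integral over \<open>v\<close> of the
  probability that \<open>v\<close> is not split from \<open>u\<close>.
\<close>

lemma (in prob_space) AE_unsplit_bound:
  fixes \<epsilon> :: "nat \<Rightarrow> 'a \<Rightarrow> 'b::euclidean_space"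
  assumes indep: "indep_vars (\<lambda>_. borel) \<epsilon> UNIV"
    and unif: "\<And>k. uniform_on_sphere (distr M borel (\<epsilon> k))" and \<sigma>: "uniform_on_sphere \<sigma>"
    and D: "2 \<le> DIM('b)" and \<eta>: "\<eta> = 1 / (real DIM('b) + 1)"
  shows "AE \<omega> in M. AE u in \<sigma>. \<exists>B::real. \<forall>j.
    measure \<sigma> {v. \<forall>i<2^j. \<not> splits \<eta> (\<epsilon> i \<omega>) u v} * (2 ^ j) ^ (DIM('b) - 1) \<le> B * real (j + 1) ^ 2"
proof -
  have rv [measurable]: "\<epsilon> k \<in> borel_measurable M" for k using indep by (auto simp: indep_vars_def)
  interpret S: prob_space \<sigma> using \<sigma> by (rule uniform_on_sphereD)
  note [simp, measurable_cong] = uniform_on_sphereD(2)[OF \<sigma>]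
  note [simp] = uniform_on_sphereD(3)[OF \<sigma>]
  interpret MS: pair_sigma_finite M \<sigma> by unfold_locales
  interpret SS: pair_sigma_finite \<sigma> \<sigma> by unfold_locales
  define q where "q = DIM('b) - 1"
  define c where "c = \<eta> / (24 * real DIM('b))"
  have c: "0 < c" by (simp add: c_def \<eta>)
  obtain C where C: "\<And>u N. norm u = 1 \<Longrightarrow> 0 < N \<Longrightarrow>
    (\<integral>\<^sup>+v. ennreal (exp (- (c * dist u v * real N))) \<partial>\<sigma>) \<le> ennreal (C / real N ^ q)"
    using uniform_exp_dist_integral_le[OF \<sigma> c] unfolding q_def by blast
  define A where "A j \<omega> u v \<longleftrightarrow> (\<forall>i<2^j. \<not> splits \<eta> (\<epsilon> i \<omega>) u v)" for j :: nat and \<omega> u v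
  have [measurable]: "Measurable.pred L (\<lambda>x. A j (f x) (g x) (h x))"
    if [measurable]: "f \<in> L \<rightarrow>\<^sub>M M" "g \<in> borel_measurable L" "h \<in> borel_measurable L" for L :: "'z measure" and f g h j
    unfolding A_def by measurable
  define X where "X j = (\<lambda>(\<omega>, u). (\<integral>\<^sup>+v. indicator {v. A j \<omega> u v} v \<partial>\<sigma>) * ennreal ((2 ^ j) ^ q))" for j
  have ind: "indicator {v. A j \<omega> u v} v = (if A j \<omega> u v then 1 else 0 :: ennreal)" for j \<omega> u v by simp
  have Xm [measurable]: "X j \<in> borel_measurable (M \<Otimes>\<^sub>M \<sigma>)" for j
    unfolding X_def ind by measurable
  have "AE x in M \<Otimes>\<^sub>M \<sigma>. \<exists>B::real. \<forall>j. X j x \<le> ennreal (B * real (j + 1) ^ 2)"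
  proof (rule AE_quadratic_growth)
    fix j
    have inner: "(\<integral>\<^sup>+\<omega>. \<integral>\<^sup>+v. (if A j \<omega> u v then 1 else 0) \<partial>\<sigma> \<partial>M) \<le> ennreal (C / (2 ^ j) ^ q)" if u: "norm u = 1" for u
    proof -
      have "(\<integral>\<^sup>+\<omega>. \<integral>\<^sup>+v. (if A j \<omega> u v then 1 else 0 :: ennreal) \<partial>\<sigma> \<partial>M) = (\<integral>\<^sup>+v. \<integral>\<^sup>+\<omega>. (if A j \<omega> u v then 1 else 0) \<partial>M \<partial>\<sigma>)"
        by (rule MS.Fubini'[symmetric]) measurable
      also have "\<dots> \<le> (\<integral>\<^sup>+v. ennreal (exp (- (c * dist u v * real (2 ^ j)))) \<partial>\<sigma>)"
      proof (rule nn_integral_mono_AE)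
        show "AE v in \<sigma>. (\<integral>\<^sup>+\<omega>. (if A j \<omega> u v then 1 else 0) \<partial>M) \<le> ennreal (exp (- (c * dist u v * real (2 ^ j))))"
          using uniform_on_sphereD(4)[OF \<sigma>]
        proof eventually_elim
          case (elim v)
          have "(\<integral>\<^sup>+\<omega>. (if A j \<omega> u v then 1 else 0 :: ennreal) \<partial>M)
              = (\<integral>\<^sup>+\<omega>. indicator {\<omega>. \<forall>i<2^j. \<not> splits \<eta> (\<epsilon> i \<omega>) u v} \<omega> \<partial>M)"
            by (intro nn_integral_cong) (auto simp: A_def indicator_def)
          with prob_no_split_le[OF indep unif D \<eta> u elim, of "2 ^ j"] show ?case by (simp add: c_def)
        qed
      qed
      also have "\<dots> \<le> ennreal (C / (2 ^ j) ^ q)" using C[OF u, of "2 ^ j"] by simp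
      finally show ?thesis .
    qed
    have "(\<integral>\<^sup>+x. X j x \<partial>(M \<Otimes>\<^sub>M \<sigma>)) = (\<integral>\<^sup>+\<omega>. \<integral>\<^sup>+u. X j (\<omega>, u) \<partial>\<sigma> \<partial>M)"
      by (rule S.nn_integral_fst[symmetric]) measurable
    also have "\<dots> = (\<integral>\<^sup>+u. \<integral>\<^sup>+\<omega>. X j (\<omega>, u) \<partial>M \<partial>\<sigma>)"
      by (rule MS.Fubini'[symmetric]) measurable
    also have "\<dots> \<le> (\<integral>\<^sup>+u. ennreal (C / (2 ^ j) ^ q) * ennreal ((2 ^ j) ^ q) \<partial>\<sigma>)"
    proof (rule nn_integral_mono_AE)
      show "AE u in \<sigma>. (\<integral>\<^sup>+\<omega>. X j (\<omega>, u) \<partial>M) \<le> ennreal (C / (2 ^ j) ^ q) * ennreal ((2 ^ j) ^ q)"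
        using uniform_on_sphereD(4)[OF \<sigma>]
      proof eventually_elim
        case (elim u)
        have "(\<integral>\<^sup>+\<omega>. X j (\<omega>, u) \<partial>M) = (\<integral>\<^sup>+\<omega>. \<integral>\<^sup>+v. (if A j \<omega> u v then 1 else 0) \<partial>\<sigma> \<partial>M) * ennreal ((2 ^ j) ^ q)"
          unfolding X_def ind prod.case by (rule nn_integral_multc) measurable
        also have "\<dots> \<le> ennreal (C / (2 ^ j) ^ q) * ennreal ((2 ^ j) ^ q)"
          by (intro mult_right_mono inner elim) auto
        finally show ?case .
      qed
    qed
    also have "\<dots> = ennreal C" using S.emeasure_space_1 by (simp flip: ennreal_mult'')
    finally show "(\<integral>\<^sup>+x. X j x \<partial>(M \<Otimes>\<^sub>M \<sigma>)) \<le> ennreal C" .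
  qed measurable
  then have "AE \<omega> in M. AE u in \<sigma>. \<exists>B::real. \<forall>j. X j (\<omega>, u) \<le> ennreal (B * real (j + 1) ^ 2)"
    by (rule MS.AE_pair)
  then show ?thesis
    using AE_space
  proof eventually_elim
    case (elim \<omega>)
    note [measurable] = measurable_const[OF elim(2), of borel]
    show ?case
      using elim(1)
    proof eventually_elim
      case (elim u)
      then obtain B :: real where B: "\<And>j. X j (\<omega>, u) \<le> ennreal (B * real (j + 1) ^ 2)" by blast
      have "measure \<sigma> {v. \<forall>i<2^j. \<not> splits \<eta> (\<epsilon> i \<omega>) u v} * (2 ^ j) ^ q \<le> \<bar>B\<bar> * real (j + 1) ^ 2" for j
      proof -
        have "{v. A j \<omega> u v} \<in> sets borel" unfolding A_def by measurable
        then have "ennreal (measure \<sigma> {v. A j \<omega> u v} * (2 ^ j) ^ q) = X j (\<omega>, u)"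
          by (simp add: X_def S.emeasure_eq_measure ennreal_mult)
        also have "\<dots> \<le> ennreal (B * real (j + 1) ^ 2)" by (rule B)
        also have "\<dots> \<le> ennreal (\<bar>B\<bar> * real (j + 1) ^ 2)" by (intro ennreal_leI mult_right_mono) auto
        finally show ?thesis by (subst (asm) ennreal_le_iff) (auto simp flip: A_def)
      qed
      then show ?case unfolding q_def by blast
    qed
  qed
qed

section \<open>Hausdorff limits\<close>

lemma hausdorff_dist_bdd:
  fixes A B :: "'a::metric_space set"
  assumes "bounded A" "b \<in> B"
  shows "bdd_above ((\<lambda>a. infdist a B) ` A)"
proof -
  obtain e where "\<And>a. a \<in> A \<Longrightarrow> dist b a \<le> e" using assms(1) bounded_any_center[of A b] by auto
  then have "infdist a B \<le> e" if "a \<in> A" for a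
    using infdist_le[OF assms(2), of a] that by (metis dist_commute order_trans)
  then show ?thesis by (intro bdd_aboveI2[of _ _ e]) auto
qed

lemma infdist_le_hausdorff_dist:
  fixes A B :: "'a::metric_space set"
  assumes "bounded A" "bounded B" "A \<noteq> {}" "B \<noteq> {}"
  shows "a \<in> A \<Longrightarrow> infdist a B \<le> hausdorff_dist A B" "b \<in> B \<Longrightarrow> infdist b A \<le> hausdorff_dist A B"
    "0 \<le> hausdorff_dist A B"
proof -
  show 1: "infdist a B \<le> hausdorff_dist A B" if "a \<in> A" for a
    using that assms hausdorff_dist_bdd[OF assms(1)] unfolding hausdorff_dist_def
    by (intro max.coboundedI1 cSUP_upper) auto
  show "infdist b A \<le> hausdorff_dist A B" if "b \<in> B" for b
    using that assms hausdorff_dist_bdd[OF assms(2)] unfolding hausdorff_dist_def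
    by (intro max.coboundedI2 cSUP_upper) auto
  obtain a where "a \<in> A" using assms by blast
  then show "0 \<le> hausdorff_dist A B" using 1[of a] infdist_nonneg[of a B] by linarith
qed

lemma hausdorff_lim_subset:
  fixes A :: "nat \<Rightarrow> 'a::metric_space set"
  assumes A: "\<And>n. bounded (A n)" "\<And>n. A n \<noteq> {}"
    and K: "compact K" "K \<noteq> {}" "(\<lambda>n. hausdorff_dist (A n) K) \<longlonglongrightarrow> 0"
    and L: "compact L" "L \<noteq> {}" "(\<lambda>n. hausdorff_dist (A n) L) \<longlonglongrightarrow> 0"
  shows "L \<subseteq> K"
proof
  fix b assume b: "b \<in> L"
  have bK: "bounded K" "bounded L" using K(1) L(1) compact_imp_bounded by auto
  have le: "infdist b K \<le> hausdorff_dist (A n) L + hausdorff_dist (A n) K" for n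
  proof (rule field_le_epsilon)
    fix x :: real assume x: "0 < x"
    have "infdist b (A n) < hausdorff_dist (A n) L + x"
      using infdist_le_hausdorff_dist(2)[OF A(1) bK(2) A(2) L(2) b, of n] x by linarith
    then obtain a where a: "a \<in> A n" "dist b a < hausdorff_dist (A n) L + x"
      using A(2)[of n] by (auto simp: infdist_def cINF_less_iff)
    have "infdist b K \<le> infdist a K + dist b a" by (rule infdist_triangle)
    also have "infdist a K \<le> hausdorff_dist (A n) K"
      by (rule infdist_le_hausdorff_dist(1)[OF A(1) bK(1) A(2) K(2) a(1)])
    finally show "infdist b K \<le> hausdorff_dist (A n) L + hausdorff_dist (A n) K + x" using a by linarith
  qed
  have "(\<lambda>n. hausdorff_dist (A n) L + hausdorff_dist (A n) K) \<longlonglongrightarrow> 0 + 0"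
    by (intro tendsto_add K L)
  then have "infdist b K \<le> 0" using le by (intro LIMSEQ_le_const[where a="infdist b K"]) auto
  then have "infdist b K = 0" using infdist_nonneg[of b K] by linarith
  then show "b \<in> K" using K(1,2) in_closed_iff_infdist_zero[of K b] compact_imp_closed by blast
qed

text \<open>
  The definite description in \<^const>\<open>hausdorff_lim\<close> is resolved by \<open>hausdorff_lim_subset\<close>, which by
  symmetry gives both inclusions between two compact limits.
\<close>

lemma hausdorff_lim_eqI:
  fixes A :: "nat \<Rightarrow> 'a::metric_space set"
  assumes A: "\<And>n. bounded (A n)" "\<And>n. A n \<noteq> {}"
    and K: "compact K" "K \<noteq> {}" "(\<lambda>n. hausdorff_dist (A n) K) \<longlonglongrightarrow> 0"
  shows "hausdorff_lim A = K"
  unfolding hausdorff_lim_def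
proof (rule the_equality)
  fix L assume "compact L \<and> L \<noteq> {} \<and> (\<lambda>n. hausdorff_dist (A n) L) \<longlonglongrightarrow> 0"
  then show "L = K" using hausdorff_lim_subset[OF A K, of L] hausdorff_lim_subset[OF A _ _ _ K, of L] by blast
qed (use K in auto)

section \<open>Sums of segments\<close>

locale segment_sum =
  fixes \<gamma> :: "nat \<Rightarrow> real" and \<epsilon> :: "nat \<Rightarrow> 'a::euclidean_space"
  assumes \<gamma>_pos: "\<And>k. 0 < \<gamma> k" and \<gamma>_summable: "summable \<gamma>" and \<epsilon>_unit: "\<And>k. norm (\<epsilon> k) = 1"
begin

definition weights :: "(nat \<Rightarrow> real) set" where "weights = (UNIV \<rightarrow>\<^sub>E {0..1})"

definition point :: "(nat \<Rightarrow> real) \<Rightarrow> 'a" where "point s = (\<Sum>k. (\<gamma> k * s k) *\<^sub>R \<epsilon> k)"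

definition zonoid :: "'a set" where "zonoid = point ` weights"

lemma weights_iff: "s \<in> weights \<longleftrightarrow> (\<forall>k. 0 \<le> s k \<and> s k \<le> 1)"
  by (auto simp: weights_def PiE_iff)

lemma term_norm_le: "\<bar>s k\<bar> \<le> c \<Longrightarrow> norm ((\<gamma> k * s k) *\<^sub>R \<epsilon> k) \<le> c * \<gamma> k"
  using \<gamma>_pos[of k] by (simp add: \<epsilon>_unit abs_mult mult.commute mult_right_mono)

lemma summable_terms: 
  assumes "\<And>k. \<bar>s k\<bar> \<le> c"
  shows "summable (\<lambda>k. (\<gamma> k * s k) *\<^sub>R \<epsilon> k)"
  by (rule summable_comparison_test'[OF summable_mult[OF \<gamma>_summable, of c]])
    (use term_norm_le assms in blast)

lemma weights_summable: "s \<in> weights \<Longrightarrow> summable (\<lambda>k. (\<gamma> k * s k) *\<^sub>R \<epsilon> k)"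
  by (rule summable_terms[of _ 1]) (auto simp: weights_iff abs_le_iff intro: order_trans[of _ 0])

lemma point_diff:
  assumes "s \<in> weights" "t \<in> weights"
  shows "point s - point t = (\<Sum>k. (\<gamma> k * (s k - t k)) *\<^sub>R \<epsilon> k)"
  unfolding point_def using assms
  by (subst suminf_diff) (auto simp: weights_summable algebra_simps)

lemma inner_point_diff:
  assumes "s \<in> weights" "t \<in> weights"
  shows "(\<lambda>k. \<gamma> k * (s k - t k) * (w \<bullet> \<epsilon> k)) sums (w \<bullet> (point s - point t))"
proof -
  have "(\<lambda>k. (\<gamma> k * s k) *\<^sub>R \<epsilon> k - (\<gamma> k * t k) *\<^sub>R \<epsilon> k) sums (point s - point t)"
    unfolding point_def using assms by (intro sums_diff summable_sums weights_summable)
  from bounded_linear.sums[OF bounded_linear_inner_right this, of w]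
  show ?thesis by (simp add: inner_simps algebra_simps)
qed

lemma norm_point_diff_le:
  assumes "s \<in> weights" "t \<in> weights" "summable (\<lambda>k. \<gamma> k * \<bar>s k - t k\<bar>)"
  shows "norm (point s - point t) \<le> (\<Sum>k. \<gamma> k * \<bar>s k - t k\<bar>)"
proof -
  have eq: "norm ((\<gamma> k * (s k - t k)) *\<^sub>R \<epsilon> k) = \<gamma> k * \<bar>s k - t k\<bar>" for k
    using \<gamma>_pos[of k] by (simp add: \<epsilon>_unit abs_mult)
  have "norm (\<Sum>k. (\<gamma> k * (s k - t k)) *\<^sub>R \<epsilon> k) \<le> (\<Sum>k. norm ((\<gamma> k * (s k - t k)) *\<^sub>R \<epsilon> k))"
    by (rule summable_norm) (simp only: eq assms(3))
  then show ?thesis by (simp only: eq point_diff[OF assms(1,2)])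
qed

text \<open>
  The weights form a compact product space, on which the series defining \<open>point\<close> converges uniformly.
\<close>

lemma compact_zonoid: "compact zonoid"
  unfolding zonoid_def
proof (rule compact_continuous_image)
  show "compact weights"
    using compactin_PiE[of "\<lambda>_. euclidean" UNIV "\<lambda>_::nat. {0..1::real}"]
    by (simp add: weights_def euclidean_product_topology)
  have "uniform_limit weights (\<lambda>n s. \<Sum>k<n. (\<gamma> k * s k) *\<^sub>R \<epsilon> k) point sequentially"
    unfolding point_def
  proof (rule Weierstrass_m_test[OF _ \<gamma>_summable])
    fix k s assume "s \<in> weights"
    then have "\<bar>s k\<bar> \<le> 1" by (simp add: weights_iff)
    then show "norm ((\<gamma> k * s k) *\<^sub>R \<epsilon> k) \<le> \<gamma> k" using term_norm_le[of s k 1] by simp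
  qed
  then show "continuous_on weights point"
    by (rule uniform_limit_theorem[rotated])
      (auto intro!: always_eventually continuous_intros continuous_on_subset[OF continuous_on_product_coordinates])
qed

lemma convex_zonoid: "convex zonoid"
proof (rule convexI)
  fix x y and u v :: real assume "x \<in> zonoid" "y \<in> zonoid" and uv: "0 \<le> u" "0 \<le> v" "u + v = 1"
  then obtain s t where s: "s \<in> weights" "x = point s" and t: "t \<in> weights" "y = point t" by (auto simp: zonoid_def)
  let ?r = "\<lambda>k. u * s k + v * t k"
  have "?r \<in> weights"
    using s t uv convex_bound_le[of "s _" 1 "t _" u v] by (auto simp: weights_iff)
  moreover have "u *\<^sub>R x + v *\<^sub>R y = point ?r"
  proof -
    have "(\<lambda>k. u *\<^sub>R ((\<gamma> k * s k) *\<^sub>R \<epsilon> k) + v *\<^sub>R ((\<gamma> k * t k) *\<^sub>R \<epsilon> k)) sums (u *\<^sub>R x + v *\<^sub>R y)"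
      unfolding s t point_def
      by (intro sums_add sums_scaleR_right summable_sums weights_summable s(1) t(1))
    then show ?thesis unfolding point_def by (simp add: sums_iff algebra_simps)
  qed
  ultimately show "u *\<^sub>R x + v *\<^sub>R y \<in> zonoid" by (auto simp: zonoid_def)
qed

lemma point_finite: "(\<And>k. n \<le> k \<Longrightarrow> s k = 0) \<Longrightarrow> point s = (\<Sum>k<n. (\<gamma> k * s k) *\<^sub>R \<epsilon> k)"
  unfolding point_def by (rule suminf_finite) (auto simp: not_less)

lemma segment_partial_sum:
  "(\<Sum>k<n. (*\<^sub>R) (\<gamma> k) ` closed_segment 0 (\<epsilon> k)) = point ` {s \<in> weights. \<forall>k\<ge>n. s k = 0}"
proof (intro set_eqI iffI)
  fix x assume "x \<in> (\<Sum>k<n. (*\<^sub>R) (\<gamma> k) ` closed_segment 0 (\<epsilon> k))"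
  then obtain f where f: "x = sum f {..<n}" "\<And>k. k < n \<Longrightarrow> f k \<in> (*\<^sub>R) (\<gamma> k) ` closed_segment 0 (\<epsilon> k)"
    by (auto simp: set_sum_alt)
  have "\<exists>t. 0 \<le> t \<and> t \<le> 1 \<and> f k = (\<gamma> k * t) *\<^sub>R \<epsilon> k" if "k < n" for k
    using f(2)[OF that] by (auto simp: in_segment) blast
  then obtain t where t: "\<And>k. k < n \<Longrightarrow> 0 \<le> t k \<and> t k \<le> 1 \<and> f k = (\<gamma> k * t k) *\<^sub>R \<epsilon> k" by metis
  define s where "s k = (if k < n then t k else 0)" for k
  have "s \<in> {s \<in> weights. \<forall>k\<ge>n. s k = 0}" using t by (auto simp: weights_iff s_def)
  moreover have "x = point s" using t by (subst point_finite[of n]) (auto simp: s_def f(1))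
  ultimately show "x \<in> point ` {s \<in> weights. \<forall>k\<ge>n. s k = 0}" by blast
next
  fix x assume "x \<in> point ` {s \<in> weights. \<forall>k\<ge>n. s k = 0}"
  then obtain s where s: "s \<in> weights" "\<And>k. k \<ge> n \<Longrightarrow> s k = 0" "x = point s" by auto
  have "x = (\<Sum>k<n. (\<gamma> k * s k) *\<^sub>R \<epsilon> k)" using s by (simp add: point_finite)
  moreover have "(\<gamma> k * s k) *\<^sub>R \<epsilon> k \<in> (*\<^sub>R) (\<gamma> k) ` closed_segment 0 (\<epsilon> k)" for k
  proof (rule image_eqI)
    show "s k *\<^sub>R \<epsilon> k \<in> closed_segment 0 (\<epsilon> k)" using s(1) by (auto simp: in_segment weights_iff)
  qed simp
  ultimately show "x \<in> (\<Sum>k<n. (*\<^sub>R) (\<gamma> k) ` closed_segment 0 (\<epsilon> k))"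
    by (auto simp: set_sum_alt)
qed

text \<open>
  Replacing the weights from \<open>n\<close> on by 0 leads from the zonoid to the partial sum and moves a point by
  at most the tail of \<open>\<Sum>k. \<gamma> k\<close>.
\<close>

lemma hausdorff_lim_partial_sums:
  "hausdorff_lim (\<lambda>n. \<Sum>k<n. (*\<^sub>R) (\<gamma> k) ` closed_segment 0 (\<epsilon> k)) = zonoid"
proof -
  define A where "A n = point ` {s \<in> weights. \<forall>k\<ge>n. s k = 0}" for n
  have Asub: "A n \<subseteq> zonoid" for n by (auto simp: A_def zonoid_def)
  have zero: "(\<lambda>_. 0) \<in> weights" by (simp add: weights_iff)
  have An: "bounded (A n)" "A n \<noteq> {}" for n
    using Asub compact_zonoid compact_imp_bounded bounded_subset zero by (blast, auto simp: A_def)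
  have Zn: "zonoid \<noteq> {}" "bounded zonoid"
    using zero compact_zonoid compact_imp_bounded by (auto simp: zonoid_def)
  define r where "r n = (\<Sum>k. \<gamma> (k + n))" for n
  have r0: "0 \<le> r n" for n
    unfolding r_def using \<gamma>_pos \<gamma>_summable by (intro suminf_nonneg) (auto simp: less_imp_le)
  have hd: "hausdorff_dist (A n) zonoid \<le> r n" for n
    unfolding hausdorff_dist_def
  proof (rule max.boundedI; rule cSUP_least)
    fix a assume "a \<in> A n" then show "infdist a zonoid \<le> r n" using Asub[of n] r0 by (auto simp: subset_iff)
  next
    fix b assume "b \<in> zonoid"
    then obtain s where s: "s \<in> weights" "b = point s" by (auto simp: zonoid_def)
    define t where "t k = (if k < n then s k else 0)" for k
    have t: "t \<in> weights" using s by (auto simp: t_def weights_iff)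
    have le: "\<gamma> k * \<bar>s k - t k\<bar> \<le> (if k < n then 0 else \<gamma> k)" for k
      using s(1) \<gamma>_pos[of k] by (auto simp: t_def weights_iff mult_left_le)
    have sm: "summable (\<lambda>k. if k < n then 0 else \<gamma> k)"
      by (rule summable_comparison_test'[OF \<gamma>_summable]) (use \<gamma>_pos in \<open>auto simp: less_imp_le\<close>)
    have sm': "summable (\<lambda>k. \<gamma> k * \<bar>s k - t k\<bar>)"
      by (rule summable_comparison_test'[OF sm]) (use le \<gamma>_pos in \<open>auto simp: less_imp_le abs_mult\<close>)
    have "dist b (point t) \<le> (\<Sum>k. \<gamma> k * \<bar>s k - t k\<bar>)"
      unfolding s dist_norm by (rule norm_point_diff_le[OF s(1) t sm'])
    also have "\<dots> \<le> (\<Sum>k. if k < n then 0 else \<gamma> k)" by (rule suminf_le[OF le sm' sm])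
    also have "\<dots> = r n" unfolding r_def by (subst suminf_split_initial_segment[OF sm, of n]) simp
    finally show "infdist b (A n) \<le> r n"
      using t by (intro infdist_le2[of "point t"]) (auto simp: A_def t_def)
  qed (use An Zn in auto)
  have r_lim: "r \<longlonglongrightarrow> 0"
    unfolding r_def by (rule suminf_exist_split2[OF \<gamma>_summable])
  have "(\<lambda>n. hausdorff_dist (A n) zonoid) \<longlonglongrightarrow> 0"
    by (rule tendsto_sandwich[OF _ _ tendsto_const r_lim])
      (use hd infdist_le_hausdorff_dist(3)[OF An(1) Zn(2) An(2) Zn(1)] in auto)
  then show ?thesis
    unfolding segment_partial_sum A_def[symmetric]
    by (intro hausdorff_lim_eqI An compact_zonoid Zn)
qed

lemma point_update:
  assumes "s \<in> weights" "0 \<le> t" "t \<le> 1"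
  shows "s(k := t) \<in> weights" "point (s(k := t)) = point s + (\<gamma> k * (t - s k)) *\<^sub>R \<epsilon> k"
proof -
  show b: "s(k := t) \<in> weights" using assms by (auto simp: weights_iff)
  have "point (s(k := t)) - point s = (\<Sum>j. (\<gamma> j * ((s(k := t)) j - s j)) *\<^sub>R \<epsilon> j)"
    by (rule point_diff[OF b assms(1)])
  also have "\<dots> = (\<Sum>j\<in>{k}. (\<gamma> j * ((s(k := t)) j - s j)) *\<^sub>R \<epsilon> j)" by (rule suminf_finite) auto
  finally show "point (s(k := t)) = point s + (\<gamma> k * (t - s k)) *\<^sub>R \<epsilon> k" by (simp add: algebra_simps)
qed

text \<open>
  Removing an extreme point from a convex set leaves a convex set, so a hyperplane with normal \<open>u\<close>
  separates the two. Changing a single weight stays in the zonoid, which gives the sign conditions,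
  and a weight strictly between 0 and 1 would make \<open>x\<close> an inner point of a segment.
\<close>

lemma extreme_point_signs:
  assumes "x extreme_point_of zonoid"
  obtains u s where "u \<noteq> 0" "s \<in> weights" "x = point s" "\<And>k. s k = 0 \<or> s k = 1"
    "\<And>k. 0 < u \<bullet> \<epsilon> k \<Longrightarrow> s k = 1" "\<And>k. u \<bullet> \<epsilon> k < 0 \<Longrightarrow> s k = 0"
proof -
  have x: "x \<in> zonoid" "convex (zonoid - {x})"
    using assms extreme_point_of_stillconvex[OF convex_zonoid, of x] by auto
  obtain s where s: "s \<in> weights" "x = point s" using x by (auto simp: zonoid_def)
  have sk: "0 \<le> s k" "s k \<le> 1" for k using s(1) by (auto simp: weights_iff)
  have \<epsilon>0: "\<epsilon> k \<noteq> 0" for k using \<epsilon>_unit[of k] by auto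
  have up: "point (s(k := t)) \<in> zonoid" if "0 \<le> t" "t \<le> 1" for k t
    using point_update(1)[OF s(1) that] by (auto simp: zonoid_def)
  have dich: "s k = 0 \<or> s k = 1" for k
  proof (rule ccontr)
    assume "\<not> ?thesis"
    then have k: "0 < s k" "s k < 1" using sk[of k] by auto
    have "x \<in> open_segment (point (s(k := 0))) (point (s(k := 1)))"
      unfolding in_segment
    proof (intro conjI exI[of _ "s k"])
      show "point (s(k := 0)) \<noteq> point (s(k := 1))"
        using \<epsilon>0[of k] \<gamma>_pos[of k] by (simp add: point_update(2)[OF s(1)] algebra_simps)
      show "x = (1 - s k) *\<^sub>R point (s(k := 0)) + s k *\<^sub>R point (s(k := 1))"
        by (simp add: point_update(2)[OF s(1)] s(2) algebra_simps)
    qed (use k in auto)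
    then show False using assms up[of 0 k] up[of 1 k] by (auto simp: extreme_point_of_def)
  qed
  have "zonoid - {x} \<noteq> {}"
  proof -
    have "point (s(0 := 1 - s 0)) \<noteq> x"
      using dich[of 0] \<epsilon>0[of 0] \<gamma>_pos[of 0] point_update(2)[OF s(1), of "1 - s 0" 0] s(2) by auto
    then show ?thesis using up[of "1 - s 0" 0] sk[of 0] by auto
  qed
  then obtain u b where u: "u \<noteq> 0" "\<And>y. y \<in> zonoid - {x} \<Longrightarrow> u \<bullet> y \<le> b" "b \<le> u \<bullet> x"
    using separating_hyperplane_sets[OF x(2), of "{x}"] by auto
  have max: "u \<bullet> y \<le> u \<bullet> x" if "y \<in> zonoid" for y
    using u(2)[of y] u(3) that by (cases "y = x") auto
  have imp: "(t - s k) * (u \<bullet> \<epsilon> k) \<le> 0" if "0 \<le> t" "t \<le> 1" for k t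
  proof -
    have "u \<bullet> x + \<gamma> k * ((t - s k) * (u \<bullet> \<epsilon> k)) \<le> u \<bullet> x"
      using max[OF up[OF that, of k]] by (simp add: point_update(2)[OF s(1) that] s(2)[symmetric] inner_simps mult_ac)
    then show ?thesis using \<gamma>_pos[of k] by (simp add: mult_le_0_iff)
  qed
  show ?thesis
  proof (rule that[OF u(1) s dich])
    show "s k = 1" if "0 < u \<bullet> \<epsilon> k" for k
      using imp[of 1 k] that sk[of k] by (simp add: mult_le_0_iff)
    show "s k = 0" if "u \<bullet> \<epsilon> k < 0" for k
      using imp[of 0 k] that sk[of k] by (simp add: mult_le_0_iff zero_le_mult_iff)
  qed
qed

end

section \<open>Criteria for null and positive Hausdorff measure\<close>

text \<open>
  A small sum forces each diameter to be small, so the covers need no separate bound on the size of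
  their members.
\<close>

lemma hausdorff_measure_eq_0I:
  fixes A :: "'a::metric_space set"
  assumes s: "0 < s"
    and cover: "\<And>\<zeta>. 0 < \<zeta> \<Longrightarrow> \<exists>I (U :: 'i \<Rightarrow> 'a set). finite I \<and> A \<subseteq> (\<Union>i\<in>I. U i) \<and> (\<forall>i\<in>I. bounded (U i)) \<and>
      (\<Sum>i\<in>I. diameter (U i) powr s) \<le> \<zeta>"
  shows "hausdorff_measure s A = 0"
proof -
  have le: "hausdorff_premeasure \<delta> s A \<le> ennreal \<zeta>" if \<delta>: "0 < \<delta>" and \<zeta>: "0 < \<zeta>" for \<delta> \<zeta>
  proof -
    define z where "z = min \<zeta> (\<delta> powr s)"
    have z: "0 < z" using \<delta> \<zeta> by (simp add: z_def)
    obtain I and U :: "'i \<Rightarrow> 'a set" where U: "finite I" "A \<subseteq> (\<Union>i\<in>I. U i)" "\<And>i. i \<in> I \<Longrightarrow> bounded (U i)"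
      "(\<Sum>i\<in>I. diameter (U i) powr s) \<le> z" using cover[OF z] by blast
    obtain h where h: "bij_betw h {0..<card I} I" using ex_bij_betw_nat_finite[OF U(1)] by blast
    define V where "V n = (if n < card I then U (h n) else {})" for n
    have hI: "h n \<in> I" if "n < card I" for n using h that by (auto simp: bij_betw_def)
    have diam: "diameter (U i) \<le> \<delta>" if i: "i \<in> I" for i
    proof (rule ccontr)
      assume "\<not> diameter (U i) \<le> \<delta>"
      then have "\<delta> powr s < diameter (U i) powr s" using \<delta> s by (intro powr_less_mono2) auto
      also have "\<dots> \<le> (\<Sum>i\<in>I. diameter (U i) powr s)" using i U(1) by (intro member_le_sum) auto
      finally show False using U(4) by (simp add: z_def)
    qed
    have "hausdorff_premeasure \<delta> s A \<le> (\<Sum>n. hausdorff_gauge s (V n))"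
      unfolding hausdorff_premeasure_def
    proof (rule INF_lower, safe)
      fix x assume "x \<in> A"
      then obtain i where "i \<in> I" "x \<in> U i" using U(2) by blast
      moreover obtain n where "n < card I" "i = h n" using h \<open>i \<in> I\<close> unfolding bij_betw_def by (metis atLeastLessThan_iff imageE)
      ultimately show "x \<in> (\<Union>n. V n)" by (auto simp: V_def)
    next
      fix n show "bounded (V n)" "diameter (V n) \<le> \<delta>"
        using U(3) diam hI \<delta> by (auto simp: V_def)
    qed
    also have "\<dots> = (\<Sum>n<card I. hausdorff_gauge s (V n))"
      by (rule suminf_finite) (auto simp: V_def hausdorff_gauge_def)
    also have "\<dots> \<le> (\<Sum>n<card I. ennreal (diameter (U (h n)) powr s))"
      using s by (intro sum_mono) (auto simp: V_def hausdorff_gauge_def)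
    also have "\<dots> = (\<Sum>i\<in>I. ennreal (diameter (U i) powr s))"
      using h by (intro sum.reindex_bij_betw) (simp add: lessThan_atLeast0)
    also have "\<dots> = ennreal (\<Sum>i\<in>I. diameter (U i) powr s)" by (rule sum_ennreal) simp
    also have "\<dots> \<le> ennreal \<zeta>" using U(4) by (intro ennreal_leI) (simp add: z_def)
    finally show ?thesis .
  qed
  have "hausdorff_premeasure \<delta> s A \<le> 0" if "0 < \<delta>" for \<delta>
    by (rule ennreal_le_epsilon) (simp add: le[OF that])
  then have "hausdorff_premeasure \<delta> s A = 0" if "0 < \<delta>" for \<delta>
    using that le_zero_eq by blast
  then show ?thesis by (simp add: hausdorff_measure_def)
qed

text \<open>
  The mass distribution principle. Since \<open>x\<close> is an arbitrary map, the mass of the preimage of a ball is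
  expressed through a measurable set \<open>W\<close> around it. For \<open>s = 0\<close> the gauge of a nonempty set is 1, not
  \<open>\<rho> powr 0\<close>, which is 0 at \<open>\<rho> = 0\<close>.
\<close>

lemma hausdorff_measure_pos_of_mass:
  fixes x :: "'b \<Rightarrow> 'a::metric_space"
  assumes \<sigma>: "finite_measure \<sigma>" and G: "G \<in> sets \<sigma>" "0 < measure \<sigma> G" and A: "x ` G \<subseteq> A"
    and mass: "\<And>u \<rho>. u \<in> G \<Longrightarrow> 0 \<le> \<rho> \<Longrightarrow>
      \<exists>W\<in>sets \<sigma>. {v \<in> G. dist (x v) (x u) \<le> \<rho>} \<subseteq> W \<and> measure \<sigma> W \<le> C * (if s = 0 then 1 else \<rho> powr s)"
  shows "hausdorff_measure s A \<noteq> 0"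
proof
  interpret finite_measure \<sigma> by fact
  assume 0: "hausdorff_measure s A = 0"
  define C' where "C' = \<bar>C\<bar> + 1"
  have C': "0 < C'" "C \<le> C'" by (auto simp: C'_def)
  have "hausdorff_premeasure 1 s A \<le> hausdorff_measure s A"
    unfolding hausdorff_measure_def by (rule SUP_upper) simp
  also have "\<dots> < ennreal (measure \<sigma> G / C')" using G C' 0 by simp
  finally obtain U :: "nat \<Rightarrow> 'a set" where U: "A \<subseteq> (\<Union>i. U i)" "\<And>i. bounded (U i)"
    "(\<Sum>i. hausdorff_gauge s (U i)) < ennreal (measure \<sigma> G / C')"
    unfolding hausdorff_premeasure_def INF_less_iff by auto
  have "\<exists>W\<in>sets \<sigma>. {v \<in> G. x v \<in> U i} \<subseteq> W \<and> emeasure \<sigma> W \<le> ennreal C' * hausdorff_gauge s (U i)" for i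
  proof (cases "\<exists>u\<in>G. x u \<in> U i")
    case True
    then obtain u where u: "u \<in> G" "x u \<in> U i" by blast
    obtain W where W: "W \<in> sets \<sigma>" "{v \<in> G. dist (x v) (x u) \<le> diameter (U i)} \<subseteq> W"
      "measure \<sigma> W \<le> C * (if s = 0 then 1 else diameter (U i) powr s)"
      using mass[OF u(1) diameter_ge_0[OF U(2)]] by blast
    have "emeasure \<sigma> W \<le> ennreal (C' * (if s = 0 then 1 else diameter (U i) powr s))"
      unfolding emeasure_eq_measure
      by (intro ennreal_leI order_trans[OF W(3)] mult_right_mono C') auto
    also have "\<dots> = ennreal C' * hausdorff_gauge s (U i)"
      using u C' by (auto simp: hausdorff_gauge_def ennreal_mult)
    finally show ?thesis
      using W(1,2) diameter_bounded_bound[OF U(2) _ u(2)] by (intro bexI[of _ W]) auto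
  qed (auto intro!: bexI[of _ "{}"])
  then have "\<forall>i. \<exists>W. W \<in> sets \<sigma> \<and> {v \<in> G. x v \<in> U i} \<subseteq> W \<and> emeasure \<sigma> W \<le> ennreal C' * hausdorff_gauge s (U i)"
    by blast
  from choice[OF this] obtain W where W: "\<And>i. W i \<in> sets \<sigma>" "\<And>i. {v \<in> G. x v \<in> U i} \<subseteq> W i"
    "\<And>i. emeasure \<sigma> (W i) \<le> ennreal C' * hausdorff_gauge s (U i)" by blast
  have "emeasure \<sigma> G \<le> emeasure \<sigma> (\<Union>i. W i)"
  proof (rule emeasure_mono)
    show "G \<subseteq> (\<Union>i. W i)"
    proof
      fix v assume v: "v \<in> G"
      then obtain i where "x v \<in> U i" using A U(1) by blast
      then show "v \<in> (\<Union>i. W i)" using W(2)[of i] v by blast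
    qed
  qed (use W in auto)
  also have "\<dots> \<le> (\<Sum>i. emeasure \<sigma> (W i))" using W(1) by (intro emeasure_subadditive_countably) auto
  also have "\<dots> \<le> (\<Sum>i. ennreal C' * hausdorff_gauge s (U i))" using W(3) by (intro suminf_le) auto
  also have "\<dots> = ennreal C' * (\<Sum>i. hausdorff_gauge s (U i))" by simp
  also have "\<dots> < ennreal C' * ennreal (measure \<sigma> G / C')"
    using U(3) C' by (intro ennreal_mult_strict_left_mono) auto
  also have "\<dots> = emeasure \<sigma> G"
    using C' by (simp add: emeasure_eq_measure flip: ennreal_mult)
  finally show False by simp
qed

lemma quadratic_times_geometric:
  fixes q :: real
  assumes "0 < q" "q < 1"
  shows "(\<lambda>j. real (j + 1) ^ 2 * q ^ j) \<longlonglongrightarrow> 0"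
proof -
  define y where "y = sqrt q"
  have y: "0 < y" "y < 1" "y\<^sup>2 = q" using assms by (auto simp: y_def)
  have "(\<lambda>n. of_nat n * y ^ n) \<longlonglongrightarrow> 0" using y by (intro powser_times_n_limit_0) auto
  then have "(\<lambda>n. real (n + 1) * y ^ (n + 1)) \<longlonglongrightarrow> 0"
    using LIMSEQ_ignore_initial_segment[of "\<lambda>n. real n * y ^ n" 0 1] by simp
  then have "(\<lambda>n. (real (n + 1) * y ^ (n + 1))\<^sup>2 / q) \<longlonglongrightarrow> 0\<^sup>2 / q" using assms by (intro tendsto_intros) auto
  moreover have "(real (n + 1) * y ^ (n + 1))\<^sup>2 / q = real (n + 1) ^ 2 * q ^ n" for n
  proof -
    have "(y ^ (n + 1))\<^sup>2 = q * q ^ n" using y(3) by (metis power_Suc Suc_eq_plus1 power_commutes power_mult mult.commute)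
    then show ?thesis using assms by (simp add: power_mult_distrib)
  qed
  ultimately show ?thesis by simp
qed

section \<open>The upper bound\<close>

lemma powr_le_exp:
  fixes y s :: real
  assumes "0 \<le> y" "0 < s"
  shows "y powr s \<le> s powr s * exp y"
proof -
  have "y / s \<le> exp (y / s)" using exp_ge_add_one_self[of "y / s"] by linarith
  then have "(y / s) powr s \<le> exp (y / s) powr s" using assms by (intro powr_mono2) auto
  also have "\<dots> = exp y" using assms by (simp add: exp_powr_real)
  finally have "(y / s) powr s \<le> exp y" .
  moreover have "(y / s) powr s = y powr s / s powr s" using assms by (simp add: powr_divide)
  ultimately show ?thesis using assms by (simp add: field_simps)
qed

context segment_sum
begin

definition late_hits :: "nat \<Rightarrow> 'a set \<Rightarrow> real" where
  "late_hits n H = (\<Sum>k. \<gamma> (k + n) * indicator H (\<epsilon> (k + n)))"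

lemma late_hits_summable: "summable (\<lambda>k. \<gamma> (k + n) * indicator H (\<epsilon> (k + n)))"
proof (rule summable_comparison_test')
  show "summable (\<lambda>k. \<gamma> (k + n))" using \<gamma>_summable by (rule summable_ignore_initial_segment)
  show "norm (\<gamma> (k + n) * indicator H (\<epsilon> (k + n))) \<le> \<gamma> (k + n)" for k
    using \<gamma>_pos[of "k + n"] by (auto simp: indicator_def)
qed

lemma late_hits_nonneg: "0 \<le> late_hits n H"
  unfolding late_hits_def using \<gamma>_pos
  by (intro suminf_nonneg late_hits_summable) (auto simp: less_imp_le)

text \<open>
  The sign of \<open>\<epsilon> k \<bullet> c\<close> fixes the weight of a vector outside \<open>H\<close>. A vector in \<open>H\<close> gets weight 1 if it
  is listed in \<open>S\<close>; the late ones are never listed, and \<open>late_hits\<close> bounds the error.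
\<close>

definition pattern :: "'a \<Rightarrow> 'a set \<Rightarrow> nat set \<Rightarrow> nat \<Rightarrow> real" where
  "pattern c H S k = (if \<epsilon> k \<in> H then of_bool (k \<in> S) else of_bool (0 < \<epsilon> k \<bullet> c))"

text \<open>
  If \<open>t *\<^sub>R u\<close> is within \<open>h\<close> of \<open>c\<close> and \<open>\<bar>\<epsilon> k \<bullet> c\<bar> > h\<close>, then \<open>\<epsilon> k \<bullet> u\<close> and \<open>\<epsilon> k \<bullet> c\<close> have the same
  sign. With \<open>S\<close> the early undecided indices of weight 1, the pattern agrees with the weights of \<open>x\<close>
  except at late indices.
\<close>

lemma extreme_point_near_pattern:
  assumes x: "x extreme_point_of zonoid"
    and net: "\<And>u. u \<noteq> 0 \<Longrightarrow> \<exists>c\<in>P. \<exists>t>0. norm (t *\<^sub>R u - c) \<le> h"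
  obtains c S where "c \<in> P" "S \<subseteq> {k. k < n \<and> \<bar>\<epsilon> k \<bullet> c\<bar> \<le> h}"
    "dist (point (pattern c {e. \<bar>e \<bullet> c\<bar> \<le> h} S)) x \<le> late_hits n {e. \<bar>e \<bullet> c\<bar> \<le> h}"
proof -
  obtain u s where us: "u \<noteq> 0" "s \<in> weights" "x = point s" "\<And>k. s k = 0 \<or> s k = 1"
    "\<And>k. 0 < u \<bullet> \<epsilon> k \<Longrightarrow> s k = 1" "\<And>k. u \<bullet> \<epsilon> k < 0 \<Longrightarrow> s k = 0"
    using extreme_point_signs[OF x] by blast
  obtain c t where c: "c \<in> P" "0 < t" "norm (t *\<^sub>R u - c) \<le> h" using net[OF us(1)] by blast
  define H where "H = {e. \<bar>e \<bullet> c\<bar> \<le> h}"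
  define S where "S = {k. k < n \<and> \<epsilon> k \<in> H \<and> s k = 1}"
  have outside: "s k = pattern c H S k" if "\<epsilon> k \<notin> H" for k
  proof -
    have "\<bar>\<epsilon> k \<bullet> (t *\<^sub>R u - c)\<bar> \<le> norm (\<epsilon> k) * norm (t *\<^sub>R u - c)" by (rule Cauchy_Schwarz_ineq2)
    also have "\<dots> \<le> h" using c(3) by (simp add: \<epsilon>_unit)
    also have "h < \<bar>\<epsilon> k \<bullet> c\<bar>" using that by (simp add: H_def)
    finally have "\<bar>t * (u \<bullet> \<epsilon> k) - \<epsilon> k \<bullet> c\<bar> < \<bar>\<epsilon> k \<bullet> c\<bar>" by (simp add: inner_simps inner_commute)
    then have "if 0 < \<epsilon> k \<bullet> c then 0 < t * (u \<bullet> \<epsilon> k) else t * (u \<bullet> \<epsilon> k) < 0"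
      by (auto simp: abs_if split: if_splits)
    then show ?thesis
      using us(5,6)[of k] c(2) that by (auto simp: pattern_def zero_less_mult_iff mult_less_0_iff split: if_splits)
  qed
  have pb: "pattern c H S \<in> weights" by (auto simp: weights_iff pattern_def)
  define g where "g k = \<gamma> k * \<bar>pattern c H S k - s k\<bar>" for k
  have g1: "g k \<le> \<gamma> k * indicator H (\<epsilon> k)" for k
    using outside[of k] us(4)[of k] \<gamma>_pos[of k]
    by (cases "\<epsilon> k \<in> H") (auto simp: g_def pattern_def of_bool_def)
  have g0: "g k = 0" if "k < n" for k
    using outside[of k] us(4)[of k] that
    by (cases "\<epsilon> k \<in> H") (auto simp: g_def pattern_def S_def)
  have gpos: "0 \<le> g k" for k using \<gamma>_pos[of k] by (simp add: g_def)
  have gs: "summable g"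
  proof (rule summable_comparison_test'[OF \<gamma>_summable])
    show "norm (g k) \<le> \<gamma> k" for k
      using g1[of k] gpos[of k] \<gamma>_pos[of k] by (cases "\<epsilon> k \<in> H") auto
  qed
  have "dist (point (pattern c H S)) x \<le> suminf g"
    using norm_point_diff_le[OF pb us(2)] gs unfolding g_def us(3) dist_norm by blast
  also have "suminf g = (\<Sum>k. g (k + n))"
    using suminf_split_initial_segment[OF gs, of n] g0 by simp
  also have "\<dots> \<le> late_hits n H"
    unfolding late_hits_def
    by (intro suminf_le g1 late_hits_summable summable_ignore_initial_segment gs)
  finally show ?thesis
    by (intro that[of c S]) (auto simp: c H_def S_def)
qed

text \<open>
  If \<open>T\<close> is the late part of the cost, the radius is at most \<open>C * n powr - \<beta> * T\<close>, and
  \<open>T powr s \<le> s powr s * exp T\<close>. The factor \<open>exp T\<close> and the number of patterns combine to the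
  exponential of the total cost.
\<close>

lemma pattern_count_times_radius_le:
  assumes \<beta>: "1 < \<beta>" and n: "1 \<le> n" and s: "0 < s" and C: "0 < C"
    and \<gamma>_le: "\<And>k. \<gamma> k \<le> C * real (k + 1) powr - \<beta>"
  shows "2 ^ card {k. k < n \<and> \<epsilon> k \<in> H} * (2 * late_hits n H) powr s
    \<le> (2 * C) powr s * s powr s * real n powr (- \<beta> * s) * exp (\<Sum>k. hit_cost \<beta> n k * indicator H (\<epsilon> k))"
proof -
  define a where "a k = hit_cost \<beta> n k * indicator H (\<epsilon> k)" for k
  have a0: "0 \<le> a k" for k using hit_cost_nonneg by (simp add: a_def)
  have as: "summable a"
  proof (rule summable_comparison_test'[OF hit_cost_sum_le(1)[OF \<beta> n]])
    fix k
    have "hit_cost \<beta> n k \<le> exp (hit_cost \<beta> n k) - 1"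
      using exp_ge_add_one_self[of "hit_cost \<beta> n k"] by linarith
    then show "norm (a k) \<le> exp (hit_cost \<beta> n k) - 1"
      using hit_cost_nonneg[of \<beta> n k] by (cases "\<epsilon> k \<in> H") (auto simp: a_def)
  qed
  define F where "F = {k. k < n \<and> \<epsilon> k \<in> H}"
  define T where "T = (\<Sum>k. a (k + n))"
  have as': "summable (\<lambda>k. a (k + n))" using as by (rule summable_ignore_initial_segment)
  have T0: "0 \<le> T" unfolding T_def using a0 as' by (intro suminf_nonneg) auto
  have "(\<Sum>k<n. a k) = (\<Sum>k<n. if \<epsilon> k \<in> H then ln 2 else 0)"
    by (intro sum.cong) (auto simp: a_def hit_cost_def)
  also have "\<dots> = real (card F) * ln 2"
    by (simp add: F_def sum.If_cases Int_def lessThan_def)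
  finally have "suminf a = T + real (card F) * ln 2"
    unfolding T_def using suminf_split_initial_segment[OF as, of n] by simp
  then have e: "exp (suminf a) = exp T * 2 ^ card F"
    by (simp add: exp_add exp_of_nat_mult)
  have "late_hits n H \<le> (\<Sum>k. C * real n powr - \<beta> * a (k + n))"
    unfolding late_hits_def
  proof (intro suminf_le late_hits_summable summable_mult as')
    fix k
    have "real n powr - \<beta> * real n powr \<beta> = 1" using n by (simp flip: powr_add)
    then have eq: "C * real n powr - \<beta> * a (k + n) = C * real (k + n + 1) powr - \<beta> * indicator H (\<epsilon> (k + n))"
      by (simp add: a_def hit_cost_def mult_ac)
    show "\<gamma> (k + n) * indicator H (\<epsilon> (k + n)) \<le> C * real n powr - \<beta> * a (k + n)"
      unfolding eq by (rule mult_right_mono[OF \<gamma>_le]) simp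
  qed
  also have "\<dots> = C * real n powr - \<beta> * T" unfolding T_def by (rule suminf_mult[OF as'])
  finally have "(2 * late_hits n H) powr s \<le> (2 * C * (real n powr - \<beta> * T)) powr s"
    using late_hits_nonneg s by (intro powr_mono2) (auto simp: mult.assoc)
  also have "\<dots> = (2 * C) powr s * real n powr (- \<beta> * s) * T powr s"
    using C T0 by (simp add: powr_mult powr_powr)
  also have "\<dots> \<le> (2 * C) powr s * real n powr (- \<beta> * s) * (s powr s * exp T)"
    by (intro mult_left_mono powr_le_exp T0 s) auto
  finally have "2 ^ card F * (2 * late_hits n H) powr s
      \<le> 2 ^ card F * ((2 * C) powr s * real n powr (- \<beta> * s) * (s powr s * exp T))"
    by (intro mult_left_mono) auto
  also have "\<dots> = (2 * C) powr s * s powr s * real n powr (- \<beta> * s) * exp (suminf a)"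
    by (simp add: e)
  finally show ?thesis unfolding F_def a_def[abs_def] .
qed

lemma hausdorff_measure_extreme_points_eq_0:
  assumes \<beta>: "1 < \<beta>" and s: "0 < s" "real (DIM('a) - 1) < \<beta> * s" and C: "0 < C"
    and \<gamma>_le: "\<And>k. \<gamma> k \<le> C * real (k + 1) powr - \<beta>"
    and P: "\<And>j. finite (P j)"
      "\<And>j u. u \<noteq> 0 \<Longrightarrow> \<exists>c\<in>P j. \<exists>t>0. norm (t *\<^sub>R u - c) \<le> real DIM('a) / 2 ^ j"
    and B: "\<And>j. (\<Sum>c\<in>P j. exp (\<Sum>k. hit_cost \<beta> (2 ^ j) k *
      indicator {e. \<bar>e \<bullet> c\<bar> \<le> real DIM('a) / 2 ^ j} (\<epsilon> k))) \<le> B * real (j + 1) ^ 2 * (2 ^ j) ^ (DIM('a) - 1)"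
  shows "hausdorff_measure s {x. x extreme_point_of zonoid} = 0"
proof (rule hausdorff_measure_eq_0I[OF s(1)])
  fix \<zeta> :: real assume \<zeta>: "0 < \<zeta>"
  define d where "d = real (DIM('a) - 1)"
  define K where "K = (2 * C) powr s * s powr s"
  define q where "q = 2 powr (d - \<beta> * s)"
  have q: "0 < q" "q < 1"
    unfolding q_def using s(2) powr_less_mono[of "d - \<beta> * s" 0 2] by (auto simp: d_def)
  have "(\<lambda>j. K * B * (real (j + 1) ^ 2 * q ^ j)) \<longlonglongrightarrow> K * B * 0"
    by (intro tendsto_mult tendsto_const quadratic_times_geometric q)
  then have "\<forall>\<^sub>F j in sequentially. K * B * (real (j + 1) ^ 2 * q ^ j) < \<zeta>"
    using \<zeta> by (intro order_tendstoD(2)) auto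
  then obtain j where j: "K * B * (real (j + 1) ^ 2 * q ^ j) < \<zeta>"
    by (auto simp: eventually_sequentially)
  define n :: nat where "n = 2 ^ j"
  define H where "H c = {e :: 'a. \<bar>e \<bullet> c\<bar> \<le> real DIM('a) / 2 ^ j}" for c
  define F where "F c = {k. k < n \<and> \<epsilon> k \<in> H c}" for c
  have finF: "finite (F c)" for c by (simp add: F_def)
  define I where "I = Sigma (P j) (\<lambda>c. Pow (F c))"
  define U where "U = (\<lambda>(c, S). cball (point (pattern c (H c) S)) (late_hits n (H c)))"
  have "finite I" unfolding I_def using P(1) finF by (intro finite_SigmaI) auto
  moreover have "{x. x extreme_point_of zonoid} \<subseteq> (\<Union>i\<in>I. U i)"
  proof safe
    fix x assume "x extreme_point_of zonoid"
    then obtain c S where "c \<in> P j" "S \<subseteq> {k. k < n \<and> \<bar>\<epsilon> k \<bullet> c\<bar> \<le> real DIM('a) / 2 ^ j}"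
      "dist (point (pattern c {e. \<bar>e \<bullet> c\<bar> \<le> real DIM('a) / 2 ^ j} S)) x \<le> late_hits n {e. \<bar>e \<bullet> c\<bar> \<le> real DIM('a) / 2 ^ j}"
      using extreme_point_near_pattern[of x "P j" "real DIM('a) / 2 ^ j" n] P(2) by blast
    then show "x \<in> (\<Union>i\<in>I. U i)"
      by (intro UN_I[of "(c, S)"]) (auto simp: I_def U_def F_def H_def)
  qed
  moreover have "\<forall>i\<in>I. bounded (U i)" by (auto simp: U_def)
  moreover have "(\<Sum>i\<in>I. diameter (U i) powr s) \<le> \<zeta>"
  proof -
    have "(\<Sum>i\<in>I. diameter (U i) powr s) = (\<Sum>c\<in>P j. \<Sum>S\<in>Pow (F c). diameter (U (c, S)) powr s)"
      unfolding I_def using P(1) finF by (subst sum.Sigma) auto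
    also have "\<dots> = (\<Sum>c\<in>P j. 2 ^ card (F c) * (2 * late_hits n (H c)) powr s)"
      using late_hits_nonneg finF by (intro sum.cong) (auto simp: U_def card_Pow not_less[symmetric])
    also have "\<dots> \<le> (\<Sum>c\<in>P j. K * real n powr (- \<beta> * s) * exp (\<Sum>k. hit_cost \<beta> n k * indicator (H c) (\<epsilon> k)))"
      unfolding K_def F_def
      by (intro sum_mono pattern_count_times_radius_le \<beta> s C \<gamma>_le) (simp add: n_def)
    also have "\<dots> = K * real n powr (- \<beta> * s) * (\<Sum>c\<in>P j. exp (\<Sum>k. hit_cost \<beta> n k * indicator (H c) (\<epsilon> k)))"
      by (simp add: sum_distrib_left)
    also have "\<dots> \<le> K * real n powr (- \<beta> * s) * (B * real (j + 1) ^ 2 * (2 ^ j) ^ (DIM('a) - 1))"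
      using B[of j] unfolding n_def H_def by (intro mult_left_mono) (auto simp: K_def)
    also have "\<dots> = K * B * (real (j + 1) ^ 2 * q ^ j)"
    proof -
      have "real n powr (- \<beta> * s) * (2 ^ j) ^ (DIM('a) - 1) = q ^ j"
        by (simp add: n_def q_def d_def powr_realpow[symmetric] powr_powr powr_add[symmetric] algebra_simps)
      then show ?thesis by (simp add: mult_ac)
    qed
    finally show ?thesis using j by simp
  qed
  ultimately show "\<exists>I (U :: 'a \<times> nat set \<Rightarrow> 'a set). finite I \<and> {x. x extreme_point_of zonoid} \<subseteq> (\<Union>i\<in>I. U i) \<and>
    (\<forall>i\<in>I. bounded (U i)) \<and> (\<Sum>i\<in>I. diameter (U i) powr s) \<le> \<zeta>" by blast
qed

end

section \<open>The lower bound\<close>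

context segment_sum
begin

definition vertex :: "'a \<Rightarrow> 'a" where
  "vertex u = point (\<lambda>k. of_bool (0 < u \<bullet> \<epsilon> k))"

lemma of_bool_weights: "(\<lambda>k. of_bool (Q k)) \<in> weights"
  by (auto simp: weights_iff)

text \<open>
  Every term of \<open>u \<bullet> (vertex u - y)\<close> is nonnegative, and a term is positive wherever the weights differ.
\<close>

lemma vertex_unique_max:
  assumes u: "\<And>k. u \<bullet> \<epsilon> k \<noteq> 0" and y: "y \<in> zonoid" "y \<noteq> vertex u"
  shows "u \<bullet> y < u \<bullet> vertex u"
proof -
  obtain s where s: "s \<in> weights" "y = point s" using y(1) by (auto simp: zonoid_def)
  let ?t = "\<lambda>k. of_bool (0 < u \<bullet> \<epsilon> k) :: real"
  let ?f = "\<lambda>k. \<gamma> k * (?t k - s k) * (u \<bullet> \<epsilon> k)"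
  have sums: "?f sums (u \<bullet> (vertex u - y))"
    unfolding vertex_def s(2) by (rule inner_point_diff[OF of_bool_weights s(1)])
  have f0: "0 \<le> ?f k" for k
    using s(1) \<gamma>_pos[of k] by (cases "0 < u \<bullet> \<epsilon> k") (auto simp: weights_iff zero_le_mult_iff mult_le_0_iff not_less)
  have "s \<noteq> ?t" using y(2) s(2) by (auto simp: vertex_def)
  then obtain k where k: "s k \<noteq> ?t k" by (auto simp: fun_eq_iff)
  have "0 < ?f k" using f0[of k] \<gamma>_pos[of k] k u[of k] by (auto simp: less_le)
  also have "?f k \<le> suminf ?f"
    using sum_le_suminf[OF sums_summable[OF sums], of "{k}"] f0 by simp
  also have "\<dots> = u \<bullet> (vertex u - y)" using sums by (simp add: sums_iff)
  finally show ?thesis by (simp add: inner_diff_right)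
qed

lemma vertex_extreme_point:
  assumes u: "\<And>k. u \<bullet> \<epsilon> k \<noteq> 0"
  shows "vertex u extreme_point_of zonoid"
  unfolding extreme_point_of_def
proof (intro conjI ballI notI)
  show "vertex u \<in> zonoid" unfolding vertex_def zonoid_def by (intro imageI of_bool_weights)
  fix a b assume a: "a \<in> zonoid" and b: "b \<in> zonoid" and seg: "vertex u \<in> open_segment a b"
  then obtain t where t: "0 < t" "t < 1" "vertex u = (1 - t) *\<^sub>R a + t *\<^sub>R b" and ab: "a \<noteq> b"
    by (auto simp: in_segment)
  have le: "u \<bullet> y \<le> u \<bullet> vertex u" if "y \<in> zonoid" for y
    using vertex_unique_max[OF u that] by (cases "y = vertex u") auto
  have eq: "u \<bullet> vertex u = (1 - t) * (u \<bullet> a) + t * (u \<bullet> b)"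
    by (subst t(3)) (simp add: inner_simps)
  consider "a \<noteq> vertex u" | "b \<noteq> vertex u" using ab by blast
  then have "(1 - t) * (u \<bullet> a) + t * (u \<bullet> b) < (1 - t) * (u \<bullet> vertex u) + t * (u \<bullet> vertex u)"
  proof cases
    case 1
    then show ?thesis
      using t vertex_unique_max[OF u a] le[OF b] by (intro add_less_le_mono mult_strict_left_mono mult_left_mono) auto
  next
    case 2
    then show ?thesis
      using t vertex_unique_max[OF u b] le[OF a] by (intro add_le_less_mono mult_strict_left_mono mult_left_mono) auto
  qed
  then show False using eq by (simp add: algebra_simps)
qed

text \<open>
  Every term of \<open>(u - v) \<bullet> (vertex u - vertex v)\<close> is nonnegative, so term \<open>i\<close> alone is a lower bound.
\<close>

lemma vertex_dist_ge:
  assumes "splits \<eta> (\<epsilon> i) u v"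
  shows "\<gamma> i * \<eta> \<le> dist (vertex u) (vertex v)"
proof -
  let ?f = "\<lambda>k. \<gamma> k * (of_bool (0 < u \<bullet> \<epsilon> k) - of_bool (0 < v \<bullet> \<epsilon> k)) * ((u - v) \<bullet> \<epsilon> k)"
  have sp: "(u \<bullet> \<epsilon> i) * (v \<bullet> \<epsilon> i) < 0" "\<eta> * dist u v \<le> \<bar>(u - v) \<bullet> \<epsilon> i\<bar>"
    using assms by (auto simp: splits_def inner_commute)
  have uv: "0 < dist u v" using sp(1) by (auto simp: mult_less_0_iff)
  have sums: "?f sums ((u - v) \<bullet> (vertex u - vertex v))"
    unfolding vertex_def by (rule inner_point_diff[OF of_bool_weights of_bool_weights])
  have f0: "0 \<le> ?f k" for k
    using \<gamma>_pos[of k] by (cases "0 < u \<bullet> \<epsilon> k"; cases "0 < v \<bullet> \<epsilon> k") (auto simp: inner_diff_left mult_le_0_iff)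
  have "\<gamma> i * \<eta> * dist u v \<le> \<gamma> i * \<bar>(u - v) \<bullet> \<epsilon> i\<bar>"
    using sp(2) \<gamma>_pos[of i] by (simp add: mult.assoc mult_left_mono)
  also have "\<dots> = ?f i" using sp(1) by (auto simp: mult_less_0_iff inner_diff_left)
  also have "\<dots> \<le> suminf ?f"
    using sum_le_suminf[OF sums_summable[OF sums], of "{i}"] f0 by simp
  also have "\<dots> = (u - v) \<bullet> (vertex u - vertex v)" using sums by (simp add: sums_iff)
  also have "\<dots> \<le> norm (u - v) * norm (vertex u - vertex v)" by (rule norm_cauchy_schwarz)
  finally have "\<gamma> i * \<eta> * dist u v \<le> dist (vertex u) (vertex v) * dist u v"
    by (simp add: dist_norm mult.commute)
  then show ?thesis using uv by simp
qed

end

text \<open>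
  If \<open>\<rho> < c * \<eta> * 2 powr (- \<beta> * j)\<close>, the directions whose vertex is within \<open>\<rho>\<close> of that of \<open>u\<close> are not
  split from \<open>u\<close> by the first \<open>2 ^ j\<close> vectors. Taking the largest such \<open>j\<close> gives a mass of at most
  \<open>(j + 1)\<^sup>2 * \<rho> powr ((DIM('a) - 1) / \<beta>)\<close> up to a constant. As \<open>s\<close> is smaller than this exponent, the
  factor \<open>(j + 1)\<^sup>2\<close> is absorbed.
\<close>

lemma (in segment_sum) mass_near_vertex_le:
  fixes \<sigma> :: "'a measure"
  assumes \<sigma>: "prob_space \<sigma>" "sets \<sigma> = sets borel"
    and \<beta>: "0 < \<beta>" and s: "0 < s" "\<beta> * s < real (DIM('a) - 1)"
    and c: "0 < c" "\<And>k. c * real (k + 1) powr - \<beta> \<le> \<gamma> k" and \<eta>: "0 < \<eta>"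
  shows "\<exists>C. \<forall>u \<rho>. (\<forall>j. measure \<sigma> {v. \<forall>i<2^j. \<not> splits \<eta> (\<epsilon> i) u v} * (2 ^ j) ^ (DIM('a) - 1) \<le> B * real (j + 1) ^ 2) \<longrightarrow>
    0 \<le> \<rho> \<longrightarrow> (\<exists>W\<in>sets \<sigma>. {v. dist (vertex v) (vertex u) \<le> \<rho>} \<subseteq> W \<and> measure \<sigma> W \<le> C * \<rho> powr s)"
proof -
  interpret prob_space \<sigma> by fact
  note [simp, measurable_cong] = \<sigma>(2)
  have [simp]: "space \<sigma> = UNIV" using sets_eq_imp_space_eq[OF \<sigma>(2)] by simp
  define d where "d = DIM('a) - 1"
  define a where "a = c * \<eta>"
  have a: "0 < a" using c \<eta> by (simp add: a_def)
  define r where "r j = 2 powr (- \<beta> * real j)" for j :: nat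
  have r_mono: "r (Suc j) = 2 powr - \<beta> * r j" for j
    by (simp add: r_def algebra_simps flip: powr_add)
  have rpos: "0 < r j" for j by (simp add: r_def)
  have r_lim: "r \<longlonglongrightarrow> 0"
  proof -
    have "r = (\<lambda>j. (2 powr - \<beta>) ^ j)" by (simp add: r_def fun_eq_iff powr_realpow[symmetric] powr_powr)
    moreover have "2 powr - \<beta> < 1" using \<beta> powr_less_mono[of "- \<beta>" 0 2] by simp
    ultimately show ?thesis by (simp add: LIMSEQ_realpow_zero)
  qed
  define q where "q = 2 powr (\<beta> * s - real d)"
  have q: "0 < q" "q < 1"
    unfolding q_def using s powr_less_mono[of "\<beta> * s - real d" 0 2] by (auto simp: d_def)
  obtain K where K: "\<And>j. real (j + 1) ^ 2 * q ^ j \<le> K"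
    using convergent_imp_bounded[OF quadratic_times_geometric[OF q]]
    unfolding bounded_iff by (auto simp: abs_le_iff) 
  have rq: "(r j) powr s * 2 ^ (j * d) * q ^ j = 1" for j
    by (simp add: r_def q_def powr_powr powr_realpow[symmetric] algebra_simps flip: powr_add)
  define W where "W u j = {v. \<forall>i<2^j. \<not> splits \<eta> (\<epsilon> i) u v}" for u and j :: nat
  have [measurable]: "W u j \<in> sets borel" for u j unfolding W_def by measurable
  have near: "{v. dist (vertex v) (vertex u) \<le> \<rho>} \<subseteq> W u j" if \<rho>: "\<rho> < a * r j" for u j \<rho>
  proof (safe, unfold W_def, safe)
    fix v i assume v: "dist (vertex v) (vertex u) \<le> \<rho>" and i: "i < 2 ^ j" and sp: "splits \<eta> (\<epsilon> i) u v"
    have "real (i + 1) \<le> 2 ^ j" using i by (metis Suc_eq_plus1 Suc_leI of_nat_le_iff of_nat_numeral of_nat_power)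
    then have "(2 ^ j) powr - \<beta> \<le> real (i + 1) powr - \<beta>" using \<beta> by (intro powr_mono2') auto
    moreover have "(2 ^ j) powr - \<beta> = r j" by (simp add: r_def powr_realpow[symmetric] powr_powr mult.commute)
    ultimately have "c * r j \<le> \<gamma> i" using c(2)[of i] c(1) by (metis mult_le_cancel_left_pos order_trans)
    then have "a * r j \<le> \<gamma> i * \<eta>" using mult_right_mono[of "c * r j" "\<gamma> i" \<eta>] \<eta> by (simp add: a_def mult_ac)
    also have "\<dots> \<le> dist (vertex u) (vertex v)" by (rule vertex_dist_ge[OF sp])
    finally show False using v \<rho> by (simp add: dist_commute)
  qed
  define C where "C = a powr - s + \<bar>B\<bar> * K * (2 powr \<beta> / a) powr s"
  have K0: "0 \<le> K" using K[of 0] q by (auto intro: order_trans[rotated])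
  show ?thesis
  proof (intro exI[of _ C] allI impI)
    fix u and \<rho> :: real
    assume u: "\<forall>j. measure \<sigma> {v. \<forall>i<2^j. \<not> splits \<eta> (\<epsilon> i) u v} * (2 ^ j) ^ (DIM('a) - 1) \<le> B * real (j + 1) ^ 2"
      and \<rho>: "0 \<le> \<rho>"
      \<comment> \<open>By \<open>rq\<close>, \<open>1 / (2 ^ j) ^ d\<close> is \<open>r j powr s\<close> times \<open>q ^ j\<close> with \<open>q < 1\<close>, which absorbs \<open>(j + 1)\<^sup>2\<close>.\<close>
    have mW: "measure \<sigma> (W u j) \<le> \<bar>B\<bar> * K * r j powr s" for j
    proof -
      have "measure \<sigma> (W u j) = (measure \<sigma> (W u j) * (2 ^ j) ^ d) * (r j powr s * q ^ j)"
        using rq[of j] by (simp add: power_mult[symmetric] mult_ac)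
      also have "\<dots> \<le> (\<bar>B\<bar> * real (j + 1) ^ 2) * (r j powr s * q ^ j)"
      proof (rule mult_right_mono)
        have "measure \<sigma> (W u j) * (2 ^ j) ^ d \<le> B * real (j + 1) ^ 2" using u by (simp add: W_def d_def)
        also have "\<dots> \<le> \<bar>B\<bar> * real (j + 1) ^ 2" by (intro mult_right_mono) auto
        finally show "measure \<sigma> (W u j) * (2 ^ j) ^ d \<le> \<bar>B\<bar> * real (j + 1) ^ 2" .
      qed (use q in auto)
      also have "\<dots> = \<bar>B\<bar> * (real (j + 1) ^ 2 * q ^ j) * r j powr s" by simp
      also have "\<dots> \<le> \<bar>B\<bar> * K * r j powr s" by (intro mult_right_mono mult_left_mono K) auto
      finally show ?thesis .
    qed
    consider "\<rho> = 0" | "0 < \<rho>" "\<rho> < a" | "a \<le> \<rho>" using \<rho> by linarith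
    then show "\<exists>W\<in>sets \<sigma>. {v. dist (vertex v) (vertex u) \<le> \<rho>} \<subseteq> W \<and> measure \<sigma> W \<le> C * \<rho> powr s"
    proof cases
      case 1
      have "measure \<sigma> (\<Inter>j. W u j) \<le> \<bar>B\<bar> * K * r j powr s" for j
        by (rule order_trans[OF finite_measure_mono mW]) auto
      moreover have "(\<lambda>j. r j powr s) \<longlonglongrightarrow> 0"
        by (rule tendsto_zero_powrI[OF r_lim tendsto_const _ s(1)]) (use rpos in \<open>auto simp: less_imp_le\<close>)
      then have "(\<lambda>j. \<bar>B\<bar> * K * r j powr s) \<longlonglongrightarrow> \<bar>B\<bar> * K * 0"
        by (intro tendsto_mult tendsto_const)
      ultimately have "measure \<sigma> (\<Inter>j. W u j) \<le> 0"
        by (intro LIMSEQ_le_const[where a="measure \<sigma> (\<Inter>j. W u j)"]) auto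
      moreover have "{v. dist (vertex v) (vertex u) \<le> \<rho>} \<subseteq> (\<Inter>j. W u j)"
        using near[of \<rho>] 1 a rpos by (auto simp: W_def)
      ultimately show ?thesis using 1 by (intro bexI[of _ "\<Inter>j. W u j"]) auto
    next
      case 2
      have "\<exists>j. a * r (Suc j) \<le> \<rho>"
      proof -
        have "(\<lambda>j. a * r (Suc j)) \<longlonglongrightarrow> a * 0" by (intro tendsto_intros LIMSEQ_Suc r_lim)
        then have "\<forall>\<^sub>F j in sequentially. a * r (Suc j) < \<rho>" using 2 by (intro order_tendstoD(2)) auto
        then show ?thesis by (auto simp: eventually_sequentially intro: less_imp_le)
      qed
      then obtain j where j: "a * r (Suc j) \<le> \<rho>" "\<And>i. i < j \<Longrightarrow> \<rho> < a * r (Suc i)"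
        using exists_least_iff[of "\<lambda>j. a * r (Suc j) \<le> \<rho>"] by (auto simp: not_le)
      have "\<rho> < a * r j" using j(2)[of "j - 1"] 2 by (cases j) (auto simp: r_def)
      have "r j \<le> 2 powr \<beta> / a * \<rho>"
        using j(1) a unfolding r_mono by (simp add: field_simps powr_minus)
      then have "r j powr s \<le> (2 powr \<beta> / a * \<rho>) powr s" using rpos[of j] s by (intro powr_mono2) auto
      also have "\<dots> = (2 powr \<beta> / a) powr s * \<rho> powr s" by (rule powr_mult)
      finally have "\<bar>B\<bar> * K * r j powr s \<le> \<bar>B\<bar> * K * ((2 powr \<beta> / a) powr s * \<rho> powr s)"
        using K0 by (intro mult_left_mono) auto
      also have "\<dots> \<le> C * \<rho> powr s" by (simp add: C_def algebra_simps)
      finally show ?thesis using near[OF \<open>\<rho> < a * r j\<close>, of u] mW[of j]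
        by (intro bexI[of _ "W u j"]) auto
    next
      case 3
      have "1 = a powr - s * a powr s" using a by (simp flip: powr_add)
      also have "\<dots> \<le> a powr - s * \<rho> powr s" using 3 a s by (intro mult_left_mono powr_mono2) auto
      also have "\<dots> \<le> C * \<rho> powr s" using K0 by (intro mult_right_mono) (auto simp: C_def)
      finally have "measure \<sigma> UNIV \<le> C * \<rho> powr s" using prob_le_1[of UNIV] by linarith
      then show ?thesis by (intro bexI[of _ UNIV]) auto
    qed
  qed
qed

text \<open>
  The constants \<open>B\<close> depend on \<open>u\<close>. The sets \<open>G N\<close> of directions with a constant at most \<open>N\<close> exhaust
  almost every direction, so one of them has positive mass and carries a uniform bound.
\<close>

lemma (in segment_sum) hausdorff_measure_extreme_points_pos:
  fixes \<sigma> :: "'a measure"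
  assumes \<sigma>: "uniform_on_sphere \<sigma>"
    and \<beta>: "0 < \<beta>" and s: "0 \<le> s" "\<beta> * s < real (DIM('a) - 1)"
    and c: "0 < c" "\<And>k. c * real (k + 1) powr - \<beta> \<le> \<gamma> k" and \<eta>: "0 < \<eta>"
    and unsplit: "AE u in \<sigma>. \<exists>B::real. \<forall>j. measure \<sigma> {v. \<forall>i<2^j. \<not> splits \<eta> (\<epsilon> i) u v} * (2 ^ j) ^ (DIM('a) - 1)
      \<le> B * real (j + 1) ^ 2"
  shows "hausdorff_measure s {x. x extreme_point_of zonoid} \<noteq> 0"
proof -
  interpret prob_space \<sigma> using \<sigma> by (rule uniform_on_sphereD)
  note [simp, measurable_cong] = uniform_on_sphereD(2)[OF \<sigma>]
  note [simp] = uniform_on_sphereD(3)[OF \<sigma>]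
  define f where "f j u = measure \<sigma> {v. \<forall>i<2^j. \<not> splits \<eta> (\<epsilon> i) u v} * (2 ^ j) ^ (DIM('a) - 1)" for j u
  have [measurable]: "f j \<in> borel_measurable borel" for j
  proof -
    have "measure \<sigma> {v. \<forall>i<2^j. \<not> splits \<eta> (\<epsilon> i) u v}
        = enn2real (\<integral>\<^sup>+v. (if \<forall>i<2^j. \<not> splits \<eta> (\<epsilon> i) u v then 1 else 0) \<partial>\<sigma>)" for u
    proof -
      have "(\<integral>\<^sup>+v. (if \<forall>i<2^j. \<not> splits \<eta> (\<epsilon> i) u v then 1 else 0) \<partial>\<sigma>)
          = (\<integral>\<^sup>+v. indicator {v. \<forall>i<2^j. \<not> splits \<eta> (\<epsilon> i) u v} v \<partial>\<sigma>)"
        by (intro nn_integral_cong) auto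
      then show ?thesis by (simp add: measure_def)
    qed
    then show ?thesis unfolding f_def by simp
  qed
  define G where "G N = {u. (\<forall>k. u \<bullet> \<epsilon> k \<noteq> 0) \<and> (\<forall>j. f j u \<le> real N * real (j + 1) ^ 2)}" for N :: nat
  have [measurable]: "G N \<in> sets borel" for N unfolding G_def by measurable
  have "AE u in \<sigma>. u \<bullet> \<epsilon> k \<noteq> 0" for k
  proof -
    have "measure \<sigma> {u. \<bar>u \<bullet> \<epsilon> k\<bar> \<le> 0} \<le> 0"
      using uniform_slab_le[OF \<sigma>, of "\<epsilon> k" 0] \<epsilon>_unit[of k] by simp
    then have "emeasure \<sigma> {u. u \<bullet> \<epsilon> k = 0} = 0" by (simp add: emeasure_eq_measure measure_le_0_iff)
    then show ?thesis by (intro AE_I[of _ _ "{u. u \<bullet> \<epsilon> k = 0}"]) auto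
  qed
  then have "AE u in \<sigma>. \<forall>k. u \<bullet> \<epsilon> k \<noteq> 0" by (simp add: AE_all_countable)
  with unsplit have "AE u in \<sigma>. u \<in> (\<Union>N. G N)"
  proof eventually_elim
    case (elim u)
    then obtain B :: real where B: "\<And>j. f j u \<le> B * real (j + 1) ^ 2" unfolding f_def by blast
    have "f j u \<le> real (nat \<lceil>B\<rceil>) * real (j + 1) ^ 2" for j
    proof -
      have "B \<le> real (nat \<lceil>B\<rceil>)" by linarith
      then have "B * real (j + 1) ^ 2 \<le> real (nat \<lceil>B\<rceil>) * real (j + 1) ^ 2" by (rule mult_right_mono) simp
      with B[of j] show ?thesis by linarith
    qed
    then show ?case using elim(2) by (auto simp: G_def)
  qed
  then have "prob (\<Union>N. G N) = 1" by (subst prob_eq_1) auto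
  then have "emeasure \<sigma> (\<Union>N. G N) \<noteq> 0" by (simp add: emeasure_eq_measure)
  moreover have "range G \<subseteq> sets \<sigma>" by auto
  ultimately obtain N where N: "emeasure \<sigma> (G N) \<noteq> 0"
    using emeasure_UN_eq_0[of \<sigma> G] by blast
  obtain C where C: "\<And>u \<rho>. u \<in> G N \<Longrightarrow> 0 \<le> \<rho> \<Longrightarrow>
    \<exists>W\<in>sets \<sigma>. {v \<in> G N. dist (vertex v) (vertex u) \<le> \<rho>} \<subseteq> W \<and> measure \<sigma> W \<le> C * (if s = 0 then 1 else \<rho> powr s)"
  proof (cases "s = 0")
    case True
    then show ?thesis using prob_le_1[of UNIV] by (intro that[of 1] bexI[of _ UNIV]) auto
  next
    case False
    then have "0 < s" using s by simp
    from mass_near_vertex_le[OF prob_space_axioms uniform_on_sphereD(2)[OF \<sigma>] \<beta> this s(2) c \<eta>, of "real N"]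
    obtain C where C: "\<And>u \<rho>. \<forall>j. measure \<sigma> {v. \<forall>i<2^j. \<not> splits \<eta> (\<epsilon> i) u v} * (2 ^ j) ^ (DIM('a) - 1) \<le> real N * real (j + 1) ^ 2 \<Longrightarrow>
      0 \<le> \<rho> \<Longrightarrow> \<exists>W\<in>sets \<sigma>. {v. dist (vertex v) (vertex u) \<le> \<rho>} \<subseteq> W \<and> measure \<sigma> W \<le> C * \<rho> powr s" by blast
    show ?thesis
    proof (rule that[of C])
      fix u \<rho> assume "u \<in> G N" "0 \<le> (\<rho>::real)"
      then show "\<exists>W\<in>sets \<sigma>. {v \<in> G N. dist (vertex v) (vertex u) \<le> \<rho>} \<subseteq> W \<and> measure \<sigma> W \<le> C * (if s = 0 then 1 else \<rho> powr s)"
        using C[of u \<rho>] False by (auto simp: G_def f_def)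
    qed
  qed
  show ?thesis
  proof (rule hausdorff_measure_pos_of_mass[where x=vertex and G="G N", OF finite_measure_axioms _ _ _ C])
    show "0 < measure \<sigma> (G N)" using N by (simp add: emeasure_eq_measure less_le)
    show "vertex ` G N \<subseteq> {x. x extreme_point_of zonoid}"
      using vertex_extreme_point by (auto simp: G_def)
  qed auto
qed

section \<open>Growth of the arrival times\<close>

text \<open>
  Tilting the standard exponential density by \<open>exp ((1 - l) * x)\<close> gives the density of rate \<open>l\<close>, up to
  the factor \<open>1 / l\<close>.
\<close>

lemma (in prob_space) exponential_exp_moment:
  assumes X: "distributed M lborel X (exponential_density 1)" and l: "0 < l"
  shows "(\<integral>\<^sup>+\<omega>. ennreal (exp ((1 - l) * X \<omega>)) \<partial>M) = ennreal (1 / l)"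
proof -
  have "(\<integral>\<^sup>+\<omega>. ennreal (exp ((1 - l) * X \<omega>)) \<partial>M)
      = (\<integral>\<^sup>+x. ennreal (exponential_density 1 x) * ennreal (exp ((1 - l) * x)) \<partial>lborel)"
    by (rule distributed_nn_integral[OF X, symmetric]) measurable
  also have "\<dots> = (\<integral>\<^sup>+x. ennreal (1 / l) * ennreal (exponential_density l x) \<partial>lborel)"
  proof (rule nn_integral_cong)
    fix x
    have "exponential_density 1 x * exp ((1 - l) * x) = 1 / l * exponential_density l x"
      using l by (simp add: exponential_density_def algebra_simps flip: exp_add)
    then show "ennreal (exponential_density 1 x) * ennreal (exp ((1 - l) * x)) = ennreal (1 / l) * ennreal (exponential_density l x)"
      using l by (simp add: exponential_density_nonneg flip: ennreal_mult)
  qed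
  also have "\<dots> = ennreal (1 / l) * (\<integral>\<^sup>+x. ennreal (exponential_density l x) \<partial>lborel)"
    by (rule nn_integral_cmult) measurable
  also have "(\<integral>\<^sup>+x. ennreal (exponential_density l x) \<partial>lborel) = 1"
    using prob_space.emeasure_space_1[OF prob_space_exponential_density[OF l]]
    by (simp add: emeasure_density)
  finally show ?thesis by simp
qed

text \<open>
  The random variables on the left have expectation exactly 1.
\<close>

lemma (in prob_space) arrival_time_exp_bound:
  assumes X: "\<And>k. distributed M lborel (\<tau> k) (exponential_density 1)"
    and indep: "indep_vars (\<lambda>_. borel) \<tau> UNIV" and l: "0 < l"
  shows "AE \<omega> in M. \<exists>B::real. \<forall>j. exp ((1 - l) * arrival_time \<tau> j \<omega>) * l ^ (j + 1) \<le> B * real (j + 1) ^ 2"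
proof -
  have rv [measurable]: "\<tau> k \<in> borel_measurable M" for k using indep by (auto simp: indep_vars_def)
  have [measurable]: "arrival_time \<tau> j \<in> borel_measurable M" for j
    unfolding arrival_time_def[abs_def] by measurable
  have "AE \<omega> in M. \<exists>B::real. \<forall>j. ennreal (exp ((1 - l) * arrival_time \<tau> j \<omega>) * l ^ (j + 1)) \<le> ennreal (B * real (j + 1) ^ 2)"
  proof (rule AE_quadratic_growth)
    fix j
    have "(\<integral>\<^sup>+\<omega>. ennreal (exp ((1 - l) * arrival_time \<tau> j \<omega>) * l ^ (j + 1)) \<partial>M)
        = (\<integral>\<^sup>+\<omega>. (\<Prod>i\<le>j. ennreal (exp ((1 - l) * \<tau> i \<omega>))) * ennreal (l ^ (j + 1)) \<partial>M)"
    proof (rule nn_integral_cong)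
      fix \<omega>
      have "exp ((1 - l) * arrival_time \<tau> j \<omega>) = (\<Prod>i\<le>j. exp ((1 - l) * \<tau> i \<omega>))"
        unfolding arrival_time_def sum_distrib_left by (rule exp_sum) simp
      then show "ennreal (exp ((1 - l) * arrival_time \<tau> j \<omega>) * l ^ (j + 1)) = (\<Prod>i\<le>j. ennreal (exp ((1 - l) * \<tau> i \<omega>))) * ennreal (l ^ (j + 1))"
        using l by (simp only: prod_ennreal exp_ge_zero) (simp add: ennreal_mult prod_nonneg)
    qed
    also have "\<dots> = (\<integral>\<^sup>+\<omega>. (\<Prod>i\<le>j. ennreal (exp ((1 - l) * \<tau> i \<omega>))) \<partial>M) * ennreal (l ^ (j + 1))"
      by (rule nn_integral_multc) measurable
    also have "(\<integral>\<^sup>+\<omega>. (\<Prod>i\<le>j. ennreal (exp ((1 - l) * \<tau> i \<omega>))) \<partial>M) = (\<Prod>i\<le>j. \<integral>\<^sup>+\<omega>. ennreal (exp ((1 - l) * \<tau> i \<omega>)) \<partial>M)"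
    proof (rule indep_vars_nn_integral)
      have "indep_vars (\<lambda>_. borel) \<tau> {..j}" by (rule indep_vars_subset[OF indep]) auto
      then show "indep_vars (\<lambda>_. borel) (\<lambda>i \<omega>. ennreal (exp ((1 - l) * \<tau> i \<omega>))) {..j}"
        by (rule indep_vars_compose2) measurable
    qed auto
    also have "\<dots> = ennreal ((1 / l) ^ (j + 1))"
      using l by (subst exponential_exp_moment[OF X l]) (simp add: ennreal_power del: power_Suc)
    also have "\<dots> * ennreal (l ^ (j + 1)) = 1"
      using l by (simp add: power_divide flip: ennreal_mult)
    finally show "(\<integral>\<^sup>+\<omega>. ennreal (exp ((1 - l) * arrival_time \<tau> j \<omega>) * l ^ (j + 1)) \<partial>M) \<le> ennreal 1" by simp
  qed measurable
  then show ?thesis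
  proof eventually_elim
    case (elim \<omega>)
    then obtain B :: real where B: "\<And>j. ennreal (exp ((1 - l) * arrival_time \<tau> j \<omega>) * l ^ (j + 1)) \<le> ennreal (B * real (j + 1) ^ 2)"
      by blast
    have "exp ((1 - l) * arrival_time \<tau> j \<omega>) * l ^ (j + 1) \<le> \<bar>B\<bar> * real (j + 1) ^ 2" for j
    proof -
      have "ennreal (B * real (j + 1) ^ 2) \<le> ennreal (\<bar>B\<bar> * real (j + 1) ^ 2)"
        by (intro ennreal_leI mult_right_mono) auto
      with B[of j] have "ennreal (exp ((1 - l) * arrival_time \<tau> j \<omega>) * l ^ (j + 1)) \<le> ennreal (\<bar>B\<bar> * real (j + 1) ^ 2)"
        by (rule order_trans)
      then show ?thesis by (subst (asm) ennreal_le_iff) auto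
    qed
    then show ?case by blast
  qed
qed

lemma ln_growth:
  assumes "0 < y" "y \<le> B * real (j + 1) ^ 2"
  shows "ln y \<le> ln (\<bar>B\<bar> + 1) + 4 + real (j + 1) / 4"
proof -
  let ?n = "real (j + 1)"
  have n: "0 < ?n" by simp
  have "y \<le> (\<bar>B\<bar> + 1) * ?n ^ 2"
    by (rule order_trans[OF assms(2)]) (intro mult_right_mono, auto)
  then have "ln y \<le> ln ((\<bar>B\<bar> + 1) * ?n ^ 2)" using assms(1) by (intro ln_mono) auto
  also have "\<dots> = ln (\<bar>B\<bar> + 1) + 2 * ln ?n" by (subst ln_mult) (auto simp: ln_realpow)
  finally have "ln y \<le> ln (\<bar>B\<bar> + 1) + 2 * ln ?n" .
  moreover have "ln ?n \<le> ?n / 8 + 2"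
  proof -
    have "ln (?n / 8) \<le> ?n / 8 - 1" by (rule ln_le_minus_one) simp
    moreover have "ln (?n / 8) = ln ?n - 3 * ln 2"
      using ln_realpow[of 2 3] by (simp add: ln_div)
    moreover have "ln 2 \<le> (1::real)" using ln_le_minus_one[of 2] by simp
    ultimately show ?thesis by linarith
  qed
  ultimately show ?thesis by linarith
qed

text \<open>
  The exponential bounds with \<open>l = 2\<close> and \<open>l = 1 / 2\<close> give a linear lower and upper bound, both up to
  an additive constant. In the lower bound the constant is removed by comparison with the first
  arrival time, which is positive and the smallest.
\<close>

lemma (in prob_space) arrival_time_linear_growth:
  assumes X: "\<And>k. distributed M lborel (\<tau> k) (exponential_density 1)"
    and indep: "indep_vars (\<lambda>_. borel) \<tau> UNIV"
  shows "AE \<omega> in M. \<exists>c C. 0 < c \<and> 0 < C \<and>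
    (\<forall>k. c * real (k + 1) \<le> arrival_time \<tau> k \<omega> \<and> arrival_time \<tau> k \<omega> \<le> C * real (k + 1))"
proof -
  have pos: "AE \<omega> in M. 0 < \<tau> k \<omega>" for k
  proof -
    have "\<P>(\<omega> in M. 0 < \<tau> k \<omega>) = 1" using exponential_distributedD_gt[OF X, of 0 k] by simp
    moreover have "\<tau> k \<in> borel_measurable M" using X[of k] by (auto dest: distributed_measurable)
    ultimately show ?thesis using AE_prob_1[of "{\<omega>\<in>space M. 0 < \<tau> k \<omega>}"] by simp
  qed
  then have "AE \<omega> in M. \<forall>k. 0 < \<tau> k \<omega>" by (simp add: AE_all_countable)
  moreover have "AE \<omega> in M. \<exists>B::real. \<forall>j. exp (- arrival_time \<tau> j \<omega>) * 2 ^ (j + 1) \<le> B * real (j + 1) ^ 2"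
    using arrival_time_exp_bound[OF X indep, of 2] by simp
  moreover have "AE \<omega> in M. \<exists>B::real. \<forall>j. exp (arrival_time \<tau> j \<omega> / 2) * (1/2) ^ (j + 1) \<le> B * real (j + 1) ^ 2"
    using arrival_time_exp_bound[OF X indep, of "1/2"] by simp
  ultimately show ?thesis
  proof eventually_elim
    case (elim \<omega>)
    then obtain B B' :: real where
      B: "\<And>j. exp (- arrival_time \<tau> j \<omega>) * 2 ^ (j + 1) \<le> B * real (j + 1) ^ 2" and
      B': "\<And>j. exp (arrival_time \<tau> j \<omega> / 2) * (1/2) ^ (j + 1) \<le> B' * real (j + 1) ^ 2"
      by blast
    define A where "A = ln (\<bar>B\<bar> + 1) + 4"
    define A' where "A' = ln (\<bar>B'\<bar> + 1) + 4"
    have A: "0 \<le> A" "0 \<le> A'" by (auto simp: A_def A'_def)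
    have ln2: "1 / 2 \<le> ln (2::real)" "ln (2::real) \<le> 1"
      using ln_le_minus_one[of "1/2::real"] ln_le_minus_one[of 2] by (auto simp: ln_div)
    define g where "g = \<tau> 0 \<omega>"
    have g: "0 < g" using elim by (simp add: g_def)
    have ge: "g \<le> arrival_time \<tau> k \<omega>" for k
      unfolding arrival_time_def g_def using elim by (intro member_le_sum) (auto intro: less_imp_le)
    have lower: "real (k + 1) / 4 - A \<le> arrival_time \<tau> k \<omega>" for k
    proof -
      have "ln (exp (- arrival_time \<tau> k \<omega>) * 2 ^ (k + 1)) \<le> A + real (k + 1) / 4"
        unfolding A_def by (rule ln_growth[OF _ B]) simp
      moreover have "ln (exp (- arrival_time \<tau> k \<omega>) * 2 ^ (k + 1)) = - arrival_time \<tau> k \<omega> + real (k + 1) * ln 2"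
        by (subst ln_mult) (auto simp: ln_realpow algebra_simps simp del: power_Suc)
      moreover have "real (k + 1) * (1 / 2) \<le> real (k + 1) * ln 2" using ln2 by (intro mult_left_mono) auto
      ultimately show ?thesis by linarith
    qed
    have upper: "arrival_time \<tau> k \<omega> \<le> 2 * A' + 3 * real (k + 1)" for k
    proof -
      have "ln (exp (arrival_time \<tau> k \<omega> / 2) * (1/2) ^ (k + 1)) \<le> A' + real (k + 1) / 4"
        unfolding A'_def by (rule ln_growth[OF _ B']) simp
      moreover have "ln (exp (arrival_time \<tau> k \<omega> / 2) * (1/2) ^ (k + 1)) = arrival_time \<tau> k \<omega> / 2 - real (k + 1) * ln 2"
        by (subst ln_mult) (auto simp: ln_realpow ln_div algebra_simps simp del: power_Suc)
      moreover have "real (k + 1) * ln 2 \<le> real (k + 1) * 1" using ln2 by (intro mult_left_mono) auto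
      ultimately show ?thesis by linarith
    qed
    show ?case
    proof (intro exI conjI allI)
      show "0 < 1 / (4 * (1 + A / g))" using A g by (intro divide_pos_pos) (auto intro: add_pos_nonneg)
      show "0 < 2 * A' + 3" using A by simp
      fix k
      have "A / g * g = A" using g by simp
      then have "real (k + 1) / 4 \<le> arrival_time \<tau> k \<omega> + A / g * g" using lower[of k] by linarith
      also have "\<dots> \<le> arrival_time \<tau> k \<omega> + A / g * arrival_time \<tau> k \<omega>"
        using ge A g by (intro add_left_mono mult_left_mono) auto
      finally have "real (k + 1) / 4 \<le> (1 + A / g) * arrival_time \<tau> k \<omega>" by (simp add: algebra_simps)
      moreover have "0 < 1 + A / g" using A g by (intro add_pos_nonneg) auto
      moreover have "1 / (4 * b) * n \<le> x" if "n / 4 \<le> b * x" "0 < b" for b n x :: real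
        using that by (simp add: field_simps)
      ultimately show "1 / (4 * (1 + A / g)) * real (k + 1) \<le> arrival_time \<tau> k \<omega>" by blast
      have "2 * A' * 1 \<le> 2 * A' * real (k + 1)" using A by (intro mult_left_mono) auto
      then show "arrival_time \<tau> k \<omega> \<le> (2 * A' + 3) * real (k + 1)" using upper[of k] by (simp add: algebra_simps)
    qed
  qed
qed

section \<open>The dimension of the set of extreme points\<close>

theorem theorem2p1:
  fixes M :: "'w measure"
    and \<alpha> :: real
    and \<tau> :: "nat \<Rightarrow> 'w \<Rightarrow> real"
    and \<epsilon> :: "nat \<Rightarrow> 'w \<Rightarrow> real ^ 'd"
  assumes "prob_space M"
    and "CARD('d) \<ge> 2"
    and "0 < \<alpha>" and "\<alpha> < 1"
    and "\<And>k. distributed M lborel (\<tau> k) (exponential_density 1)"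
    and "prob_space.indep_vars M (\<lambda>_. borel) \<tau> UNIV"
    and "\<And>k. uniform_on_sphere (distr M borel (\<epsilon> k))"
    and "prob_space.indep_vars M (\<lambda>_. borel) \<epsilon> UNIV"
    and "prob_space.indep_set M
           (sets (vimage_algebra (space M) (\<lambda>\<omega> k. \<tau> k \<omega>) (PiM UNIV (\<lambda>_. borel))))
           (sets (vimage_algebra (space M) (\<lambda>\<omega> k. \<epsilon> k \<omega>) (PiM UNIV (\<lambda>_. borel))))"
  shows "AE \<omega> in M.
           hausdorff_dim {x. x extreme_point_of stable_zonoid \<alpha> \<tau> \<epsilon> \<omega>}
             = ennreal ((real CARD('d) - 1) * \<alpha>)"
proof -
  interpret prob_space M by fact
  define d where "d = DIM(real ^ 'd) - 1"
  have D: "2 \<le> DIM(real ^ 'd)" using assms(2) by simp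
  have d: "real d = real CARD('d) - 1" using assms(2) by (simp add: d_def)
  define \<beta> where "\<beta> = 1 / \<alpha>"
  have \<beta>: "1 < \<beta>" using assms(3,4) by (simp add: \<beta>_def)
  have \<beta>s: "real d < \<beta> * s \<longleftrightarrow> real d * \<alpha> < s" "\<beta> * s < real d \<longleftrightarrow> s < real d * \<alpha>" for s
    using assms(3) by (auto simp: \<beta>_def field_simps)
  define \<eta> where "\<eta> = 1 / (real DIM(real ^ 'd) + 1)"
  have \<eta>: "0 < \<eta>" by (simp add: \<eta>_def)
  have "\<exists>P :: (real ^ 'd) set. finite P \<and> card P \<le> 2 * DIM(real ^ 'd) * (2 ^ j) ^ d \<and> (\<forall>c\<in>P. 1 \<le> norm c) \<and>
      (\<forall>u. u \<noteq> 0 \<longrightarrow> (\<exists>c\<in>P. \<exists>t>0. norm (t *\<^sub>R u - c) \<le> real DIM(real ^ 'd) / 2 ^ j))" for j :: nat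
    using direction_net[of "2 ^ j", where 'a="real ^ 'd"] unfolding d_def
    by (metis of_nat_numeral of_nat_power zero_less_numeral zero_less_power)
  then obtain P :: "nat \<Rightarrow> (real ^ 'd) set" where P: "\<And>j. finite (P j)"
    "\<And>j. card (P j) \<le> 2 * DIM(real ^ 'd) * (2 ^ j) ^ d" "\<And>j c. c \<in> P j \<Longrightarrow> 1 \<le> norm c"
    "\<And>j u. u \<noteq> 0 \<Longrightarrow> \<exists>c\<in>P j. \<exists>t>0. norm (t *\<^sub>R u - c) \<le> real DIM(real ^ 'd) / 2 ^ j"
    by metis
  have unit: "AE \<omega> in M. \<forall>k. norm (\<epsilon> k \<omega>) = 1"
  proof -
    have rv: "\<epsilon> k \<in> borel_measurable M" for k using assms(8) by (auto simp: indep_vars_def)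
    have "AE \<omega> in M. norm (\<epsilon> k \<omega>) = 1" for k
      using uniform_on_sphereD(4)[OF assms(7)[of k]] by (subst (asm) AE_distr_iff[OF rv]) auto
    then show ?thesis by (simp add: AE_all_countable)
  qed
  have hits: "AE \<omega> in M. \<exists>B::real. \<forall>j. (\<Sum>c\<in>P j. exp (\<Sum>k. hit_cost \<beta> (2 ^ j) k *
      indicator {e. \<bar>e \<bullet> c\<bar> \<le> real DIM(real ^ 'd) / 2 ^ j} (\<epsilon> k \<omega>))) \<le> B * real (j + 1) ^ 2 * (2 ^ j) ^ (DIM(real ^ 'd) - 1)"
    using P(3) by (intro AE_hits_bound[OF assms(8,7) \<beta> P(1) P(2)[unfolded d_def]]) blast
  note unsplit = AE_unsplit_bound[OF assms(8,7) assms(7)[of 0] D \<eta>_def]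
  from hits unsplit unit arrival_time_linear_growth[OF assms(5,6)]
  show ?thesis
  proof eventually_elim
    case (elim \<omega>)
    obtain B :: real where B: "\<And>j. (\<Sum>c\<in>P j. exp (\<Sum>k. hit_cost \<beta> (2 ^ j) k *
        indicator {e. \<bar>e \<bullet> c\<bar> \<le> real DIM(real ^ 'd) / 2 ^ j} (\<epsilon> k \<omega>))) \<le> B * real (j + 1) ^ 2 * (2 ^ j) ^ (DIM(real ^ 'd) - 1)"
      using elim(1) by blast
    obtain c C where cC: "0 < c" "0 < C"
      "\<And>k. c * real (k + 1) \<le> arrival_time \<tau> k \<omega>" "\<And>k. arrival_time \<tau> k \<omega> \<le> C * real (k + 1)"
      using elim(4) by blast
    define \<gamma> where "\<gamma> k = arrival_time \<tau> k \<omega> powr (- 1 / \<alpha>)" for k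
    have pos: "0 < arrival_time \<tau> k \<omega>" for k
      using cC(1) by (intro less_le_trans[OF _ cC(3)]) simp
    have \<gamma>_le: "\<gamma> k \<le> c powr - \<beta> * real (k + 1) powr - \<beta>" for k
    proof -
      have "\<gamma> k \<le> (c * real (k + 1)) powr - \<beta>"
        unfolding \<gamma>_def \<beta>_def using cC(1,3) assms(3) by (simp only: minus_divide_left, intro powr_mono2') auto
      then show ?thesis using cC(1) by (simp add: powr_mult)
    qed
    have \<gamma>_ge: "C powr - \<beta> * real (k + 1) powr - \<beta> \<le> \<gamma> k" for k
    proof -
      have "(C * real (k + 1)) powr - \<beta> \<le> \<gamma> k"
        unfolding \<gamma>_def \<beta>_def using pos cC(4) assms(3) by (simp only: minus_divide_left, intro powr_mono2') auto
      then show ?thesis using cC(2) by (simp add: powr_mult)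
    qed
    interpret segment_sum \<gamma> "\<lambda>k. \<epsilon> k \<omega>"
    proof
      show "0 < \<gamma> k" for k using pos[of k] by (simp add: \<gamma>_def)
      have "summable (\<lambda>k. real (k + 1) powr - \<beta>)"
        using powr_tail_le(1)[OF \<beta>, of 1] summable_iff_shift[of "\<lambda>k. real (k + 1) powr - \<beta>" 1] by simp
      then have "summable (\<lambda>k. c powr - \<beta> * real (k + 1) powr - \<beta>)" by (rule summable_mult)
      then show "summable \<gamma>"
        by (rule summable_comparison_test') (use \<gamma>_le in \<open>auto simp: \<gamma>_def\<close>)
      show "norm (\<epsilon> k \<omega>) = 1" for k using elim(3) by blast
    qed
    have Z: "stable_zonoid \<alpha> \<tau> \<epsilon> \<omega> = zonoid"
      using hausdorff_lim_partial_sums unfolding stable_zonoid_def partial_zonotope_def \<gamma>_def .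
    let ?F = "{x. x extreme_point_of zonoid}"
    have upper: "hausdorff_dim ?F \<le> ennreal s" if s: "real d * \<alpha> < s" for s
    proof -
      have s0: "0 < s" using s assms(3) by (intro le_less_trans[OF _ s]) auto
      have "hausdorff_measure s ?F = 0"
      proof (rule hausdorff_measure_extreme_points_eq_0[OF \<beta> s0 _ _ \<gamma>_le P(1,4) B])
        show "real (DIM(real ^ 'd) - 1) < \<beta> * s" using \<beta>s(1) s unfolding d_def by blast
        show "0 < c powr - \<beta>" using cC by simp
      qed
      then show ?thesis unfolding hausdorff_dim_def using s0 by (intro INF_lower) auto
    qed
    have lower: "real d * \<alpha> \<le> s" if s: "0 \<le> s" "hausdorff_measure s ?F = 0" for s
    proof (rule ccontr)
      assume "\<not> real d * \<alpha> \<le> s"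
      then have "\<beta> * s < real (DIM(real ^ 'd) - 1)" using \<beta>s(2)[of s] unfolding d_def by simp
      moreover have "0 < C powr - \<beta>" using cC by simp
      ultimately have "hausdorff_measure s ?F \<noteq> 0"
        using \<beta> by (intro hausdorff_measure_extreme_points_pos[OF assms(7)[of 0] _ s(1) _ _ \<gamma>_ge \<eta> elim(2)]) auto
      then show False using s by simp
    qed
    have "hausdorff_dim ?F = ennreal (real d * \<alpha>)"
    proof (rule antisym)
      show "ennreal (real d * \<alpha>) \<le> hausdorff_dim ?F"
        unfolding hausdorff_dim_def using lower by (intro INF_greatest ennreal_leI) auto
      show "hausdorff_dim ?F \<le> ennreal (real d * \<alpha>)"
      proof (rule ennreal_le_epsilon)
        fix e :: real assume "0 < e"
        then show "hausdorff_dim ?F \<le> ennreal (real d * \<alpha>) + ennreal e"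
          using upper[of "real d * \<alpha> + e"] assms(3) by (simp flip: ennreal_plus)
      qed
    qed
    then show ?case by (simp add: Z d)
  qed
qed

end
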